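(* If $X_t\in\mathcal C_{k,l}$ and $l>0$, then $S_1$ satisfies the following identity in distribution: $$S_1\times\left[\varepsilon_1\prod_{j=1}^{l-1}\frac{\gamma_{\{\alpha^{-1}j\}}}{\gamma_{1-\{\alpha^{-1}j\}}}\right]^{\frac1\alpha}\overset{d}{=}\varepsilon_2\prod_{j=1}^{k}\frac{\gamma_{1-\{\alpha j\}}}{\gamma_{\{\alpha j\}}},$$ where $\{x\}\in[0,1)$ denotes the fractional part of $x$, $\varepsilon_i\sim\mathrm{Exp}(1)$, $\gamma_c$ denotes a gamma random variable with $\mathbb E[\gamma_c]=\mathrm{Var}[\gamma_c]=c$, and all random variables are assumed to be independent.
   Context: The admissible set is $\mathcal A=\{\alpha\in(0,1),\rho\in(0,1)\}\cup\{\alpha=1,\rho=\frac12\}\cup\{\alpha\in(1,2),\rho\in[1-\alpha^{-1},\alpha^{-1}]\}$. For $(\alpha,\rho)\in\mathcal A$, $X_t$ is the stable Lévy process with $X_0=0$, $\mathbb E[e^{izX_t}]=e^{-t\Psi(z)}$, $z\in\mathbb R$, $\Psi(z)=e^{\pi i\gamma/2}|z|^\alpha$ for $z>0$, $\Psi(z)=e^{-\pi i\gamma/2}|z|^\alpha$ for $z<0$, with the number $\gamma=\alpha(1-2\rho)$ (unrelated to the gamma variables $\gamma_c$). $S_t=\sup_{0\le u\le t}X_u$. For $k,l\in\mathbb Z$, $\mathcal C_{k,l}$ is the class of stable processes with $(\alpha,\rho)\in\mathcal A$ and $\rho+k=\frac l\alpha$. If $\alpha=\frac mn$ is rational ($m,n$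 coprime), the pair $(k,l)$ is not unique and one takes the representative with $0\le k<n$, $1\le l<m$. Empty products equal $1$. $\mathrm{Exp}(1)$ is the exponential law with mean $1$; the gamma law with mean and variance $c$ has density $x^{c-1}e^{-x}/\Gamma(c)$ on $(0,\infty)$. *)

theory Defs
  imports "HOL-Probability.Probability"
begin

definition admissible :: "(real \<times> real) set" where
  "admissible =
     {(\<alpha>, \<rho>). \<alpha> \<in> {0<..<1} \<and> \<rho> \<in> {0<..<1}}
   \<union> {(1, 1/2)}
   \<union> {(\<alpha>, \<rho>). \<alpha> \<in> {1<..<2} \<and> \<rho> \<in> {1 - 1/\<alpha>..1/\<alpha>}}"

definition cadlag :: "(real \<Rightarrow> real) \<Rightarrow> bool" where
  "cadlag f \<longleftrightarrow>
     (\<forall>t\<ge>0. (f \<longlongrightarrow> f t) (at_right t)) \<and>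
     (\<forall>t>0. \<exists>l. (f \<longlongrightarrow> l) (at_left t))"

(* Time runs over [0, \<infinity>); the values of X at negative times are irrelevant. *)
locale levy_process = prob_space M for M :: "'a measure" +
  fixes X :: "real \<Rightarrow> 'a \<Rightarrow> real"
  assumes measurable_X: "\<And>t. 0 \<le> t \<Longrightarrow> random_variable borel (X t)"
    and X_zero: "AE \<omega> in M. X 0 \<omega> = 0"
    and independent_increments:
      "\<And>(n::nat) (t :: nat \<Rightarrow> real).
         0 \<le> t 0 \<Longrightarrow> (\<And>i. i < n \<Longrightarrow> t i \<le> t (Suc i)) \<Longrightarrow>
         indep_vars (\<lambda>_. borel) (\<lambda>i \<omega>. X (t (Suc i)) \<omega> - X (t i) \<omega>) {..<n}"
    and stationary_increments:
      "\<And>s t. 0 \<le> s \<Longrightarrow> 0 \<le> t \<Longrightarrow>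
         distr M borel (\<lambda>\<omega>. X (s + t) \<omega> - X s \<omega>) = distr M borel (X t)"
    and cadlag_paths: "AE \<omega> in M. cadlag (\<lambda>t. X t \<omega>)"

(* The characteristic exponent; the value 0 at z = 0 is forced by E[exp(0)] = 1. *)
definition stable_exponent :: "real \<Rightarrow> real \<Rightarrow> real \<Rightarrow> complex" where
  "stable_exponent \<alpha> \<rho> z =
     (let \<gamma> = \<alpha> * (1 - 2 * \<rho>) in
      if z > 0 then exp (\<i> * of_real (pi * \<gamma> / 2)) * of_real (\<bar>z\<bar> powr \<alpha>)
      else if z < 0 then exp (- (\<i> * of_real (pi * \<gamma> / 2))) * of_real (\<bar>z\<bar> powr \<alpha>)
      else 0)"

locale stable_process = levy_process +
  fixes \<alpha> \<rho> :: real
  assumes parameters: "(\<alpha>, \<rho>) \<in> admissible"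
    and char_X: "\<And>t z. 0 \<le> t \<Longrightarrow>
      char (distr M borel (X t)) z = exp (- (of_real t * stable_exponent \<alpha> \<rho> z))"

(* The class C_{k,l} of stable processes. *)
locale stable_process_class = stable_process +
  fixes k l :: int
  assumes class_eq: "\<rho> + of_int k = of_int l / \<alpha>"

(* For rational \<alpha> the pair (k, l) with \<rho> + k = l / \<alpha> is not unique; this selects
   the conventional one. It is no restriction when \<alpha> is irrational. *)
definition canonical_indices :: "real \<Rightarrow> int \<Rightarrow> int \<Rightarrow> bool" where
  "canonical_indices \<alpha> k l \<longleftrightarrow>
     (\<forall>m n :: int. n > 0 \<longrightarrow> coprime m n \<longrightarrow> \<alpha> = of_int m / of_int n \<longrightarrow>
        0 \<le> k \<and> k < n \<and> 1 \<le> l \<and> l < m)"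

definition running_sup :: "(real \<Rightarrow> 'a \<Rightarrow> real) \<Rightarrow> real \<Rightarrow> 'a \<Rightarrow> real" where
  "running_sup X t \<omega> = (SUP u\<in>{0..t}. X u \<omega>)"

(* Density of the gamma law with mean and variance c, for c > 0. *)
definition gamma_density :: "real \<Rightarrow> real \<Rightarrow> real" where
  "gamma_density c x = (if x > 0 then x powr (c - 1) * exp (- x) / Gamma c else 0)"

(* Labels for the random variables in the identity, so that their joint independence
   can be stated as the independence of one family. *)
datatype label =
    Supremum | Exp_left | Exp_right
  | Num_left int | Den_left int | Num_right int | Den_right int

definition labels :: "int \<Rightarrow> int \<Rightarrow> label set" where
  "labels k l = {Supremum, Exp_left, Exp_right}
     \<union> Num_left ` {1..l - 1} \<union> Den_left ` {1..l - 1}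
     \<union> Num_right ` {1..k} \<union> Den_right ` {1..k}"

end

theory Submission
  imports Defs "HOL-Complex_Analysis.Complex_Analysis"
begin

text \<open>
  Multiply \<open>S\<^sub>1\<close> by \<open>\<epsilon>\<^sub>1 powr (1 / \<alpha>)\<close>. By self-similarity this is the supremum of the process up to an
  independent exponential time, and its Laplace transform \<open>L\<close> is one of the two Wiener-Hopf
  factors of the process. Write \<open>G\<close> and \<open>H\<close> for the two products of gamma quotients, with the power
  \<open>1 / \<alpha>\<close> included in \<open>G\<close>. On the imaginary axis the transforms of the two sides are then
  \<open>E (L (z * G))\<close> and \<open>E (1 / (1 + z * H))\<close>, and both can be computed as Mellin-Barnes integrals:
  \<open>1 / (1 + x)\<close> has the Mellin transform \<open>pi / sin (pi * s)\<close>, and by the reflection formula the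
  power moments of a quotient of independent gamma variables with parameters \<open>a\<close> and \<open>1 - a\<close> are
  quotients of sines. So the identity says that \<open>L\<close> is the Mellin-Barnes integral with the kernel
  \<open>pi / sin (pi * s) * R s\<close>, where \<open>R\<close> is the quotient of the two products of sines that belong to
  \<open>H\<close> and \<open>G\<close>. This is proved by characterising \<open>L\<close> and by showing that the integral fits.

  The characterisation. For a random walk that is stopped at a geometric time, Lindley's recursion
  \<open>max 0 (y + m)\<close> for the law of the maximum gives an identity on the imaginary axis between a
  function that is bounded and holomorphic on the right and one that is so on the left
  (\<open>geometric_max_axis\<close>). The same identity for the reflected walk has the same factor on the
  axis, so the two can be glued along it, and Liouville's theorem makes the result constant
  (\<open>geometric_max_times_under\<close>). The grids of mesh \<open>1 / N\<close> turn this into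
  \<open>L z * L' (- z) * (1 + \<Psi>) = 1\<close> on the axis, with \<open>L'\<close> for the reflected process
  (\<open>sup_inf_transform\<close>). The maximum principle and a convexity argument give lower bounds for the
  random walk that survive the limit and bound \<open>L\<close> from below. Therefore a function \<open>\<phi>\<close> on the
  right half plane equals \<open>L\<close> as soon as \<open>\<phi> 0 = 1\<close>, \<open>\<phi>\<close> vanishes at infinity on the positive axis, and \<open>\<phi> * (1 + \<Psi>)\<close> continues
  to the left half plane, all with polynomial growth (\<open>sup_transform_unique\<close>): the quotient
  \<open>\<phi> / L\<close> is a polynomial, and it grows more slowly than linearly.

  The candidate. The relation \<open>\<rho> + k = l / \<alpha>\<close> enters through two facts on \<open>R\<close>. In the strip
  \<open>- \<alpha> < Re s < \<alpha> * \<rho>\<close> every zero of the denominator is also a zero of the numerator, so \<open>R\<close> is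
  holomorphic there (\<open>sin_ratio_exists\<close>); the canonical choice of \<open>(k, l)\<close> makes these zeros simple.
  Moreover \<open>R\<close> satisfies a functional equation with the shift \<open>\<alpha>\<close> (\<open>sin_ratio_shift\<close>). The
  Mellin-Barnes integral \<open>\<phi>\<close> lives on the plane cut along the negative axis. Moving its line of
  integration by \<open>\<alpha>\<close>, across the strip, shows that \<open>\<phi>\<close> times the continuation of \<open>1 + \<Psi>\<close> takes the
  same values on both sides of the cut (\<open>kernel_transform_cut\<close>), which is the continuation of
  \<open>\<phi> * (1 + \<Psi>)\<close> to the left half plane. For \<open>\<alpha> * \<rho> = 1\<close> the integral does not decay enough on the
  cut; then \<open>k = 0\<close>, \<open>l = 1\<close> and \<open>L z = 1 / (1 + z)\<close>
  (\<open>sup_transform_spectrally_negative\<close>).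
\<close>

section \<open>Parameter integrals and half planes\<close>

lemma continuous_on_lebesgue_integral:
  fixes f :: "'b::metric_space \<Rightarrow> 'a \<Rightarrow> complex"
  assumes cont: "\<And>x. x \<in> space M \<Longrightarrow> continuous_on S (\<lambda>z. f z x)"
    and meas: "\<And>z. z \<in> S \<Longrightarrow> f z \<in> borel_measurable M"
    and dom: "integrable M g" "\<And>z x. z \<in> S \<Longrightarrow> x \<in> space M \<Longrightarrow> norm (f z x) \<le> g x"
  shows "continuous_on S (\<lambda>z. LINT x|M. f z x)"
  unfolding continuous_on_sequentially
proof (intro allI ballI impI)
  fix u z assume z: "z \<in> S" and u: "(\<forall>n. u n \<in> S) \<and> u \<longlonglongrightarrow> z"
  have "(\<lambda>n. LINT x|M. f (u n) x) \<longlonglongrightarrow> (LINT x|M. f z x)"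
  proof (rule integral_dominated_convergence[where w = g])
    show "AE x in M. (\<lambda>n. f (u n) x) \<longlonglongrightarrow> f z x"
    proof (rule AE_I2)
      fix x assume "x \<in> space M"
      from cont[OF this] show "(\<lambda>n. f (u n) x) \<longlonglongrightarrow> f z x"
        using u z unfolding continuous_on_sequentially o_def by blast
    qed
  qed (use u z meas dom in auto)
  then show "((\<lambda>z. LINT x|M. f z x) \<circ> u) \<longlonglongrightarrow> (LINT x|M. f z x)"
    by (simp add: o_def)
qed

text \<open>
  Cauchy's inequality on a disc turns the bound on the integrand into one on its derivative, so
  that the difference quotients are dominated.
\<close>
lemma holomorphic_on_lebesgue_integral:
  fixes f :: "complex \<Rightarrow> 'a \<Rightarrow> complex"
  assumes "open S"
    and hol: "\<And>x. x \<in> space M \<Longrightarrow> (\<lambda>z. f z x) holomorphic_on S"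
    and meas: "\<And>z. z \<in> S \<Longrightarrow> f z \<in> borel_measurable M"
    and dom: "integrable M g" "\<And>z x. z \<in> S \<Longrightarrow> x \<in> space M \<Longrightarrow> norm (f z x) \<le> g x"
  shows "(\<lambda>z. LINT x|M. f z x) holomorphic_on S"
  unfolding holomorphic_on_open[OF \<open>open S\<close>]
proof
  fix z0 assume z0: "z0 \<in> S"
  obtain r where r: "r > 0" "cball z0 (2 * r) \<subseteq> S"
  proof -
    obtain e where "e > 0" "cball z0 e \<subseteq> S"
      using \<open>open S\<close> z0 open_contains_cball by blast
    then show thesis by (intro that[of "e / 2"]) auto
  qed
  define f' where "f' x = deriv (\<lambda>z. f z x) z0" for x
  have fld: "((\<lambda>z. f z x) has_field_derivative deriv (\<lambda>z. f z x) z) (at z)"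
    if "x \<in> space M" "z \<in> S" for x z
    using hol[OF that(1)] \<open>open S\<close> that(2) holomorphic_derivI by blast
  have int: "integrable M (f z)" if "z \<in> S" for z
    by (rule Bochner_Integration.integrable_bound[OF dom(1) meas[OF that]])
      (use dom(2)[OF that] in \<open>fastforce intro!: AE_I2\<close>)
  have deriv_bound: "norm (deriv (\<lambda>z. f z x) z) \<le> g x / r"
    if x: "x \<in> space M" and z: "z \<in> ball z0 r" for x z
  proof -
    have "cball z r \<subseteq> cball z0 (2 * r)"
      using z by (subst cball_subset_cball_iff) (auto simp: dist_commute)
    then have sub: "cball z r \<subseteq> S" using r by blast
    have "cmod ((deriv ^^ 1) (\<lambda>z. f z x) z) \<le> fact 1 * g x / r ^ 1"
    proof (rule Cauchy_inequality)
      show "(\<lambda>z. f z x) holomorphic_on ball z r"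
        by (rule holomorphic_on_subset[OF hol[OF x] order_trans[OF ball_subset_cball sub]])
      show "continuous_on (cball z r) (\<lambda>z. f z x)"
        by (rule holomorphic_on_imp_continuous_on[OF holomorphic_on_subset[OF hol[OF x] sub]])
      show "norm (f w x) \<le> g x" if "norm (z - w) = r" for w
      proof -
        have "w \<in> S" using sub that by (auto simp: dist_norm)
        then show ?thesis using dom(2)[OF _ x] by simp
      qed
    qed (use r in auto)
    then show ?thesis by simp
  qed
  have Lip: "norm (f z x - f z0 x) \<le> g x / r * norm (z - z0)"
    if x: "x \<in> space M" and z: "z \<in> ball z0 r" for x z
  proof (rule field_differentiable_bound[of "ball z0 r"])
    show "((\<lambda>z. f z x) has_field_derivative deriv (\<lambda>z. f z x) w) (at w within ball z0 r)"
      if "w \<in> ball z0 r" for w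
    proof (rule has_field_derivative_at_within[OF fld[OF x]])
      have "w \<in> cball z0 (2 * r)" using that r(1) by simp
      then show "w \<in> S" using r(2) by blast
    qed
    show "norm (deriv (\<lambda>z. f z x) w) \<le> g x / r" if "w \<in> ball z0 r" for w
      by (rule deriv_bound[OF x that])
  qed (use z r(1) in simp_all)
  have "((\<lambda>z. LINT x|M. f z x) has_field_derivative (LINT x|M. f' x)) (at z0)"
    unfolding has_field_derivative_iff
  proof (subst tendsto_at_iff_sequentially, intro allI impI)
    fix u :: "nat \<Rightarrow> complex"
    assume u: "\<forall>i. u i \<in> UNIV - {z0}" "u \<longlonglongrightarrow> z0"
    have ev: "\<forall>\<^sub>F n in sequentially. u n \<in> ball z0 r"
      using u(2) r(1) by (simp add: tendsto_iff dist_commute)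
    then obtain N where N: "\<And>n. n \<ge> N \<Longrightarrow> u n \<in> ball z0 r"
      unfolding eventually_sequentially by blast
    have inS: "u (n + N) \<in> S" for n
    proof -
      have "u (n + N) \<in> cball z0 (2 * r)" using N[of "n + N"] r(1) by simp
      then show ?thesis using r(2) by blast
    qed
    have "(\<lambda>n. LINT x|M. (f (u (n + N)) x - f z0 x) / (u (n + N) - z0)) \<longlonglongrightarrow> (LINT x|M. f' x)"
    proof (rule integral_dominated_convergence[where w = "\<lambda>x. g x / r"])
      show lim: "AE x in M. (\<lambda>n. (f (u (n + N)) x - f z0 x) / (u (n + N) - z0)) \<longlonglongrightarrow> f' x"
      proof (rule AE_I2)
        fix x assume x: "x \<in> space M"
        have "(\<lambda>n. (f (u n) x - f z0 x) / (u n - z0)) \<longlonglongrightarrow> f' x"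
          using fld[OF x z0] u unfolding has_field_derivative_iff f'_def
          by (subst (asm) tendsto_at_iff_sequentially) (auto simp: o_def)
        then show "(\<lambda>n. (f (u (n + N)) x - f z0 x) / (u (n + N) - z0)) \<longlonglongrightarrow> f' x"
          by (rule LIMSEQ_ignore_initial_segment)
      qed
      show m: "(\<lambda>x. (f (u (n + N)) x - f z0 x) / (u (n + N) - z0)) \<in> borel_measurable M" for n
        using meas[OF inS] meas[OF z0] by measurable
      show "f' \<in> borel_measurable M"
      proof (rule borel_measurable_LIMSEQ_metric[OF m])
        fix x assume "x \<in> space M"
        then show "(\<lambda>n. (f (u (n + N)) x - f z0 x) / (u (n + N) - z0)) \<longlonglongrightarrow> f' x"
          using fld[OF _ z0, of x] u unfolding has_field_derivative_iff f'_def
          by (subst (asm) tendsto_at_iff_sequentially)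
            (auto simp: o_def intro!: LIMSEQ_ignore_initial_segment[where f = "\<lambda>n. (f (u n) x - f z0 x) / (u n - z0)"])
      qed
      show "AE x in M. norm ((f (u (n + N)) x - f z0 x) / (u (n + N) - z0)) \<le> g x / r" for n
      proof (rule AE_I2)
        fix x assume x: "x \<in> space M"
        have "u (n + N) - z0 \<noteq> 0" using u by auto
        then show "norm ((f (u (n + N)) x - f z0 x) / (u (n + N) - z0)) \<le> g x / r"
          using Lip[OF x N[of "n + N"]] by (simp add: norm_divide pos_divide_le_eq)
      qed
    qed (use dom(1) in auto)
    also have "(\<lambda>n. LINT x|M. (f (u (n + N)) x - f z0 x) / (u (n + N) - z0)) =
      (\<lambda>n. ((LINT x|M. f (u (n + N)) x) - (LINT x|M. f z0 x)) / (u (n + N) - z0))"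
      using int[OF inS] int[OF z0] by (simp add: fun_eq_iff)
    finally have "(\<lambda>n. ((LINT x|M. f (u n) x) - (LINT x|M. f z0 x)) / (u n - z0)) \<longlonglongrightarrow> (LINT x|M. f' x)"
      by (rule LIMSEQ_offset)
    then show "((\<lambda>z. ((LINT x|M. f z x) - (LINT x|M. f z0 x)) / (z - z0)) \<circ> u) \<longlonglongrightarrow> (LINT x|M. f' x)"
      by (simp add: o_def)
  qed
  then show "\<exists>f'. ((\<lambda>z. LINT x|M. f z x) has_field_derivative f') (at z0)" by blast
qed

text \<open>
  A Phragmen-Lindelof principle in the simplest case: after division by \<open>(1 + z)\<^sup>2\<close> a bounded
  function is small on large arcs, so that only the axis counts. The point is that the conclusion
  does not depend on \<open>B\<close>; it will be applied to a sequence of functions for which only the bound on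
  the axis is uniform.
\<close>
lemma half_plane_maximum_modulus:
  fixes f :: "complex \<Rightarrow> complex"
  assumes hol: "f holomorphic_on {z. 0 < Re z}" and cont: "continuous_on {z. 0 \<le> Re z} f"
    and bnd: "\<And>z. 0 \<le> Re z \<Longrightarrow> norm (f z) \<le> B"
    and axis: "\<And>z. Re z = 0 \<Longrightarrow> norm (f z) \<le> K * norm (1 + z) ^ 2"
    and K: "K > 0" and z: "0 \<le> Re z"
  shows "norm (f z) \<le> K * norm (1 + z) ^ 2"
proof (cases "Re z = 0")
  case False
  then have z': "0 < Re z" using z by simp
  define g where "g w = f w / (1 + w) ^ 2" for w
  have nz: "1 + w \<noteq> 0" if "0 \<le> Re w" for w :: complex
    using that by (auto simp: complex_eq_iff)
  have B: "B \<ge> 0" using bnd[OF z] norm_ge_zero order_trans by blast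
  \<comment> \<open>on the arc of radius \<open>R\<close> the bound \<open>B\<close> is at most \<open>K * norm (1 + w) ^ 2\<close>\<close>
  define R where "R = norm z + 1 + sqrt (B / K) + 1"
  define S where "S = {z. 0 < Re z} \<inter> ball 0 R"
  have opS: "open S" unfolding S_def by (intro open_Int open_halfspace_Re_gt open_ball)
  have clS: "closure S \<subseteq> {z. 0 \<le> Re z} \<inter> cball 0 R"
    by (rule closure_minimal) (auto simp: S_def intro!: closed_Int closed_halfspace_Re_ge)
  have "norm (g z) \<le> K"
  proof (rule maximum_modulus_frontier[of g S])
    show "g holomorphic_on interior S"
      unfolding g_def interior_open[OF opS] using nz
      by (intro holomorphic_intros holomorphic_on_subset[OF hol]) (auto simp: S_def)
    show "continuous_on (closure S) g"
      unfolding g_def using nz clS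
      by (intro continuous_intros continuous_on_subset[OF cont]) auto
    show "bounded S" unfolding S_def by auto
    have "sqrt (B / K) \<ge> 0" using B K by simp
    then have "norm z < R" unfolding R_def using norm_ge_zero[of z] by linarith
    then show "z \<in> S" using z' by (auto simp: S_def)
    show "norm (g w) \<le> K" if w: "w \<in> frontier S" for w
    proof -
      have w1: "w \<in> closure S" "w \<notin> S" using w opS by (auto simp: frontier_def interior_open)
      then have w2: "0 \<le> Re w" "norm w \<le> R" using clS by auto
      have pos: "norm (1 + w) > 0" using nz[OF w2(1)] by simp
      show ?thesis
      proof (cases "Re w = 0")
        case True
        with axis[of w] pos show ?thesis
          unfolding g_def by (simp add: norm_divide norm_power pos_divide_le_eq)
      next
        case False
        then have nw: "norm w = R" using w1 w2 by (auto simp: S_def)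
        have sq: "sqrt (B / K) \<ge> 0" using B K by simp
        have "norm (1 + w) \<ge> norm w - 1"
          using norm_triangle_ineq2[of w "-1"] by (simp add: add.commute)
        also have "norm w - 1 \<ge> sqrt (B / K)" using nw R_def by simp
        finally have "norm (1 + w) ^ 2 \<ge> sqrt (B / K) ^ 2"
          using sq by (intro power_mono) auto
        then have "K * norm (1 + w) ^ 2 \<ge> B"
          using B K by (simp add: field_simps)
        with bnd[OF w2(1)] pos show ?thesis
          unfolding g_def by (simp add: norm_divide norm_power pos_divide_le_eq)
      qed
    qed
  qed
  then show ?thesis using nz[OF z] unfolding g_def
    by (simp add: norm_divide norm_power pos_divide_le_eq)
qed (use axis in auto)

text \<open>
  All uniqueness arguments below produce an entire function in this way.
\<close>
lemma holomorphic_paste_half_planes: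
  fixes f g :: "complex \<Rightarrow> complex"
  assumes f: "f holomorphic_on {z. 0 < Re z}" "continuous_on {z. 0 \<le> Re z} f"
    and g: "g holomorphic_on {z. Re z < 0}" "continuous_on {z. Re z \<le> 0} g"
    and eq: "\<And>z. Re z = 0 \<Longrightarrow> f z = g z"
  shows "(\<lambda>z. if 0 \<le> Re z then f z else g z) holomorphic_on UNIV"
proof (rule holomorphic_on_paste_across_line[of UNIV 1 _ 0])
  let ?h = "\<lambda>z. if 0 \<le> Re z then f z else g z"
  show "?h holomorphic_on UNIV \<inter> {z. 1 \<bullet> z < 0}"
    using g(1) by (rule holomorphic_transform[THEN holomorphic_on_subset]) auto
  show "?h holomorphic_on UNIV \<inter> {z. 0 < 1 \<bullet> z}"
    using f(1) by (rule holomorphic_transform[THEN holomorphic_on_subset]) auto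
  have "continuous_on ({z. 0 \<le> Re z} \<union> {z. Re z \<le> 0}) ?h"
    using f(2) g(2) eq
    by (intro continuous_on_If closed_halfspace_Re_ge closed_halfspace_Re_le) auto
  moreover have "{z. 0 \<le> Re z} \<union> {z. Re z \<le> 0} = UNIV" by auto
  ultimately show "continuous_on UNIV ?h" by simp
qed auto

section \<open>Shifting vertical lines of integration\<close>

lemma integrable_exp_minus_abs:
  fixes \<kappa> :: real
  assumes "\<kappa> > 0"
  shows "integrable lborel (\<lambda>y. exp (- \<kappa> * \<bar>y\<bar>))"
proof -
  have 1: "integrable lborel (\<lambda>y. exponential_density \<kappa> y)"
    using prob_space.prob_space[OF prob_space_exponential_density[OF assms]]
  proof -
    interpret prob_space "density lborel (exponential_density \<kappa>)"
      by (rule prob_space_exponential_density[OF assms])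
    have "integrable (density lborel (exponential_density \<kappa>)) (\<lambda>_. 1 :: real)" by simp
    then show ?thesis
      by (subst (asm) integrable_density) (auto simp: exponential_density_def assms less_imp_le)
  qed
  have 2: "integrable lborel (\<lambda>y. exponential_density \<kappa> (- y))"
    using lborel_integrable_real_affine[OF 1, of "-1" 0] by simp
  have 3: "integrable lborel (\<lambda>y. exponential_density \<kappa> y / \<kappa> + exponential_density \<kappa> (- y) / \<kappa>)"
    using 1 2 by simp
  show ?thesis
    by (rule Bochner_Integration.integrable_bound[OF 3])
       (use assms in \<open>auto simp: exponential_density_def intro!: AE_I2\<close>)
qed

text \<open>
  The residue theorem on long rectangles, in the form of Cauchy's integral formula at the origin;
  the exponential decay kills the horizontal sides.
\<close>
lemma vertical_line_shift_pole:
  fixes h :: "complex \<Rightarrow> complex"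
  assumes hol: "h holomorphic_on {s. a < Re s \<and> Re s < b}"
    and ab: "a < p" "p < 0" "0 < q" "q < b" and \<kappa>: "\<kappa> > 0"
    and decay: "\<And>s. p \<le> Re s \<Longrightarrow> Re s \<le> q \<Longrightarrow> norm (h s) \<le> C * exp (- \<kappa> * \<bar>Im s\<bar>)"
  shows "integrable lborel (\<lambda>y. h (Complex q y) / Complex q y)"
    and "integrable lborel (\<lambda>y. h (Complex p y) / Complex p y)"
    and "(LINT y|lborel. h (Complex q y) / Complex q y) =
         (LINT y|lborel. h (Complex p y) / Complex p y) + 2 * pi * h 0"
proof -
  let ?S = "{s. a < Re s \<and> Re s < b}"
  have opS: "open ?S"
    by (intro open_Collect_conj open_halfspace_Re_gt open_halfspace_Re_lt)
  have cvS: "convex ?S"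
    by (intro convex_Int[of "{s. a < Re s}" "{s. Re s < b}", unfolded Int_def mem_Collect_eq]
        convex_halfspace_Re_gt convex_halfspace_Re_lt)
  have cont: "continuous_on ?S h" using hol by (rule holomorphic_on_imp_continuous_on)
  have C: "C \<ge> 0"
    using decay[of 0] ab order_trans[OF norm_ge_zero[of "h 0"]] by simp
  define m where "m = min (-p) q"
  have m: "m > 0" using ab by (simp add: m_def)
  have meas: "(\<lambda>y. h (Complex c y) / Complex c y) \<in> borel_measurable lborel"
    if "a < c" "c < b" "c \<noteq> 0" for c
  proof -
    have "continuous_on UNIV (\<lambda>y. h (Complex c y) / Complex c y)"
      using that by (intro continuous_intros continuous_on_compose2[OF cont])
         (auto simp: Complex_eq complex_eq_iff intro!: continuous_intros)
    then show ?thesis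
      using borel_measurable_continuous_onI by simp
  qed
  have bound: "norm (h (Complex c y) / Complex c y) \<le> C / m * exp (- \<kappa> * \<bar>y\<bar>)"
    if "c = p \<or> c = q" for c y
  proof -
    have "m \<le> \<bar>Re (Complex c y)\<bar>" using that ab by (auto simp: m_def)
    also have "\<dots> \<le> norm (Complex c y)" by (rule abs_Re_le_cmod)
    finally have n: "m \<le> norm (Complex c y)" .
    have "norm (h (Complex c y)) \<le> C * exp (- \<kappa> * \<bar>y\<bar>)"
      using decay[of "Complex c y"] that ab by auto
    then have "norm (h (Complex c y)) / norm (Complex c y) \<le> (C * exp (- \<kappa> * \<bar>y\<bar>)) / m"
      using n m C by (intro frac_le) auto
    then show ?thesis by (simp add: norm_divide)
  qed
  have intg: "integrable lborel (\<lambda>y. C / m * exp (- \<kappa> * \<bar>y\<bar>))"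
    using integrable_exp_minus_abs[OF \<kappa>] by simp
  have int: "integrable lborel (\<lambda>y. h (Complex c y) / Complex c y)" if "c = p \<or> c = q" for c
    by (rule Bochner_Integration.integrable_bound[OF intg meas])
      (use that ab bound[OF that] C m in \<open>auto intro!: AE_I2\<close>)
  then show "integrable lborel (\<lambda>y. h (Complex q y) / Complex q y)"
    "integrable lborel (\<lambda>y. h (Complex p y) / Complex p y)" by auto
  define F where "F s = h s / s" for s
  define J where "J c T = integral {-T..T} (\<lambda>y. F (Complex c y))" for c T :: real
  have Jlim: "(\<lambda>n. J c (real n)) \<longlonglongrightarrow> (LINT y|lborel. F (Complex c y))" if c: "c = p \<or> c = q" for c
  proof -
    have "(\<lambda>n. LINT y|lborel. indicator {-real n..real n} y *\<^sub>R F (Complex c y))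
       \<longlonglongrightarrow> (LINT y|lborel. F (Complex c y))"
    proof (rule integral_dominated_convergence[OF _ _ intg])
      show "AE y in lborel. (\<lambda>n. indicator {-real n..real n} y *\<^sub>R F (Complex c y)) \<longlonglongrightarrow> F (Complex c y)"
      proof (rule AE_I2)
        fix y :: real
        obtain N where N: "\<bar>y\<bar> \<le> real N" using real_arch_simple by blast
        have "\<forall>\<^sub>F n in sequentially. indicator {-real n..real n} y *\<^sub>R F (Complex c y) = F (Complex c y)"
          using eventually_ge_at_top[of N]
        proof eventually_elim
          case (elim n)
          then have "real N \<le> real n" by simp
          then show ?case using N by (auto simp: indicator_def abs_le_iff)
        qed
        then show "(\<lambda>n. indicator {-real n..real n} y *\<^sub>R F (Complex c y)) \<longlonglongrightarrow> F (Complex c y)"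
          by (rule tendsto_eventually)
      qed
      show "AE y in lborel. norm (indicator {-real n..real n} y *\<^sub>R F (Complex c y)) \<le> C / m * exp (- \<kappa> * \<bar>y\<bar>)" for n
      proof (rule AE_I2)
        fix y
        have "norm (indicator {-real n..real n} y *\<^sub>R F (Complex c y)) \<le> norm (F (Complex c y))"
          by (auto simp: indicator_def)
        also have "\<dots> \<le> C / m * exp (- \<kappa> * \<bar>y\<bar>)" using bound[OF c] by (simp add: F_def)
        finally show "norm (indicator {-real n..real n} y *\<^sub>R F (Complex c y)) \<le> C / m * exp (- \<kappa> * \<bar>y\<bar>)" .
      qed
      show "(\<lambda>y. F (Complex c y)) \<in> borel_measurable lborel"
        using meas[of c] c ab by (auto simp: F_def)
      then show "(\<lambda>y. indicator {-real n..real n} y *\<^sub>R F (Complex c y)) \<in> borel_measurable lborel" for n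
        by measurable
    qed
    moreover have "(LINT y|lborel. indicator {-real n..real n} y *\<^sub>R F (Complex c y)) = J c n" for n
    proof -
      have "set_integrable lborel {-real n..real n} (\<lambda>y. F (Complex c y))"
        unfolding set_integrable_def using int[OF c]
        by (intro integrable_mult_indicator) (auto simp: F_def)
      from set_borel_integral_eq_integral(2)[OF this] show ?thesis
        by (simp add: J_def set_lebesgue_integral_def)
    qed
    ultimately show ?thesis by simp
  qed
  define H where "H n = J q (real n) - J p (real n) - 2 * pi * h 0" for n
  have Hbound: "norm (H n) \<le> 2 * (q - p) * (C * exp (- \<kappa> * real n))" if n: "n \<ge> 1" for n
  proof -
    define T where "T = real n"
    have T: "T \<ge> 1" using n by (simp add: T_def)
    define A1 A2 A3 A4 where "A1 = Complex p (-T)" "A2 = Complex q (-T)"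
       "A3 = Complex q T" "A4 = Complex p T"
    note A = A1_A2_A3_A4_def
    have box: "cbox A1 A3 \<subseteq> ?S" using ab by (auto simp: in_cbox_complex_iff A)
    have img: "path_image (rectpath A1 A3) \<subseteq> ?S - {0}"
    proof -
      have "0 \<in> box A1 A3" using ab T by (auto simp: in_box_complex_iff A)
      then have "0 \<notin> path_image (rectpath A1 A3)"
        using path_image_rectpath_inter_box[of A1 A3] ab T by (auto simp: A)
      moreover have "path_image (rectpath A1 A3) \<subseteq> cbox A1 A3"
        using ab T by (intro path_image_rectpath_subset_cbox) (auto simp: A)
      ultimately show ?thesis using box by blast
    qed
    have "(F has_contour_integral (2 * pi * \<i> * winding_number (rectpath A1 A3) 0 * h 0)) (rectpath A1 A3)"
      using Cauchy_integral_formula_convex_simple[OF cvS hol, of 0 "rectpath A1 A3"] img ab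
      by (auto simp: interior_open[OF opS] F_def[abs_def])
    moreover have "winding_number (rectpath A1 A3) 0 = 1"
      using ab T by (intro winding_number_rectpath) (auto simp: in_box_complex_iff A)
    ultimately have rect: "contour_integral (rectpath A1 A3) F = 2 * pi * \<i> * h 0"
      by (auto dest: contour_integral_unique)
    have contF: "continuous_on (closed_segment z w) F" if "closed_segment z w \<subseteq> path_image (rectpath A1 A3)" for z w
    proof -
      have "continuous_on (?S - {0}) F" unfolding F_def
        by (intro continuous_intros continuous_on_subset[OF cont]) auto
      then show ?thesis using that img by (meson continuous_on_subset order_trans)
    qed
    have segs: "path_image (rectpath A1 A3) = closed_segment A1 A2 \<union> closed_segment A2 A3 \<union>
        closed_segment A3 A4 \<union> closed_segment A4 A1"
      by (simp add: rectpath_def Let_def A path_image_join Un_assoc)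
    have ci: "F contour_integrable_on linepath A1 A2" "F contour_integrable_on linepath A2 A3"
      "F contour_integrable_on linepath A3 A4" "F contour_integrable_on linepath A4 A1"
      by (rule contour_integrable_continuous_linepath, rule contF, subst segs, blast)+
    have "contour_integral (rectpath A1 A3) F = contour_integral (linepath A1 A2) F
       + contour_integral (linepath A2 A3) F + contour_integral (linepath A3 A4) F
       + contour_integral (linepath A4 A1) F"
      using ci unfolding rectpath_def Let_def
      by (simp add: A contour_integral_join)
    moreover have "contour_integral (linepath A2 A3) F = \<i> * J q T"
      using T by (subst contour_integral_linepath_same_Re[where a = "-T" and b = T and c = q])
        (auto simp: A J_def)
    moreover have "contour_integral (linepath A4 A1) F = - \<i> * J p T"
    proof -
      have "contour_integral (linepath A4 A1) F = - contour_integral (linepath A1 A4) F"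
        using contF[of A4 A1] by (intro contour_integral_reverse_linepath) (simp add: segs)
      also have "contour_integral (linepath A1 A4) F = \<i> * J p T"
        using T by (subst contour_integral_linepath_same_Re[where a = "-T" and b = T and c = p])
          (auto simp: A J_def)
      finally show ?thesis by simp
    qed
    moreover have hor: "norm (contour_integral (linepath z w) F) \<le> C * exp (- \<kappa> * T) * (q - p)"
      if "F contour_integrable_on linepath z w" "norm (w - z) = q - p"
        and seg: "\<And>x. x \<in> closed_segment z w \<Longrightarrow> \<bar>Im x\<bar> = T \<and> p \<le> Re x \<and> Re x \<le> q" for z w
    proof -
      have "norm (F x) \<le> C * exp (- \<kappa> * T)" if x: "x \<in> closed_segment z w" for x
      proof -
        have 1: "\<bar>Im x\<bar> = T" "p \<le> Re x" "Re x \<le> q" using seg[OF x] by auto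
        have "1 \<le> \<bar>Im x\<bar>" using 1 T by simp
        also have "\<dots> \<le> norm x" by (rule abs_Im_le_cmod)
        finally have "norm (h x) / norm x \<le> norm (h x) / 1"
          by (intro divide_left_mono) auto
        also have "\<dots> \<le> C * exp (- \<kappa> * T)" using decay[of x] 1 by simp
        finally show ?thesis by (simp add: F_def norm_divide)
      qed
      from contour_integral_bound_linepath[OF that(1) _ this] that(2) C show ?thesis by simp
    qed
    have "norm (contour_integral (linepath A1 A2) F) \<le> C * exp (- \<kappa> * T) * (q - p)"
      using ab T by (intro hor ci) (auto simp: A closed_segment_same_Im closed_segment_eq_real_ivl norm_complex_def cmod_def)
    moreover have "norm (contour_integral (linepath A3 A4) F) \<le> C * exp (- \<kappa> * T) * (q - p)"
      using ab T by (intro hor ci) (auto simp: A closed_segment_same_Im closed_segment_eq_real_ivl norm_complex_def cmod_def)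
    moreover have "\<i> * H n = contour_integral (rectpath A1 A3) F - 2 * pi * \<i> * h 0
       - contour_integral (linepath A1 A2) F - contour_integral (linepath A3 A4) F"
      using calculation by (simp add: H_def T_def algebra_simps)
    then have "norm (\<i> * H n) = norm (contour_integral (linepath A1 A2) F + contour_integral (linepath A3 A4) F)"
      unfolding rect by (metis (no_types, lifting) cancel_comm_monoid_add_class.diff_cancel diff_0 diff_diff_eq norm_minus_cancel)
    ultimately have "norm (\<i> * H n) \<le> C * exp (- \<kappa> * T) * (q - p) + C * exp (- \<kappa> * T) * (q - p)"
      using norm_triangle_ineq[of "contour_integral (linepath A1 A2) F" "contour_integral (linepath A3 A4) F"] by linarith
    then show ?thesis by (simp add: norm_mult T_def algebra_simps)
  qed
  have "(\<lambda>n. 2 * (q - p) * (C * exp (- \<kappa> * real n))) \<longlonglongrightarrow> 2 * (q - p) * (C * 0)"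
  proof (intro tendsto_intros)
    have "filterlim (\<lambda>n. - \<kappa> * real n) at_bot sequentially"
      using \<kappa> by (intro filterlim_tendsto_neg_mult_at_bot[OF tendsto_const]) (auto simp: filterlim_real_sequentially)
    then show "(\<lambda>n. exp (- \<kappa> * real n)) \<longlonglongrightarrow> 0"
      by (rule filterlim_compose[OF exp_at_bot])
  qed
  then have "H \<longlonglongrightarrow> 0"
    by (intro Lim_null_comparison[of H "\<lambda>n. 2 * (q - p) * (C * exp (- \<kappa> * real n))"])
       (auto simp: eventually_sequentially intro!: exI[of _ 1] Hbound[simplified])
  moreover have "H \<longlonglongrightarrow> (LINT y|lborel. F (Complex q y)) - (LINT y|lborel. F (Complex p y)) - 2 * pi * h 0"
    unfolding H_def by (intro tendsto_intros Jlim) auto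
  ultimately have "(LINT y|lborel. F (Complex q y)) - (LINT y|lborel. F (Complex p y)) - 2 * pi * h 0 = 0"
    using LIMSEQ_unique by blast
  then show "(LINT y|lborel. h (Complex q y) / Complex q y) =
         (LINT y|lborel. h (Complex p y) / Complex p y) + 2 * pi * h 0"
    by (simp add: F_def algebra_simps)
qed

text \<open>
  The case without a pole, obtained from the previous one by placing a removable pole on the
  middle line.
\<close>
lemma vertical_line_shift:
  fixes f :: "complex \<Rightarrow> complex"
  assumes hol: "f holomorphic_on {s. a < Re s \<and> Re s < b}"
    and ab: "a < p" "p < q" "q < b" and \<kappa>: "\<kappa> > 0"
    and decay: "\<And>s. p \<le> Re s \<Longrightarrow> Re s \<le> q \<Longrightarrow> norm (f s) \<le> C * exp (- \<kappa> * \<bar>Im s\<bar>)"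
  shows "(LINT y|lborel. f (Complex q y)) = (LINT y|lborel. f (Complex p y))"
proof -
  \<comment> \<open>the pole of \<open>h s / s\<close> at the origin has the residue \<open>h 0 = 0\<close>\<close>
  define m where "m = (p + q) / 2"
  define h where "h s = s * f (s + of_real m)" for s
  have C: "C \<ge> 0"
    using decay[of "of_real p"] ab order_trans[OF norm_ge_zero[of "f (of_real p)"]] by simp
  have shift: "Complex (c - m) y + of_real m = Complex c y" for c y
    by (simp add: complex_eq_iff)
  have "(LINT y|lborel. h (Complex (q - m) y) / Complex (q - m) y) =
        (LINT y|lborel. h (Complex (p - m) y) / Complex (p - m) y) + 2 * pi * h 0"
  proof (rule vertical_line_shift_pole(3))
    show "h holomorphic_on {s. a - m < Re s \<and> Re s < b - m}"
      unfolding h_def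
      by (intro holomorphic_intros holomorphic_on_compose[OF _ holomorphic_on_subset[OF hol], unfolded o_def]) auto
    show "norm (h s) \<le> ((q - p) + 2 / \<kappa>) * C * exp (- (\<kappa> / 2) * \<bar>Im s\<bar>)"
      if s: "p - m \<le> Re s" "Re s \<le> q - m" for s
    proof -
      have e: "exp (- (\<kappa> / 2) * \<bar>Im s\<bar>) * exp (- (\<kappa> / 2) * \<bar>Im s\<bar>) = exp (- \<kappa> * \<bar>Im s\<bar>)"
        by (simp add: exp_add[symmetric])
      have "\<bar>Re s\<bar> \<le> q - p" using s ab by (auto simp: m_def abs_le_iff field_simps)
      then have 1: "norm s \<le> (q - p) + \<bar>Im s\<bar>" using cmod_le[of s] by linarith
      have 2: "\<kappa> / 2 * \<bar>Im s\<bar> \<le> exp (\<kappa> / 2 * \<bar>Im s\<bar>)"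
        using exp_ge_add_one_self[of "\<kappa> / 2 * \<bar>Im s\<bar>"] by linarith
      have 3: "1 \<le> exp (\<kappa> / 2 * \<bar>Im s\<bar>)" using \<kappa> by simp
      have "\<bar>Im s\<bar> \<le> 2 / \<kappa> * exp (\<kappa> / 2 * \<bar>Im s\<bar>)" using 2 \<kappa> by (simp add: field_simps)
      moreover have "(q - p) * 1 \<le> (q - p) * exp (\<kappa> / 2 * \<bar>Im s\<bar>)" using 3 ab by (intro mult_left_mono) auto
      ultimately have n: "norm s \<le> ((q - p) + 2 / \<kappa>) * exp (\<kappa> / 2 * \<bar>Im s\<bar>)"
        using 1 by (simp add: algebra_simps)
      have "norm (f (s + of_real m)) \<le> C * exp (- \<kappa> * \<bar>Im s\<bar>)"
        using decay[of "s + of_real m"] s by simp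
      then have "norm (h s) \<le> (((q - p) + 2 / \<kappa>) * exp (\<kappa> / 2 * \<bar>Im s\<bar>)) * (C * exp (- \<kappa> * \<bar>Im s\<bar>))"
        unfolding h_def norm_mult using n C order_trans[OF norm_ge_zero n] by (intro mult_mono) auto
      also have "\<dots> = ((q - p) + 2 / \<kappa>) * C * (exp (\<kappa> / 2 * \<bar>Im s\<bar>) * exp (- \<kappa> * \<bar>Im s\<bar>))"
        by (simp add: algebra_simps)
      also have "exp (\<kappa> / 2 * \<bar>Im s\<bar>) * exp (- \<kappa> * \<bar>Im s\<bar>) = exp (- (\<kappa> / 2) * \<bar>Im s\<bar>)"
        unfolding exp_add[symmetric] by simp
      finally show ?thesis .
    qed
  qed (use ab \<kappa> in \<open>auto simp: m_def field_simps\<close>)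
  moreover have "Complex (q - m) y \<noteq> 0" "Complex (p - m) y \<noteq> 0" for y
    using ab by (auto simp: m_def complex_eq_iff)
  ultimately show ?thesis
    by (simp add: h_def shift)
qed

section \<open>Laplace transforms and the maximum of a random walk\<close>

definition laplace :: "real measure \<Rightarrow> complex \<Rightarrow> complex" where
  "laplace \<mu> z = (LINT x|\<mu>. exp (- z * of_real x))"

lemma real_distribution_distrI:
  assumes "prob_space M" "f \<in> borel_measurable M"
  shows "real_distribution (distr M borel f)"
  using assms by (intro prob_space.real_distribution_distr) auto

lemma laplace_distr:
  assumes "f \<in> borel_measurable M"
  shows "laplace (distr M borel f) z = (LINT x|M. exp (- z * of_real (f x)))"
  unfolding laplace_def by (subst integral_distr[OF assms]) auto

lemma laplace_eq_char:
  assumes "Re z = 0" shows "laplace \<mu> z = char \<mu> (- Im z)"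
proof -
  have "- z = \<i> * complex_of_real (- Im z)" using assms by (simp add: complex_eq_iff)
  then have "exp (- z * of_real x) = iexp (- Im z * x)" for x
    by (metis mult.assoc of_real_mult)
  then show ?thesis by (simp add: laplace_def char_def)
qed

context
  fixes \<mu> :: "real measure"
  assumes \<mu>: "real_distribution \<mu>" and nonneg: "AE x in \<mu>. 0 \<le> x"
begin

interpretation real_distribution \<mu> by (rule \<mu>)

lemma laplace_max: "laplace \<mu> z = (LINT x|\<mu>. exp (- z * of_real (max 0 x)))"
  unfolding laplace_def by (rule integral_cong_AE) (use nonneg in auto)

lemma laplace_holomorphic: "laplace \<mu> holomorphic_on {z. 0 < Re z}"
  unfolding laplace_max[abs_def]
  by (rule holomorphic_on_lebesgue_integral[where g = "\<lambda>_. 1"])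
     (auto intro!: holomorphic_intros open_halfspace_Re_gt simp: max_def)

lemma laplace_continuous: "continuous_on {z. 0 \<le> Re z} (laplace \<mu>)"
  unfolding laplace_max[abs_def]
  by (rule continuous_on_lebesgue_integral[where g = "\<lambda>_. 1"])
     (auto intro!: continuous_intros simp: max_def)

lemma norm_laplace_le_1: 
  assumes "0 \<le> Re z" shows "norm (laplace \<mu> z) \<le> 1"
proof -
  have "norm (laplace \<mu> z) \<le> (LINT x|\<mu>. norm (exp (- z * of_real (max 0 x))))"
    unfolding laplace_max by (rule integral_norm_bound)
  also have "\<dots> \<le> (LINT x|\<mu>. 1)"
    by (rule integral_mono_AE')
       (use assms in \<open>auto intro!: integrable_const_bound[where B = 1] AE_I2 simp: max_def\<close>)
  finally show ?thesis using prob_space by simp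
qed

lemma laplace_0: "laplace \<mu> 0 = 1"
  using prob_space by (simp add: laplace_def)

lemma laplace_of_real:
  assumes "0 \<le> x" shows "laplace \<mu> (of_real x) = of_real (LINT m|\<mu>. exp (- x * m))"
proof -
  have "exp (- of_real x * of_real m) = complex_of_real (exp (- x * m))" for m
    by (simp add: exp_of_real[symmetric])
  then show ?thesis by (simp add: laplace_def)
qed

lemma integrable_exp_minus:
  assumes "0 \<le> (x::real)" shows "integrable \<mu> (\<lambda>m. exp (- x * m))"
  by (rule integrable_const_bound[where B = 1]) (use nonneg assms in auto)

text \<open>
  Concavity of \<open>1 - exp (- x * m)\<close> in \<open>x\<close>. It will bound the Wiener-Hopf factors linearly on the
  positive axis, where the maximum principle only gives a quadratic bound; that gain excludes
  nonconstant polynomials in the uniqueness theorem.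
\<close>
lemma one_minus_laplace_scale:
  fixes x :: real
  assumes "1 \<le> x"
  shows "1 - (LINT m|\<mu>. exp (- x * m)) \<le> x * (1 - (LINT m|\<mu>. exp (- m)))"
proof -
  have *: "1 - exp (- x * m) \<le> x * (1 - exp (- m))" for m
  proof -
    have "exp ((1 - 1 / x) *\<^sub>R 0 + (1 / x) *\<^sub>R (- x * m)) \<le> (1 - 1 / x) * exp 0 + (1 / x) * exp (- x * m)"
      using assms by (intro convex_onD[OF exp_convex]) auto
    then have "x * exp (- m) \<le> x * ((1 - 1 / x) + (1 / x) * exp (- x * m))"
      using assms by (intro mult_left_mono) auto
    also have "\<dots> = x - 1 + exp (- x * m)" using assms by (simp add: algebra_simps)
    finally show ?thesis by (simp add: algebra_simps)
  qed
  have i: "integrable \<mu> (\<lambda>m. exp (- x * m))" "integrable \<mu> (\<lambda>m. exp (- m))"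
    using integrable_exp_minus[of x] integrable_exp_minus[of 1] assms by auto
  have "(LINT m|\<mu>. 1 - exp (- x * m)) \<le> (LINT m|\<mu>. x * (1 - exp (- m)))"
    using i * by (intro integral_mono) auto
  moreover have "(LINT m|\<mu>. 1 - exp (- x * m)) = 1 - (LINT m|\<mu>. exp (- x * m))"
    using i prob_space by (subst Bochner_Integration.integral_diff) auto
  moreover have "(LINT m|\<mu>. 1 - exp (- m)) = 1 - (LINT m|\<mu>. exp (- m))"
    using i prob_space by (subst Bochner_Integration.integral_diff) auto
  ultimately show ?thesis by simp
qed

end

text \<open>
  A series is an integral over the counting measure.
\<close>
lemma geometric_suminf_holomorphic:
  fixes f :: "nat \<Rightarrow> complex \<Rightarrow> complex" and r :: real
  assumes "open S" "\<And>n. f n holomorphic_on S" "\<And>n z. z \<in> S \<Longrightarrow> norm (f n z) \<le> B" "0 \<le> r" "r < 1"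
  shows "(\<lambda>z. \<Sum>n. of_real r ^ n * f n z) holomorphic_on S"
proof -
  have dom: "norm (of_real r ^ n * f n z) \<le> r ^ n * B" if "z \<in> S" for n z
    using assms(3)[OF that] assms(4) by (simp add: norm_mult norm_power mult_left_mono)
  have sm: "summable (\<lambda>n. norm (of_real r ^ n * f n z))" if "z \<in> S" for z
    by (rule summable_comparison_test'[where g = "\<lambda>n. r ^ n * B"])
      (use assms(4,5) dom[OF that] in \<open>auto intro!: summable_mult2 summable_geometric\<close>)
  have dom': "norm (of_real r ^ n * f n z) \<le> r ^ n * \<bar>B\<bar>" if "z \<in> S" for n z
    using order_trans[OF assms(3)[OF that] abs_ge_self] assms(4) by (simp add: norm_mult norm_power mult_left_mono)
  have int: "integrable (count_space UNIV) (\<lambda>n. r ^ n * \<bar>B\<bar>)"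
    using assms(4,5) by (auto simp: integrable_count_space_nat_iff abs_mult intro!: summable_mult2 summable_geometric)
  have "(\<lambda>z. LINT n|count_space UNIV. of_real r ^ n * f n z) holomorphic_on S"
    by (rule holomorphic_on_lebesgue_integral[OF assms(1) _ _ int])
       (auto intro!: holomorphic_intros assms(2) dom'[simplified])
  then show ?thesis
    by (rule holomorphic_transform) (use sm in \<open>simp add: integral_count_space_nat integrable_count_space_nat_iff\<close>)
qed

lemma geometric_suminf_continuous:
  fixes f :: "nat \<Rightarrow> complex \<Rightarrow> complex" and r :: real
  assumes "\<And>n. continuous_on S (f n)" "\<And>n z. z \<in> S \<Longrightarrow> norm (f n z) \<le> B" "0 \<le> r" "r < 1"
  shows "continuous_on S (\<lambda>z. \<Sum>n. of_real r ^ n * f n z)"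
proof -
  have dom: "norm (of_real r ^ n * f n z) \<le> r ^ n * B" if "z \<in> S" for n z
    using assms(2)[OF that] assms(3) by (simp add: norm_mult norm_power mult_left_mono)
  have sm: "summable (\<lambda>n. norm (of_real r ^ n * f n z))" if "z \<in> S" for z
    by (rule summable_comparison_test'[where g = "\<lambda>n. r ^ n * B"])
      (use assms(3,4) dom[OF that] in \<open>auto intro!: summable_mult2 summable_geometric\<close>)
  have dom': "norm (of_real r ^ n * f n z) \<le> r ^ n * \<bar>B\<bar>" if "z \<in> S" for n z
    using order_trans[OF assms(2)[OF that] abs_ge_self] assms(3) by (simp add: norm_mult norm_power mult_left_mono)
  have int: "integrable (count_space UNIV) (\<lambda>n. r ^ n * \<bar>B\<bar>)"
    using assms(3,4) by (auto simp: integrable_count_space_nat_iff abs_mult intro!: summable_mult2 summable_geometric)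
  have "continuous_on S (\<lambda>z. LINT n|count_space UNIV. of_real r ^ n * f n z)"
    by (rule continuous_on_lebesgue_integral[OF _ _ int])
       (auto intro!: continuous_intros assms(1) dom'[simplified])
  then show ?thesis
    by (rule continuous_on_eq) (use sm in \<open>simp add: integral_count_space_nat integrable_count_space_nat_iff\<close>)
qed

lemma geometric_suminf_bound:
  fixes f :: "nat \<Rightarrow> 'a::banach" and r :: real
  assumes "\<And>n. norm (f n) \<le> B" "0 \<le> r" "r < 1"
  shows "summable (\<lambda>n. (r ^ n) *\<^sub>R f n)" "norm (\<Sum>n. (r ^ n) *\<^sub>R f n) \<le> B / (1 - r)"
proof -
  have dom: "norm ((r ^ n) *\<^sub>R f n) \<le> r ^ n * B" for n
    using assms(1)[of n] assms(2) by (simp add: mult_left_mono)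
  have g: "summable (\<lambda>n. r ^ n * B)" 
    using assms(2,3) by (intro summable_mult2 summable_geometric) auto
  show 1: "summable (\<lambda>n. (r ^ n) *\<^sub>R f n)"
    by (rule summable_comparison_test'[OF g dom])
  have "norm (\<Sum>n. (r ^ n) *\<^sub>R f n) \<le> (\<Sum>n. r ^ n * B)"
    by (rule norm_suminf_le[OF dom g])
  also have "\<dots> = B / (1 - r)"
    using assms(2,3) by (subst suminf_mult2[symmetric]) (auto simp: suminf_geometric summable_geometric)
  finally show "norm (\<Sum>n. (r ^ n) *\<^sub>R f n) \<le> B / (1 - r)" .
qed

lemma geometric_suminf_recursion:
  fixes a b :: "nat \<Rightarrow> complex"
  assumes sa: "summable (\<lambda>n. r ^ n * a n)" and sb: "summable (\<lambda>n. r ^ n * b n)"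
    and rec: "\<And>n. a (Suc n) = c * a n + b n"
  shows "(\<Sum>n. r ^ n * a n) * (1 - r * c) = a 0 + r * (\<Sum>n. r ^ n * b n)"
proof -
  define A B where "A = (\<Sum>n. r ^ n * a n)" and "B = (\<Sum>n. r ^ n * b n)"
  have "(\<lambda>n. r ^ n * a n) sums A" "(\<lambda>n. r ^ n * b n) sums B"
    using sa sb by (simp_all add: A_def B_def summable_sums)
  then have "(\<lambda>n. r * c * (r ^ n * a n) + r * (r ^ n * b n)) sums (r * c * A + r * B)"
    by (intro sums_add sums_mult)
  then have "(\<lambda>n. r ^ Suc n * a (Suc n)) sums (r * c * A + r * B)"
    by (simp add: rec algebra_simps)
  then have "(\<lambda>n. r ^ n * a n) sums (r * c * A + r * B + a 0)"
    by (subst (asm) sums_Suc_iff) simp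
  then have "A = r * c * A + r * B + a 0"
    using \<open>_ sums A\<close> sums_unique2 by blast
  then show ?thesis unfolding A_def[symmetric] B_def[symmetric] by algebra
qed

text \<open>
  The law of the maximum of the first \<open>n\<close> partial sums (with the empty sum) of a random walk with
  step law \<open>\<nu>\<close>, through Lindley's recursion: conditionally on the first step, the maximum is
  \<open>max 0 (y + m)\<close> for the maximum \<open>m\<close> of the remaining walk.
\<close>
primrec walk_max :: "real measure \<Rightarrow> nat \<Rightarrow> real measure" where
  "walk_max \<nu> 0 = return borel 0"
| "walk_max \<nu> (Suc n) = distr (\<nu> \<Otimes>\<^sub>M walk_max \<nu> n) borel (\<lambda>(y, m). max 0 (y + m))"

text \<open>
  The part of the new partial sum that the recursion cuts off.
\<close>
definition walk_undershoot :: "real measure \<Rightarrow> nat \<Rightarrow> real measure" where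
  "walk_undershoot \<nu> n = distr (\<nu> \<Otimes>\<^sub>M walk_max \<nu> n) borel (\<lambda>(y, m). max 0 (- (y + m)))"

text \<open>
  The Laplace transform of the maximum of the walk at an independent time that is geometric with
  parameter \<open>r\<close>.
\<close>
definition geometric_max :: "real measure \<Rightarrow> real \<Rightarrow> complex \<Rightarrow> complex" where
  "geometric_max \<nu> r z = (1 - of_real r) * (\<Sum>n. of_real r ^ n * laplace (walk_max \<nu> n) z)"

text \<open>
  The normalisation makes this function the reciprocal of \<open>geometric_max\<close> for the reflected walk.
\<close>
definition geometric_under :: "real measure \<Rightarrow> real \<Rightarrow> complex \<Rightarrow> complex" where
  "geometric_under \<nu> r z = 1 + of_real r * (\<Sum>n. of_real r ^ n * (1 - laplace (walk_undershoot \<nu> n) z))"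

context
  fixes \<nu> :: "real measure"
  assumes \<nu>: "real_distribution \<nu>"
begin

interpretation \<nu>: real_distribution \<nu> by (rule \<nu>)

lemma real_distribution_walk_max: "real_distribution (walk_max \<nu> n)"
proof (induction n)
  case 0
  show ?case by (auto simp: real_distribution_def real_distribution_axioms_def prob_space_return)
next
  case (Suc n)
  interpret m: real_distribution "walk_max \<nu> n" by fact
  interpret pair_prob_space \<nu> "walk_max \<nu> n" ..
  show ?case unfolding walk_max.simps
    by (rule real_distribution_distrI) (auto intro: prob_space_axioms)
qed

lemma walk_max_nonneg: "AE x in walk_max \<nu> n. 0 \<le> x"
proof (cases n)
  case 0
  show ?thesis unfolding 0 walk_max.simps by (subst AE_return) auto
next
  case (Suc n)
  interpret m: real_distribution "walk_max \<nu> n" by (rule real_distribution_walk_max)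
  show ?thesis unfolding Suc walk_max.simps
    by (subst AE_distr_iff) (auto simp: case_prod_beta)
qed

lemma real_distribution_walk_undershoot: "real_distribution (walk_undershoot \<nu> n)"
proof -
  interpret m: real_distribution "walk_max \<nu> n" by (rule real_distribution_walk_max)
  interpret pair_prob_space \<nu> "walk_max \<nu> n" ..
  show ?thesis unfolding walk_undershoot_def
    by (rule real_distribution_distrI) (auto intro: prob_space_axioms)
qed

lemma walk_undershoot_nonneg: "AE x in walk_undershoot \<nu> n. 0 \<le> x"
proof -
  interpret m: real_distribution "walk_max \<nu> n" by (rule real_distribution_walk_max)
  show ?thesis unfolding walk_undershoot_def
    by (subst AE_distr_iff) (auto simp: case_prod_beta)
qed

lemmas walk_max_facts = real_distribution_walk_max walk_max_nonneg
lemmas walk_undershoot_facts = real_distribution_walk_undershoot walk_undershoot_nonneg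

text \<open>
  With \<open>s = y + m\<close>, one of \<open>max 0 s\<close> and \<open>max 0 (- s)\<close> vanishes and
  \<open>exp (- z * max 0 s) + exp (z * max 0 (- s)) = exp (- z * s) + 1\<close>. The restriction to the axis makes
  all the exponentials bounded.
\<close>
lemma laplace_walk_max_Suc:
  assumes z: "Re z = 0"
  shows "laplace (walk_max \<nu> (Suc n)) z =
     laplace \<nu> z * laplace (walk_max \<nu> n) z + (1 - laplace (walk_undershoot \<nu> n) (- z))"
proof -
  interpret m: real_distribution "walk_max \<nu> n" by (rule real_distribution_walk_max)
  interpret P: pair_prob_space \<nu> "walk_max \<nu> n" ..
  let ?P = "\<nu> \<Otimes>\<^sub>M walk_max \<nu> n"
  have int: "integrable ?P (\<lambda>p. exp (- z * of_real (f p)))" if "f \<in> borel_measurable ?P" for f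
    using z that by (intro P.integrable_const_bound[where B = 1]) auto
  have pt: "exp (- z * of_real (max 0 s)) = exp (- z * of_real s) + (1 - exp (z * of_real (max 0 (- s))))" for s :: real
    by (cases "s \<ge> 0") auto
  have "laplace (walk_max \<nu> (Suc n)) z = (LINT p|?P. exp (- z * of_real (max 0 (fst p + snd p))))"
    by (simp add: laplace_distr case_prod_beta)
  also have "\<dots> = (LINT p|?P. exp (- z * of_real (fst p + snd p)) + (1 - exp (- (- z) * of_real (max 0 (- (fst p + snd p))))))"
    by (subst pt) simp
  also have "\<dots> = (LINT p|?P. exp (- z * of_real (fst p + snd p))) + (1 - (LINT p|?P. exp (- (- z) * of_real (max 0 (- (fst p + snd p))))))"
  proof -
    have i1: "integrable ?P (\<lambda>p. exp (- z * of_real (fst p + snd p)))" by (rule int) measurable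
    have i2: "integrable ?P (\<lambda>p. exp (- (- z) * of_real (max 0 (- (fst p + snd p)))))"
      using z by (intro P.integrable_const_bound[where B = 1]) auto
    have i3: "integrable ?P (\<lambda>p. 1 :: complex)" by simp
    show ?thesis
      unfolding Bochner_Integration.integral_add[OF i1 Bochner_Integration.integrable_diff[OF i3 i2]]
        Bochner_Integration.integral_diff[OF i3 i2]
      using P.prob_space by simp
  qed
  also have "(LINT p|?P. exp (- (- z) * of_real (max 0 (- (fst p + snd p))))) = laplace (walk_undershoot \<nu> n) (- z)"
    unfolding walk_undershoot_def by (subst laplace_distr) (auto simp: case_prod_beta)
  also have "(LINT p|?P. exp (- z * of_real (fst p + snd p))) = (LINT y|\<nu>. LINT m|walk_max \<nu> n. exp (- z * of_real y) * exp (- z * of_real m))"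
    using int[of "\<lambda>p. fst p + snd p"]
    by (subst P.integral_fst'[symmetric]) (auto simp: exp_add[symmetric] algebra_simps)
  also have "\<dots> = laplace \<nu> z * laplace (walk_max \<nu> n) z"
    by (simp add: laplace_def)
  finally show ?thesis .
qed

lemma norm_one_minus_laplace: "0 \<le> Re z \<Longrightarrow> norm (1 - laplace (walk_undershoot \<nu> n) z) \<le> 2"
  using norm_triangle_ineq4[of 1 "laplace (walk_undershoot \<nu> n) z"] norm_laplace_le_1[OF walk_undershoot_facts, of z n] by simp

context
  fixes r :: real
  assumes r: "0 \<le> r" "r < 1"
begin

lemma summable_max: "0 \<le> Re z \<Longrightarrow> summable (\<lambda>n. of_real r ^ n * laplace (walk_max \<nu> n) z)"
  and summable_under: "0 \<le> Re z \<Longrightarrow> summable (\<lambda>n. of_real r ^ n * (1 - laplace (walk_undershoot \<nu> n) z))"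
  and norm_geometric_max: "0 \<le> Re z \<Longrightarrow> norm (geometric_max \<nu> r z) \<le> 1"
  and norm_geometric_under: "0 \<le> Re z \<Longrightarrow> norm (geometric_under \<nu> r z) \<le> 1 + 2 / (1 - r)"
proof -
  assume z: "0 \<le> Re z"
  have 1: "summable (\<lambda>n. of_real r ^ n * laplace (walk_max \<nu> n) z)"
     "norm (\<Sum>n. of_real r ^ n * laplace (walk_max \<nu> n) z) \<le> 1 / (1 - r)"
    using geometric_suminf_bound[OF norm_laplace_le_1[OF walk_max_facts z] r] by (simp_all add: scaleR_conv_of_real)
  have 2: "summable (\<lambda>n. of_real r ^ n * (1 - laplace (walk_undershoot \<nu> n) z))"
     "norm (\<Sum>n. of_real r ^ n * (1 - laplace (walk_undershoot \<nu> n) z)) \<le> 2 / (1 - r)"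
    using geometric_suminf_bound[OF norm_one_minus_laplace[OF z] r] by (simp_all add: scaleR_conv_of_real)
  show "summable (\<lambda>n. of_real r ^ n * laplace (walk_max \<nu> n) z)"
    "summable (\<lambda>n. of_real r ^ n * (1 - laplace (walk_undershoot \<nu> n) z))" by fact+
  have "norm (1 - complex_of_real r) = 1 - r"
    using r by (metis abs_of_nonneg diff_ge_0_iff_ge less_imp_le norm_of_real of_real_1 of_real_diff)
  then have "norm (geometric_max \<nu> r z) \<le> (1 - r) * (1 / (1 - r))"
    unfolding geometric_max_def norm_mult using 1(2) r by (simp only:) (intro mult_left_mono, auto)
  then show "norm (geometric_max \<nu> r z) \<le> 1" using r by simp
  have "norm (geometric_under \<nu> r z) \<le> 1 + r * (2 / (1 - r))"
    unfolding geometric_under_def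
    by (rule norm_triangle_le) (use 2(2) r in \<open>simp add: norm_mult mult_left_mono del: times_divide_eq_right\<close>)
  also have "\<dots> \<le> 1 + 1 * (2 / (1 - r))" using r by (intro add_left_mono mult_right_mono) auto
  finally show "norm (geometric_under \<nu> r z) \<le> 1 + 2 / (1 - r)" by simp
qed

lemma geometric_max_holomorphic: "geometric_max \<nu> r holomorphic_on {z. 0 < Re z}"
  unfolding geometric_max_def[abs_def]
  by (intro holomorphic_intros geometric_suminf_holomorphic[where B = 1] open_halfspace_Re_gt
       laplace_holomorphic walk_max_facts norm_laplace_le_1 r) auto

lemma geometric_max_continuous: "continuous_on {z. 0 \<le> Re z} (geometric_max \<nu> r)"
  unfolding geometric_max_def[abs_def]
  by (intro continuous_intros geometric_suminf_continuous[where B = 1]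
       laplace_continuous walk_max_facts norm_laplace_le_1 r) auto

lemma geometric_under_holomorphic: "geometric_under \<nu> r holomorphic_on {z. 0 < Re z}"
  unfolding geometric_under_def[abs_def]
  by (intro holomorphic_intros geometric_suminf_holomorphic[where B = 2] open_halfspace_Re_gt
       laplace_holomorphic walk_undershoot_facts norm_one_minus_laplace r) auto

lemma geometric_under_continuous: "continuous_on {z. 0 \<le> Re z} (geometric_under \<nu> r)"
  unfolding geometric_under_def[abs_def]
  by (intro continuous_intros geometric_suminf_continuous[where B = 2]
       laplace_continuous walk_undershoot_facts norm_one_minus_laplace r) auto

lemma geometric_max_0: "geometric_max \<nu> r 0 = 1"
proof -
  have "(\<Sum>n. complex_of_real r ^ n) = 1 / (1 - complex_of_real r)"
    by (rule suminf_geometric) (use r in simp)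
  moreover have "1 - complex_of_real r \<noteq> 0" using r by (simp add: complex_eq_iff)
  ultimately show ?thesis by (simp add: geometric_max_def laplace_0[OF walk_max_facts])
qed

lemma geometric_under_0: "geometric_under \<nu> r 0 = 1"
  by (simp add: geometric_under_def laplace_0[OF walk_undershoot_facts])

text \<open>
  Lindley's recursion, summed with the geometric weights. The first factor on each side is
  holomorphic off the axis, on the right for \<open>geometric_max\<close> and on the left for the other one.
\<close>
lemma geometric_max_axis:
  assumes z: "Re z = 0"
  shows "geometric_max \<nu> r z * (1 - of_real r * laplace \<nu> z) = (1 - of_real r) * geometric_under \<nu> r (- z)"
proof -
  let ?a = "\<lambda>n. laplace (walk_max \<nu> n) z" and ?b = "\<lambda>n. 1 - laplace (walk_undershoot \<nu> n) (- z)"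
  define A where "A = (\<Sum>n. of_real r ^ n * ?a n)"
  define B where "B = (\<Sum>n. of_real r ^ n * ?b n)"
  have sa: "summable (\<lambda>n. of_real r ^ n * ?a n)"
    by (rule summable_max) (simp add: z)
  have sb: "summable (\<lambda>n. of_real r ^ n * ?b n)"
    by (rule summable_under) (simp add: z)
  have "A * (1 - of_real r * laplace \<nu> z) = ?a 0 + of_real r * B"
    unfolding A_def B_def using sa sb
    by (intro geometric_suminf_recursion) (simp_all only: of_real_power laplace_walk_max_Suc[OF z])
  moreover have "?a 0 = 1"
    by (simp add: laplace_def integral_return)
  ultimately have "A * (1 - of_real r * laplace \<nu> z) = 1 + of_real r * B" by simp
  then show ?thesis
    by (simp add: geometric_max_def geometric_under_def A_def B_def mult.assoc)
qed

lemma geometric_under_of_real: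
  assumes "0 \<le> x"
  shows "geometric_under \<nu> r (of_real x) =
     of_real (1 + r * (\<Sum>n. r ^ n * (1 - (LINT m|walk_undershoot \<nu> n. exp (- x * m)))))"
proof -
  have "complex_of_real (\<Sum>n. r ^ n * (1 - (LINT m|walk_undershoot \<nu> n. exp (- x * m)))) =
    (\<Sum>n. of_real (r ^ n * (1 - (LINT m|walk_undershoot \<nu> n. exp (- x * m)))))"
  proof (rule bounded_linear.suminf[OF bounded_linear_of_real])
    have "summable (\<lambda>n. complex_of_real (r ^ n * (1 - (LINT m|walk_undershoot \<nu> n. exp (- x * m)))))"
      using summable_under[of "of_real x"] assms by (simp add: laplace_of_real[OF walk_undershoot_facts assms])
    then show "summable (\<lambda>n. r ^ n * (1 - (LINT m|walk_undershoot \<nu> n. exp (- x * m))))"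
      by (simp only: of_real_power[symmetric] of_real_mult[symmetric] summable_complex_of_real)
  qed
  then show ?thesis
    by (simp add: geometric_under_def laplace_of_real[OF walk_undershoot_facts assms])
qed

lemma geometric_under_growth:
  assumes x: "1 \<le> x"
  shows "norm (geometric_under \<nu> r (of_real x)) \<le> x * norm (geometric_under \<nu> r 1)"
proof -
  define d where "d y n = 1 - (LINT m|walk_undershoot \<nu> n. exp (- y * m))" for y n
  have eq: "geometric_under \<nu> r (of_real y) = of_real (1 + r * (\<Sum>n. r ^ n * d y n))" if "0 \<le> y" for y
    using geometric_under_of_real[OF that] by (simp add: d_def)
  have sm: "summable (\<lambda>n. r ^ n * d y n)" if "0 \<le> y" for y
  proof -
    have "summable (\<lambda>n. complex_of_real (r ^ n * d y n))"
      using summable_under[of "of_real y"] that by (simp add: d_def laplace_of_real[OF walk_undershoot_facts that])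
    then show ?thesis by (simp only: of_real_power[symmetric] of_real_mult[symmetric] summable_complex_of_real)
  qed
  have d_nonneg: "0 \<le> d y n" if "0 \<le> y" for y n
    using norm_laplace_le_1[OF walk_undershoot_facts, of "of_real y" n] that
    by (simp add: d_def laplace_of_real[OF walk_undershoot_facts that])
  have s_nonneg: "0 \<le> (\<Sum>n. r ^ n * d y n)" if "0 \<le> y" for y
    using d_nonneg[OF that] r by (intro suminf_nonneg sm that) auto
  have "(\<Sum>n. r ^ n * d x n) \<le> (\<Sum>n. x * (r ^ n * d 1 n))"
  proof (rule suminf_le)
    show "r ^ n * d x n \<le> x * (r ^ n * d 1 n)" for n
      using mult_left_mono[OF one_minus_laplace_scale[OF walk_undershoot_facts x, of n], of "r ^ n"] r
      by (simp add: d_def algebra_simps)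
  qed (use sm x in \<open>auto intro!: summable_mult\<close>)
  also have "\<dots> = x * (\<Sum>n. r ^ n * d 1 n)" using sm[of 1] by (simp add: suminf_mult)
  finally have "1 + r * (\<Sum>n. r ^ n * d x n) \<le> x * (1 + r * (\<Sum>n. r ^ n * d 1 n))"
    using mult_left_mono[OF _ r(1)] x by (fastforce simp: algebra_simps)
  moreover have "norm (geometric_under \<nu> r (of_real y)) = 1 + r * (\<Sum>n. r ^ n * d y n)" if "0 \<le> y" for y
    unfolding eq[OF that] norm_of_real using s_nonneg[OF that] r by (intro abs_of_nonneg) auto
  from this[of x] this[of 1] x calculation show ?thesis by simp
qed

end
end

section \<open>Wiener-Hopf factorization of a random walk\<close>

context
  fixes \<nu> \<nu>' :: "real measure" and r :: real
  assumes \<nu>: "real_distribution \<nu>" and \<nu>': "\<nu>' = distr \<nu> borel uminus"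
    and r: "0 \<le> r" "r < 1"
begin

lemma real_distribution_dual: "real_distribution \<nu>'"
proof -
  interpret real_distribution \<nu> by (rule \<nu>)
  show ?thesis unfolding \<nu>' by (rule real_distribution_distrI) (auto intro: prob_space_axioms)
qed

lemma laplace_dual: "laplace \<nu>' z = laplace \<nu> (- z)"
proof -
  interpret real_distribution \<nu> by (rule \<nu>)
  show ?thesis unfolding \<nu>' by (subst laplace_distr) (auto simp: laplace_def)
qed

lemma dual_axis:
  assumes z: "Re z = 0"
  shows "geometric_max \<nu>' r (- z) * (1 - of_real r * laplace \<nu> z) = (1 - of_real r) * geometric_under \<nu>' r z"
  using geometric_max_axis[OF real_distribution_dual r, of "- z"] z by (simp add: laplace_dual)

text \<open>
  The identities \<open>geometric_max_axis\<close> for the walk and for the reflected walk contain the same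
  factor \<open>1 - r * laplace \<nu> z\<close>. Eliminating it equates a product that is bounded and holomorphic on the
  right with one that is so on the left, hence both are constant.
\<close>
lemma geometric_max_times_under:
  assumes z: "0 \<le> Re z"
  shows "geometric_max \<nu> r z * geometric_under \<nu>' r z = 1"
proof -
  define f where "f z = geometric_max \<nu> r z * geometric_under \<nu>' r z" for z
  define g where "g z = geometric_under \<nu> r (- z) * geometric_max \<nu>' r (- z)" for z
  have r1: "1 - complex_of_real r \<noteq> 0" using r by (simp add: complex_eq_iff)
  define h where "h z = (if 0 \<le> Re z then f z else g z)" for z
  have bound: "norm (geometric_max \<mu> r z * geometric_under \<kappa> r z) \<le> 1 + 2 / (1 - r)"
    if "0 \<le> Re z" "real_distribution \<mu>" "real_distribution \<kappa>" for z \<mu> \<kappa>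
  proof -
    have "norm (geometric_max \<mu> r z) * norm (geometric_under \<kappa> r z) \<le> 1 * (1 + 2 / (1 - r))"
      using norm_geometric_max[OF that(2) r that(1)] norm_geometric_under[OF that(3) r that(1)]
      by (intro mult_mono) auto
    then show ?thesis by (simp add: norm_mult)
  qed
  have "h holomorphic_on UNIV"
    unfolding h_def[abs_def]
  proof (rule holomorphic_paste_half_planes)
    show "f holomorphic_on {z. 0 < Re z}" unfolding f_def
      by (intro holomorphic_intros geometric_max_holomorphic geometric_under_holomorphic \<nu> real_distribution_dual r)
    show "continuous_on {z. 0 \<le> Re z} f" unfolding f_def
      by (intro continuous_intros geometric_max_continuous geometric_under_continuous \<nu> real_distribution_dual r)
    show "g holomorphic_on {z. Re z < 0}" unfolding g_def
      by (intro holomorphic_intros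
         holomorphic_on_compose_gen[OF _ geometric_max_holomorphic[OF real_distribution_dual r], of uminus, unfolded o_def]
         holomorphic_on_compose_gen[OF _ geometric_under_holomorphic[OF \<nu> r], of uminus, unfolded o_def]) auto
    show "continuous_on {z. Re z \<le> 0} g" unfolding g_def
      by (intro continuous_intros
         continuous_on_compose2[OF geometric_max_continuous[OF real_distribution_dual r], of _ uminus]
         continuous_on_compose2[OF geometric_under_continuous[OF \<nu> r], of _ uminus]) auto
    show "f z = g z" if "Re z = 0" for z
    proof -
      have 1: "geometric_max \<nu> r z * (1 - of_real r * laplace \<nu> z) = (1 - of_real r) * geometric_under \<nu> r (- z)"
        by (rule geometric_max_axis[OF \<nu> r that])
      have 2: "geometric_max \<nu>' r (- z) * (1 - of_real r * laplace \<nu> z) = (1 - of_real r) * geometric_under \<nu>' r z"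
        by (rule dual_axis[OF that])
      have "(1 - of_real r) * f z = (1 - of_real r) * g z"
        unfolding f_def g_def using 1 2 by algebra
      then show ?thesis using r1 by simp
    qed
  qed
  moreover have "bounded (range h)"
    unfolding bounded_iff
  proof (intro exI[of _ "1 + 2 / (1 - r)"] ballI)
    fix y assume "y \<in> range h"
    then obtain z where y: "y = h z" by blast
    show "norm y \<le> 1 + 2 / (1 - r)"
      using bound[of z \<nu> \<nu>'] bound[of "- z" \<nu>' \<nu>] \<nu> real_distribution_dual
      by (auto simp: y h_def f_def g_def mult.commute)
  qed
  ultimately have "h constant_on UNIV" by (rule Liouville_theorem)
  then have "h z = h 0" unfolding constant_on_def by auto
  then show ?thesis
    using z by (simp add: h_def f_def geometric_max_0[OF \<nu> r] geometric_under_0[OF real_distribution_dual r])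
qed

lemma geometric_wiener_hopf:
  assumes z: "Re z = 0"
  shows "geometric_max \<nu> r z * geometric_max \<nu>' r (- z) * (1 - of_real r * laplace \<nu> z) = 1 - of_real r"
  using geometric_max_times_under[of z] dual_axis[OF z] z by (simp add: mult.assoc)

text \<open>
  The reciprocal of \<open>geometric_max\<close> is \<open>geometric_under\<close> of the reflected walk. It is bounded by a
  constant that explodes as \<open>r\<close> tends to one, but on the axis \<open>dual_axis\<close> bounds it uniformly, and
  the maximum principle carries that bound inside.
\<close>
lemma geometric_max_lower_bound:
  assumes K: "K > 0" "\<And>z. Re z = 0 \<Longrightarrow> norm (1 - of_real r * laplace \<nu> z) \<le> (1 - r) * (K * norm (1 + z) ^ 2)"
    and z: "0 \<le> Re z"
  shows "1 \<le> norm (geometric_max \<nu> r z) * (K * norm (1 + z) ^ 2)"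
proof -
  have n1: "norm (1 - complex_of_real r) = 1 - r"
    using r by (metis abs_of_nonneg diff_ge_0_iff_ge less_imp_le norm_of_real of_real_1 of_real_diff)
  have "norm (geometric_under \<nu>' r z) \<le> K * norm (1 + z) ^ 2"
  proof (rule half_plane_maximum_modulus[OF geometric_under_holomorphic[OF real_distribution_dual r]
        geometric_under_continuous[OF real_distribution_dual r] norm_geometric_under[OF real_distribution_dual r] _ K(1) z])
    fix w :: complex assume w: "Re w = 0"
    have "(1 - r) * norm (geometric_under \<nu>' r w) = norm (geometric_max \<nu>' r (- w)) * norm (1 - of_real r * laplace \<nu> w)"
      using arg_cong[OF dual_axis[OF w], of norm] by (simp add: norm_mult n1)
    also have "\<dots> \<le> 1 * ((1 - r) * (K * norm (1 + w) ^ 2))"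
      using norm_geometric_max[OF real_distribution_dual r, of "- w"] K(2)[OF w] w by (intro mult_mono) auto
    finally show "norm (geometric_under \<nu>' r w) \<le> K * norm (1 + w) ^ 2" using r by simp
  qed
  then have "norm (geometric_max \<nu> r z) * norm (geometric_under \<nu>' r z) \<le> norm (geometric_max \<nu> r z) * (K * norm (1 + z) ^ 2)"
    by (intro mult_left_mono) auto
  then show ?thesis using geometric_max_times_under[OF z] by (metis norm_mult norm_one)
qed

lemma geometric_max_decay:
  assumes x: "1 \<le> x"
  shows "norm (geometric_max \<nu> r 1) \<le> x * norm (geometric_max \<nu> r (of_real x))"
proof -
  have 1: "norm (geometric_max \<nu> r (of_real x)) * norm (geometric_under \<nu>' r (of_real x)) = 1"
    using geometric_max_times_under[of "of_real x"] x by (simp add: norm_mult[symmetric])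
  have 2: "norm (geometric_max \<nu> r 1) * norm (geometric_under \<nu>' r 1) = 1"
    using geometric_max_times_under[of 1] by (simp add: norm_mult[symmetric])
  have 3: "norm (geometric_under \<nu>' r (of_real x)) \<le> x * norm (geometric_under \<nu>' r 1)"
    by (rule geometric_under_growth[OF real_distribution_dual r x])
  have "norm (geometric_max \<nu> r 1) * 1 \<le> norm (geometric_max \<nu> r 1) * (norm (geometric_max \<nu> r (of_real x)) * (x * norm (geometric_under \<nu>' r 1)))"
    unfolding 1[symmetric] using 3 by (intro mult_left_mono) auto
  also have "\<dots> = x * norm (geometric_max \<nu> r (of_real x)) * (norm (geometric_max \<nu> r 1) * norm (geometric_under \<nu>' r 1))"
    by simp
  finally show ?thesis by (simp add: 2)
qed

end

text \<open>
  Stable laws of different times differ by scaling only, so that this lemma expresses the maximum over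
  any grid through the maximum over a grid in the unit interval.
\<close>
lemma walk_max_scale:
  assumes \<nu>: "real_distribution \<nu>" and c: "0 \<le> c"
  shows "walk_max (distr \<nu> borel ((*) c)) n = distr (walk_max \<nu> n) borel ((*) c)"
proof (induction n)
  case 0
  show ?case by (simp add: distr_return)
next
  case (Suc n)
  interpret \<nu>: real_distribution \<nu> by (rule \<nu>)
  interpret m: real_distribution "walk_max \<nu> n" by (rule real_distribution_walk_max[OF \<nu>])
  interpret d: real_distribution "distr (walk_max \<nu> n) borel ((*) c)"
    by (rule real_distribution_distrI) (auto intro: m.prob_space_axioms)
  have max: "max 0 (c * a + c * b) = c * max 0 (a + b)" for a b
    using c by (simp add: max_mult_distrib_left distrib_left)
  have "walk_max (distr \<nu> borel ((*) c)) (Suc n) =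
    distr (distr \<nu> borel ((*) c) \<Otimes>\<^sub>M distr (walk_max \<nu> n) borel ((*) c)) borel (\<lambda>(y, m). max 0 (y + m))"
    by (simp add: Suc)
  also have "\<dots> = distr (distr (\<nu> \<Otimes>\<^sub>M walk_max \<nu> n) (borel \<Otimes>\<^sub>M borel) (\<lambda>(x, y). (c * x, c * y))) borel (\<lambda>(y, m). max 0 (y + m))"
    by (subst pair_measure_distr) (auto intro: d.sigma_finite_measure_axioms)
  also have "\<dots> = distr (distr (\<nu> \<Otimes>\<^sub>M walk_max \<nu> n) borel (\<lambda>(y, m). max 0 (y + m))) borel ((*) c)"
    by (subst (1 2) distr_distr) (auto simp: o_def case_prod_beta max)
  finally show ?case by simp
qed

text \<open>
  The maximum of the partial sums of \<open>y a, y (a + 1), ...\<close>. The starting index is a parameter because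
  Lindley's recursion removes the first step.
\<close>
primrec path_max :: "(nat \<Rightarrow> real) \<Rightarrow> nat \<Rightarrow> nat \<Rightarrow> real" where
  "path_max y a 0 = 0"
| "path_max y a (Suc n) = max 0 (y a + path_max y (Suc a) n)"

lemma path_max_cong: "(\<And>i. i \<in> {a..<a + n} \<Longrightarrow> y i = y' i) \<Longrightarrow> path_max y a n = path_max y' a n"
  by (induction n arbitrary: a) auto

lemma path_max_eq_Max: "path_max y a n = Max ((\<lambda>i. \<Sum>j<i. y (a + j)) ` {..n})"
proof (induction n arbitrary: a)
  case (Suc n)
  have "(\<lambda>i. \<Sum>j<i. y (a + j)) ` {..Suc n} = insert 0 ((\<lambda>s. y a + s) ` (\<lambda>i. \<Sum>j<i. y (Suc a + j)) ` {..n})"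
    by (simp add: atMost_Suc_eq_insert_0 image_image sum.lessThan_Suc_shift del: sum.lessThan_Suc)
  also have "Max \<dots> = max 0 (Max ((\<lambda>s. y a + s) ` (\<lambda>i. \<Sum>j<i. y (Suc a + j)) ` {..n}))"
    by (rule Max_insert) auto
  also have "Max ((\<lambda>s. y a + s) ` (\<lambda>i. \<Sum>j<i. y (Suc a + j)) ` {..n}) = y a + Max ((\<lambda>i. \<Sum>j<i. y (Suc a + j)) ` {..n})"
    by (rule mono_Max_commute[symmetric]) (auto simp: mono_def)
  finally show ?case by (simp add: Suc)
qed simp

lemma (in prob_space) distr_path_max:
  fixes Y :: "nat \<Rightarrow> 'a \<Rightarrow> real"
  assumes indep: "indep_vars (\<lambda>_. borel) Y {..<N}" and law: "\<And>i. i < N \<Longrightarrow> distr M borel (Y i) = \<nu>"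
  shows "a + n \<le> N \<Longrightarrow> random_variable borel (\<lambda>\<omega>. path_max (\<lambda>i. Y i \<omega>) a n) \<and>
     distr M borel (\<lambda>\<omega>. path_max (\<lambda>i. Y i \<omega>) a n) = walk_max \<nu> n"
proof (induction n arbitrary: a)
  case 0
  show ?case by (simp add: distr_const)
next
  case (Suc n)
  have Y[measurable]: "random_variable borel (Y i)" if "i < N" for i
    using indep that by (auto simp: indep_vars_def)
  have IH: "random_variable borel (\<lambda>\<omega>. path_max (\<lambda>i. Y i \<omega>) (Suc a) n)"
    "distr M borel (\<lambda>\<omega>. path_max (\<lambda>i. Y i \<omega>) (Suc a) n) = walk_max \<nu> n"
    using Suc.IH[of "Suc a"] Suc.prems by auto
  let ?B = "{Suc a..<Suc a + n}"
  have pm: "(\<lambda>y. path_max y b m) \<in> borel_measurable (PiM A (\<lambda>_. borel))" if "{b..<b + m} \<subseteq> A" for b m and A :: "nat set"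
    using that
  proof (induction m arbitrary: b)
    case (Suc m)
    have [measurable]: "(\<lambda>y. path_max y (Suc b) m) \<in> borel_measurable (PiM A (\<lambda>_. borel))"
      by (rule Suc.IH) (use Suc.prems in auto)
    have [measurable]: "(\<lambda>y. y b) \<in> borel_measurable (PiM A (\<lambda>_. borel))"
      by (rule measurable_component_singleton) (use Suc.prems in auto)
    show ?case by simp
  qed simp
  have ind: "indep_var (PiM {a} (\<lambda>_. borel)) (\<lambda>\<omega>. restrict (\<lambda>i. Y i \<omega>) {a})
      (PiM ?B (\<lambda>_. borel)) (\<lambda>\<omega>. restrict (\<lambda>i. Y i \<omega>) ?B)"
    by (rule indep_var_restrict[OF indep]) (use Suc.prems in auto)
  have "indep_var borel ((\<lambda>y. y a) \<circ> (\<lambda>\<omega>. restrict (\<lambda>i. Y i \<omega>) {a}))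
     borel ((\<lambda>y. path_max y (Suc a) n) \<circ> (\<lambda>\<omega>. restrict (\<lambda>i. Y i \<omega>) ?B))"
    by (rule indep_var_compose[OF ind]) (auto intro!: pm)
  moreover have "path_max (restrict (\<lambda>i. Y i \<omega>) ?B) (Suc a) n = path_max (\<lambda>i. Y i \<omega>) (Suc a) n" for \<omega>
    by (rule path_max_cong) auto
  ultimately have "indep_var borel (Y a) borel (\<lambda>\<omega>. path_max (\<lambda>i. Y i \<omega>) (Suc a) n)"
    by (simp add: o_def)
  then have joint: "distr M borel (Y a) \<Otimes>\<^sub>M distr M borel (\<lambda>\<omega>. path_max (\<lambda>i. Y i \<omega>) (Suc a) n)
     = distr M (borel \<Otimes>\<^sub>M borel) (\<lambda>\<omega>. (Y a \<omega>, path_max (\<lambda>i. Y i \<omega>) (Suc a) n))"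
    by (rule indep_var_distribution_eq[THEN iffD1, THEN conjunct2, THEN conjunct2])
  have aN: "a < N" using Suc.prems by simp
  have m[measurable]: "random_variable borel (Y a)" by (rule Y[OF aN])
  note IH(1)[measurable]
  have "walk_max \<nu> (Suc n) = distr (distr M (borel \<Otimes>\<^sub>M borel) (\<lambda>\<omega>. (Y a \<omega>, path_max (\<lambda>i. Y i \<omega>) (Suc a) n))) borel (\<lambda>(y, m). max 0 (y + m))"
    using joint law[OF aN] IH(2) by simp
  also have "\<dots> = distr M borel (\<lambda>\<omega>. path_max (\<lambda>i. Y i \<omega>) a (Suc n))"
    by (subst distr_distr) (auto simp: o_def)
  finally show ?case by simp
qed

section \<open>The supremum as a limit over grids\<close>

text \<open>
  Grids with mesh \<open>h\<close>; with \<open>h = 1 / n\<close> the grid covers the unit interval.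
\<close>
definition grid_max :: "(real \<Rightarrow> 'a \<Rightarrow> real) \<Rightarrow> real \<Rightarrow> nat \<Rightarrow> 'a \<Rightarrow> real" where
  "grid_max X h n \<omega> = Max ((\<lambda>i. X (real i * h) \<omega>) ` {..n})"

context levy_process
begin

lemma grid_max_measurable:
  assumes "0 \<le> h" shows "random_variable borel (grid_max X h n)"
  unfolding grid_max_def[abs_def] using assms by (intro borel_measurable_Max measurable_X) auto

lemma grid_max_nonneg: "AE \<omega> in M. \<forall>n h. 0 \<le> grid_max X h n \<omega>"
  using X_zero
proof eventually_elim
  case (elim \<omega>)
  have "X (real 0 * h) \<omega> \<le> grid_max X h n \<omega>" for n h
    unfolding grid_max_def by (intro Max_ge finite_imageI imageI) auto
  then show ?case using elim by simp
qed

lemma distr_grid_max: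
  assumes h: "0 \<le> h"
  shows "distr M borel (grid_max X h n) = walk_max (distr M borel (X h)) n"
proof -
  define Y where "Y i \<omega> = X (real (Suc i) * h) \<omega> - X (real i * h) \<omega>" for i \<omega>
  have "indep_vars (\<lambda>_. borel) Y {..<n}"
    using independent_increments[of "\<lambda>i. real i * h" n] h
    by (simp add: Y_def[abs_def] mult_right_mono)
  moreover have "distr M borel (Y i) = distr M borel (X h)" for i
    using stationary_increments[of "real i * h" h] h by (simp add: Y_def[abs_def] algebra_simps)
  ultimately have p: "random_variable borel (\<lambda>\<omega>. path_max (\<lambda>i. Y i \<omega>) 0 n)"
    "distr M borel (\<lambda>\<omega>. path_max (\<lambda>i. Y i \<omega>) 0 n) = walk_max (distr M borel (X h)) n"
    using distr_path_max[of Y n "distr M borel (X h)" 0 n] by auto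
  have "AE \<omega> in M. grid_max X h n \<omega> = path_max (\<lambda>i. Y i \<omega>) 0 n"
    using X_zero
  proof eventually_elim
    case (elim \<omega>)
    have "(\<Sum>j<i. Y (0 + j) \<omega>) = X (real i * h) \<omega>" for i
      unfolding Y_def using sum_lessThan_telescope[of "\<lambda>i. X (real i * h) \<omega>" i] elim by simp
    then show ?case by (simp add: grid_max_def path_max_eq_Max)
  qed
  then have "distr M borel (grid_max X h n) = distr M borel (\<lambda>\<omega>. path_max (\<lambda>i. Y i \<omega>) 0 n)"
    by (intro distr_cong_AE grid_max_measurable h p) auto
  then show ?thesis using p by simp
qed

end

text \<open>
  Otherwise some point of the interval would be the limit of points at which the function tends to
  infinity, against the existence of one-sided limits there.
\<close>
lemma cadlag_bdd_above:
  assumes "cadlag f" shows "bdd_above (f ` {0..1})"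
proof (rule ccontr)
  assume neg: "\<not> bdd_above (f ` {0..1})"
  have "\<exists>t\<in>{0..1}. f t > real n" for n
    using neg by (force simp: bdd_above_def not_le)
  then obtain t where t: "\<And>n. t n \<in> {0..1}" "\<And>n. f (t n) > real n" by metis
  obtain l r where l: "l \<in> {0..1}" "strict_mono r" "(t \<circ> r) \<longlonglongrightarrow> l"
    using compact_Icc[of 0 "1::real"] t(1) unfolding compact_def by metis
  have l0: "0 \<le> l" using l by auto
  have "\<exists>B. \<forall>\<^sub>F u in at_right l. f u \<le> B"
  proof
    have "(f \<longlongrightarrow> f l) (at_right l)" using assms l0 by (auto simp: cadlag_def)
    then show "\<forall>\<^sub>F u in at_right l. f u \<le> f l + 1"
      by (rule eventually_mono[OF order_tendstoD(2)[of _ _ _ "f l + 1"]]) auto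
  qed
  then obtain B1 where B1: "\<forall>\<^sub>F u in at_right l. f u \<le> B1" by blast
  have "\<exists>B. \<forall>\<^sub>F u in at_left l. 0 \<le> u \<longrightarrow> f u \<le> B"
  proof (cases "l = 0")
    case True
    then show ?thesis by (auto simp: eventually_at_filter intro!: exI[of _ 0])
  next
    case False
    then have "0 < l" using l0 by simp
    then obtain m where "(f \<longlongrightarrow> m) (at_left l)" using assms unfolding cadlag_def by blast
    then have "\<forall>\<^sub>F u in at_left l. f u < m + 1" by (rule order_tendstoD(2)) simp
    then show ?thesis by (intro exI[of _ "m + 1"]) (auto elim: eventually_mono)
  qed
  then obtain B2 where B2: "\<forall>\<^sub>F u in at_left l. 0 \<le> u \<longrightarrow> f u \<le> B2" by blast
  have "\<forall>\<^sub>F u in at l. 0 \<le> u \<longrightarrow> f u \<le> max (max B1 B2) (f l)"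
    using B1 B2 unfolding at_eq_sup_left_right eventually_sup by (auto elim: eventually_mono)
  then have "\<forall>\<^sub>F u in nhds l. 0 \<le> u \<longrightarrow> f u \<le> max (max B1 B2) (f l)"
    by (auto simp: eventually_at_filter elim: eventually_mono)
  then have "\<forall>\<^sub>F n in sequentially. 0 \<le> t (r n) \<longrightarrow> f (t (r n)) \<le> max (max B1 B2) (f l)"
    using l(3) unfolding o_def by (rule eventually_compose_filterlim)
  moreover obtain N where N: "max (max B1 B2) (f l) \<le> real N" using real_arch_simple by blast
  ultimately obtain n where n: "n \<ge> N" "0 \<le> t (r n) \<longrightarrow> f (t (r n)) \<le> max (max B1 B2) (f l)"
    using eventually_happens'[OF _ eventually_conj[OF eventually_ge_at_top[of N]]] by force
  have "real N \<le> real (r n)" using seq_suble[OF l(2), of n] n(1) by linarith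
  also have "\<dots> < f (t (r n))" by (rule t)
  also have "\<dots> \<le> real N" using n(2) t(1)[of "r n"] N by auto
  finally show False by simp
qed

text \<open>
  Right continuity suffices: a time \<open>u < 1\<close> is approached from the right by grid points, and the time
  \<open>1\<close> belongs to every grid.
\<close>
lemma grid_max_tendsto_sup:
  assumes f: "cadlag f"
  shows "(\<lambda>n. Max ((\<lambda>i. f (real i * (1 / real n))) ` {..n})) \<longlonglongrightarrow> (SUP u\<in>{0..1}. f u)"
proof (rule order_tendstoI)
  let ?Z = "\<lambda>n. Max ((\<lambda>i. f (real i * (1 / real n))) ` {..n})"
  have bdd: "bdd_above (f ` {0..1})" by (rule cadlag_bdd_above[OF f])
  have le: "?Z n \<le> (SUP u\<in>{0..1}. f u)" for n
    using bdd by (subst Max_le_iff) (auto intro!: cSUP_upper simp: divide_simps)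
  show "\<forall>\<^sub>F n in sequentially. ?Z n < a" if "(SUP u\<in>{0..1}. f u) < a" for a
    by (intro always_eventually allI le_less_trans[OF le that])
  show "\<forall>\<^sub>F n in sequentially. a < ?Z n" if a: "a < (SUP u\<in>{0..1}. f u)" for a
  proof -
    obtain u where u: "0 \<le> u" "u \<le> 1" "a < f u"
      using a bdd by (subst (asm) less_cSUP_iff) auto
    have ge: "f (real i * (1 / real n)) \<le> ?Z n" if "i \<le> n" for i n
      using that by (intro Max_ge) auto
    show ?thesis
    proof (cases "u = 1")
      case True
      show ?thesis
        using eventually_gt_at_top[of 0]
      proof eventually_elim
        case (elim n)
        then show ?case using ge[of n n] u True by simp
      qed
    next
      case False
      then have u1: "u < 1" using u by simp
      define j where "j n = nat (\<lfloor>u * real n\<rfloor> + 1)" for n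
      have j1: "real (j n) = of_int \<lfloor>u * real n\<rfloor> + 1" for n
        using u by (simp add: j_def)
      have j: "u * real n < real (j n)" "real (j n) \<le> u * real n + 1" for n
        unfolding j1 by linarith+
      have lim: "(\<lambda>n. real (j n) * (1 / real n)) \<longlonglongrightarrow> u"
      proof (rule tendsto_sandwich)
        show "\<forall>\<^sub>F n in sequentially. u \<le> real (j n) * (1 / real n)"
          using eventually_gt_at_top[of 0] by eventually_elim (use j in \<open>simp add: field_simps less_imp_le\<close>)
        show "\<forall>\<^sub>F n in sequentially. real (j n) * (1 / real n) \<le> u + 1 / real n"
          using eventually_gt_at_top[of 0] by eventually_elim (use j in \<open>simp add: field_simps\<close>)
        show "(\<lambda>n. u + 1 / real n) \<longlonglongrightarrow> u"
          using tendsto_add[OF tendsto_const[of u] lim_1_over_n] by simp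
      qed simp
      have "filterlim (\<lambda>n. real (j n) * (1 / real n)) (at_right u) sequentially"
        unfolding filterlim_at
      proof
        show "\<forall>\<^sub>F n in sequentially. real (j n) * (1 / real n) \<in> {u<..} \<and> real (j n) * (1 / real n) \<noteq> u"
          using eventually_gt_at_top[of 0]
        proof eventually_elim
          case (elim n)
          then have "u < real (j n) * (1 / real n)" using j(1)[of n] by (simp add: field_simps)
          then show ?case by auto
        qed
      qed (rule lim)
      moreover have "(f \<longlongrightarrow> f u) (at_right u)" using f u by (auto simp: cadlag_def)
      ultimately have "(\<lambda>n. f (real (j n) * (1 / real n))) \<longlonglongrightarrow> f u"
        by (rule filterlim_compose[rotated])
      then have "\<forall>\<^sub>F n in sequentially. a < f (real (j n) * (1 / real n))"
        using u(3) by (rule order_tendstoD)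
      moreover have "\<forall>\<^sub>F n in sequentially. real (j n) * (1 / real n) < 1"
        using lim u1 by (rule order_tendstoD)
      ultimately show ?thesis using eventually_gt_at_top[of 0]
      proof eventually_elim
        case (elim n)
        then have "j n \<le> n" by (simp add: field_simps)
        from ge[OF this] elim show ?case by linarith
      qed
    qed
  qed
qed

abbreviation exp_law :: "real measure" where
  "exp_law \<equiv> density lborel (\<lambda>x. ennreal (exponential_density 1 x))"

lemma prob_space_exp_law: "prob_space exp_law"
  by (rule prob_space_exponential_density) simp

lemma AE_exp_law_pos: "AE t in exp_law. 0 < t"
proof (subst AE_density)
  show "AE t in lborel. ennreal (exponential_density 1 t) > 0 \<longrightarrow> 0 < t"
    using AE_lborel_singleton[of "0::real"]
    by eventually_elim (auto simp: exponential_density_def split: if_splits)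
qed simp

lemma measure_exp_law_Ioc:
  assumes "0 \<le> a" "a \<le> b" shows "measure exp_law {a<..b} = exp (- a) - exp (- b)"
proof -
  interpret prob_space exp_law by (rule prob_space_exp_law)
  have D: "distributed exp_law lborel (\<lambda>x. x) (exponential_density 1)"
    unfolding distributed_def by (auto simp: exponential_density_def intro!: distr_id2)
  have m: "measure exp_law {a<..} = exp (- a)" if "0 \<le> a" for a :: real
    using exponential_distributedD_gt[OF D that] by (simp add: greaterThan_def)
  have "{a<..b} = {a<..} - {b<..}" by auto
  then have "measure exp_law {a<..b} = measure exp_law ({a<..} - {b<..})" by simp
  also have "\<dots> = measure exp_law {a<..} - measure exp_law {b<..}"
    using assms by (intro finite_measure_Diff) auto
  finally show ?thesis using assms m by simp
qed

text \<open>
  Rounding an exponential time to a grid of mesh \<open>1 / N\<close> gives a geometric number of steps. This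
  realises the geometric times for all \<open>N\<close> on one probability space.
\<close>
lemma exp_law_geometric:
  fixes g :: "nat \<Rightarrow> complex"
  assumes g: "\<And>n. norm (g n) \<le> 1" and N: "N > 0"
  defines "r \<equiv> exp (- 1 / real N)"
  shows "(LINT t|exp_law. g (nat \<lceil>t * real N\<rceil> - 1)) = (1 - of_real r) * (\<Sum>n. of_real r ^ n * g n)"
proof -
  interpret prob_space exp_law by (rule prob_space_exp_law)
  have r: "0 \<le> r" "r < 1" using N by (auto simp: r_def)
  define A where "A n = {real n / real N<..(real n + 1) / real N}" for n
  \<comment> \<open>the half-open intervals fit the ceiling; the exponential law ignores the times \<open>t \<le> 0\<close>\<close>
  have A_iff: "t \<in> A n \<longleftrightarrow> n = nat \<lceil>t * real N\<rceil> - 1" if "0 < t" for t n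
  proof -
    have pos: "0 < t * real N" using that N by simp
    then have c: "1 \<le> \<lceil>t * real N\<rceil>" by linarith
    have "t \<in> A n \<longleftrightarrow> real n < t * real N \<and> t * real N \<le> real n + 1"
      using N by (auto simp: A_def field_simps)
    also have "\<dots> \<longleftrightarrow> \<lceil>t * real N\<rceil> = int n + 1"
      by (subst ceiling_eq_iff) auto
    also have "\<dots> \<longleftrightarrow> n = nat \<lceil>t * real N\<rceil> - 1" using c by linarith
    finally show ?thesis .
  qed
  have mA: "measure exp_law (A n) = r ^ n * (1 - r)" for n
  proof -
    have "measure exp_law (A n) = exp (- (real n / real N)) - exp (- ((real n + 1) / real N))"
      unfolding A_def by (rule measure_exp_law_Ioc) (auto simp: divide_right_mono)
    also have "exp (- (real n / real N)) = r ^ n"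
      unfolding r_def exp_of_nat_mult[symmetric] by simp
    also have "exp (- ((real n + 1) / real N)) = r ^ Suc n"
      unfolding r_def exp_of_nat_mult[symmetric] by (simp add: add_divide_distrib algebra_simps)
    finally show ?thesis by (simp add: algebra_simps)
  qed
  have [measurable]: "A n \<in> sets borel" for n by (simp add: A_def)
  let ?f = "\<lambda>n t. indicator (A n) t *\<^sub>R g n"
  have int: "integrable exp_law (?f n)" for n
    by (intro integrable_scaleR_left integrable_real_indicator) (auto simp: emeasure_eq_measure)
  have one: "(\<lambda>n. ?f n t) sums g (nat \<lceil>t * real N\<rceil> - 1)" if "0 < t" for t
  proof -
    have "(\<lambda>n. ?f n t) = (\<lambda>n. if n = nat \<lceil>t * real N\<rceil> - 1 then g n else 0)"
      unfolding indicator_def A_iff[OF that] by auto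
    then show ?thesis using sums_single[of "nat \<lceil>t * real N\<rceil> - 1" g] by simp
  qed
  have val: "(LINT t|exp_law. norm (?f n t)) = norm (g n) * (r ^ n * (1 - r))" for n
    by (simp add: mA mult.commute)
  have val': "(LINT t|exp_law. ?f n t) = (1 - of_real r) * (of_real r ^ n * g n)" for n
  proof -
    have "(LINT t|exp_law. ?f n t) = (LINT t|exp_law. indicator (A n) t) *\<^sub>R g n"
      by (rule integral_scaleR_left) (auto intro!: integrable_real_indicator simp: emeasure_eq_measure)
    also have "(LINT t|exp_law. indicator (A n) t) = r ^ n * (1 - r)" by (simp add: mA)
    finally show ?thesis by (simp add: scaleR_conv_of_real algebra_simps)
  qed
  have "(LINT t|exp_law. g (nat \<lceil>t * real N\<rceil> - 1)) = (LINT t|exp_law. (\<Sum>n. ?f n t))"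
  proof (rule integral_cong_AE)
    show "AE t in exp_law. g (nat \<lceil>t * real N\<rceil> - 1) = (\<Sum>n. ?f n t)"
      using AE_exp_law_pos by eventually_elim (use one in \<open>simp add: sums_iff\<close>)
  qed measurable
  also have "\<dots> = (\<Sum>n. LINT t|exp_law. ?f n t)"
  proof (rule integral_suminf[OF int])
    show "AE t in exp_law. summable (\<lambda>n. norm (?f n t))"
      using AE_exp_law_pos
    proof eventually_elim
      case (elim t)
      have "(\<lambda>n. norm (?f n t)) = (\<lambda>n. if n = nat \<lceil>t * real N\<rceil> - 1 then norm (g n) else 0)"
        unfolding indicator_def A_iff[OF elim] by auto
      then show ?case by (simp add: summable_single)
    qed
    show "summable (\<lambda>n. LINT t|exp_law. norm (?f n t))"
      unfolding val
    proof (rule summable_comparison_test')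
      show "summable (\<lambda>n. r ^ n * 1)" using r by (intro summable_mult2 summable_geometric) auto
      show "norm (norm (g n) * (r ^ n * (1 - r))) \<le> r ^ n * 1" for n
        using r g[of n] mult_mono[of "norm (g n)" 1 "r ^ n * (1 - r)" "r ^ n * 1"]
        by (simp add: abs_mult mult_left_le)
    qed
  qed
  also have "\<dots> = (1 - of_real r) * (\<Sum>n. of_real r ^ n * g n)"
    unfolding val'
    using geometric_suminf_bound(1)[OF g r] by (intro suminf_mult) (simp add: scaleR_conv_of_real)
  finally show ?thesis .
qed

section \<open>Stable processes: passage to continuous time\<close>

lemma stable_exponent_scale:
  assumes "0 < c" shows "stable_exponent \<alpha> \<rho> (c * z) = of_real (c powr \<alpha>) * stable_exponent \<alpha> \<rho> z"
proof -
  have *: "\<bar>c * z\<bar> powr \<alpha> = c powr \<alpha> * \<bar>z\<bar> powr \<alpha>"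
    using assms by (simp add: abs_mult powr_mult)
  show ?thesis
    using assms unfolding stable_exponent_def Let_def *
    by (auto simp only: zero_less_mult_iff mult_less_0_iff of_real_mult mult_ac mult_zero_left mult_zero_right split: if_splits)
qed

lemma norm_one_minus_exp_le:
  assumes "0 \<le> Re w" shows "norm (1 - exp (- w)) \<le> norm w"
proof -
  have "norm (exp (- w) - exp 0) \<le> 1 * norm (- w - 0)"
  proof (rule field_differentiable_bound[of "{z. Re z \<le> 0}"])
    show "(exp has_field_derivative exp z) (at z within {z. Re z \<le> 0})" for z :: complex
      by (rule DERIV_exp[THEN has_field_derivative_at_within])
  qed (use assms in \<open>auto simp: convex_halfspace_Re_le\<close>)
  then show ?thesis by (simp add: norm_minus_commute)
qed

text \<open>
  Both \<open>1 - r\<close> and \<open>1 - r * laplace \<nu> z\<close> have the form \<open>1 - exp (- w / N)\<close> on the grid of mesh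
  \<open>1 / N\<close>, so this is where the characteristic exponent comes out of the limit.
\<close>
lemma exp_scaled_limit:
  fixes w :: complex
  shows "(\<lambda>N. (1 - exp (- w / of_nat N)) * of_nat N) \<longlonglongrightarrow> w"
proof (cases "w = 0")
  case False
  have d: "((\<lambda>h. (exp (0 + h) - exp 0) / h) \<longlongrightarrow> exp (0::complex)) (at 0)"
    using DERIV_exp[of "0::complex"] unfolding DERIV_def .
  have "(\<lambda>N. - w / of_nat N) \<longlonglongrightarrow> 0" by (rule lim_const_over_n)
  moreover have "\<forall>\<^sub>F N in sequentially. - w / of_nat N \<noteq> 0"
    using eventually_gt_at_top[of 0] by eventually_elim (use False in auto)
  ultimately have "filterlim (\<lambda>N. - w / of_nat N) (at 0) sequentially"
    by (simp add: filterlim_at)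
  from filterlim_compose[OF d this]
  have "(\<lambda>N. (exp (- w / of_nat N) - 1) / (- w / of_nat N)) \<longlonglongrightarrow> 1" by simp
  then have "(\<lambda>N. w * ((exp (- w / of_nat N) - 1) / (- w / of_nat N))) \<longlonglongrightarrow> w * 1"
    by (intro tendsto_intros)
  moreover have "\<forall>\<^sub>F N in sequentially. w * ((exp (- w / of_nat N) - 1) / (- w / of_nat N)) = (1 - exp (- w / of_nat N)) * of_nat N"
    using eventually_gt_at_top[of 0] by eventually_elim (use False in \<open>simp add: field_simps\<close>)
  ultimately show ?thesis using tendsto_cong by fastforce
qed simp

text \<open>
  A version of the supremum up to time \<open>1\<close> that is measurable by construction, for the process and
  for its reflection alike. On the null set without convergence the value of \<open>lim\<close> is arbitrary.
\<close>
definition sup_limit :: "(real \<Rightarrow> 'a \<Rightarrow> real) \<Rightarrow> 'a \<Rightarrow> real" where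
  "sup_limit X \<omega> = lim (\<lambda>n. grid_max X (1 / real n) n \<omega>)"

text \<open>
  By self-similarity this is the law of the supremum of the process up to an independent exponential
  time.
\<close>
definition exp_sup_law :: "'a measure \<Rightarrow> (real \<Rightarrow> 'a \<Rightarrow> real) \<Rightarrow> real \<Rightarrow> real measure" where
  "exp_sup_law M X \<alpha> = distr (exp_law \<Otimes>\<^sub>M M) borel (\<lambda>(t, \<omega>). t powr (1 / \<alpha>) * sup_limit X \<omega>)"

context stable_process
begin

lemma alpha_pos: "0 < \<alpha>" and alpha_less_2: "\<alpha> < 2"
  using parameters by (auto simp: admissible_def)

lemma index_bounds: "0 \<le> \<rho>" "\<rho> \<le> 1" "\<alpha> * \<rho> \<le> 1" "\<alpha> * (1 - \<rho>) \<le> 1"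
proof -
  consider "0 < \<alpha>" "\<alpha> < 1" "0 < \<rho>" "\<rho> < 1" | "\<alpha> = 1" "\<rho> = 1 / 2" | "1 < \<alpha>" "1 - 1 / \<alpha> \<le> \<rho>" "\<rho> \<le> 1 / \<alpha>"
    using parameters by (auto simp: admissible_def)
  then have "0 \<le> \<rho> \<and> \<rho> \<le> 1 \<and> \<alpha> * \<rho> \<le> 1 \<and> \<alpha> * (1 - \<rho>) \<le> 1"
  proof cases
    case 1
    then show ?thesis by (auto intro!: mult_le_one)
  next
    case 3
    then have "0 < 1 / \<alpha>" "1 / \<alpha> < 1" by auto
    with 3 have "0 \<le> \<rho>" "\<rho> \<le> 1" by linarith+
    with 3 show ?thesis by (auto simp: field_simps)
  qed auto
  then show "0 \<le> \<rho>" "\<rho> \<le> 1" "\<alpha> * \<rho> \<le> 1" "\<alpha> * (1 - \<rho>) \<le> 1" by auto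
qed

lemma Re_stable_exponent: "0 \<le> Re (stable_exponent \<alpha> \<rho> z)"
proof -
  have "0 \<le> \<alpha> * \<rho>" "0 \<le> \<alpha> * (1 - \<rho>)" using alpha_pos index_bounds by auto
  then have "\<bar>\<alpha> * (1 - 2 * \<rho>)\<bar> \<le> 1"
    using index_bounds(3,4) by (simp add: abs_le_iff algebra_simps)
  then have "pi * \<bar>\<alpha> * (1 - 2 * \<rho>)\<bar> \<le> pi * 1" by (intro mult_left_mono) auto
  moreover have "\<bar>pi * (\<alpha> * (1 - 2 * \<rho>)) / 2\<bar> = pi * \<bar>\<alpha> * (1 - 2 * \<rho>)\<bar> / 2"
    unfolding abs_divide abs_mult[of pi] by simp
  ultimately have "\<bar>pi * (\<alpha> * (1 - 2 * \<rho>)) / 2\<bar> \<le> pi / 2" by linarith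
  then have "0 \<le> cos (pi * (\<alpha> * (1 - 2 * \<rho>)) / 2)"
    by (intro cos_ge_zero; linarith)
  then show ?thesis
    by (simp add: stable_exponent_def Let_def Re_exp)
qed

lemma norm_stable_exponent: "norm (stable_exponent \<alpha> \<rho> z) \<le> 1 + z\<^sup>2"
proof -
  have "\<bar>z\<bar> powr \<alpha> \<le> 1 + z\<^sup>2"
  proof (cases "\<bar>z\<bar> \<le> 1")
    case True
    then have "\<bar>z\<bar> powr \<alpha> \<le> 1 powr \<alpha>" using alpha_pos by (intro powr_mono2) auto
    then show ?thesis using zero_le_power2[of z] by (auto intro: order_trans)
  next
    case False
    then have "\<bar>z\<bar> powr \<alpha> \<le> \<bar>z\<bar> powr 2" using alpha_less_2 by (intro powr_mono) auto
    also have "\<dots> = z\<^sup>2" using False by (simp add: powr_numeral)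
    finally show ?thesis by simp
  qed
  moreover have "norm (stable_exponent \<alpha> \<rho> z) \<le> \<bar>z\<bar> powr \<alpha>"
    by (auto simp: stable_exponent_def Let_def norm_mult)
  ultimately show ?thesis by linarith
qed

lemma real_distribution_X: "0 \<le> t \<Longrightarrow> real_distribution (distr M borel (X t))"
  using measurable_X by (rule real_distribution_distrI[OF prob_space_axioms])

text \<open>
  Self-similarity, read off from the characteristic function.
\<close>
lemma distr_X_scale:
  assumes "0 < s" "0 < t"
  shows "distr M borel (X s) = distr (distr M borel (X t)) borel ((*) ((s / t) powr (1 / \<alpha>)))"
proof (rule Levy_uniqueness)
  interpret t: real_distribution "distr M borel (X t)" using assms by (intro real_distribution_X) auto
  show "real_distribution (distr M borel (X s))" using assms by (intro real_distribution_X) auto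
  show "real_distribution (distr (distr M borel (X t)) borel ((*) ((s / t) powr (1 / \<alpha>))))"
    by (rule real_distribution_distrI) (auto intro: t.prob_space_axioms)
  let ?c = "(s / t) powr (1 / \<alpha>)"
  have c: "0 < ?c" "?c powr \<alpha> = s / t" using assms alpha_pos by (auto simp: powr_powr)
  have "char (distr (distr M borel (X t)) borel ((*) ?c)) z = char (distr M borel (X s)) z" for z
  proof -
    have "char (distr (distr M borel (X t)) borel ((*) ?c)) z = char (distr M borel (X t)) (?c * z)"
      unfolding char_def by (subst integral_distr) (auto simp: mult_ac)
    then show ?thesis
      using assms c by (simp add: char_X stable_exponent_scale)
  qed
  then show "char (distr M borel (X s)) = char (distr (distr M borel (X t)) borel ((*) ?c))"
    by auto
qed

lemma AE_grid_max_tendsto: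
  "AE \<omega> in M. (\<lambda>n. grid_max X (1 / real n) n \<omega>) \<longlonglongrightarrow> running_sup X 1 \<omega>"
  using cadlag_paths by eventually_elim (auto simp: grid_max_def running_sup_def dest: grid_max_tendsto_sup)

lemma AE_sup_limit: "AE \<omega> in M. sup_limit X \<omega> = running_sup X 1 \<omega>"
  using AE_grid_max_tendsto by eventually_elim (auto simp: sup_limit_def dest: limI)

lemma [measurable]: "random_variable borel (sup_limit X)"
  unfolding sup_limit_def[abs_def]
  by (rule borel_measurable_lim_metric) (auto intro: grid_max_measurable)

lemma AE_sup_limit_tendsto:
  "AE \<omega> in M. (\<lambda>n. grid_max X (1 / real n) n \<omega>) \<longlonglongrightarrow> sup_limit X \<omega>"
  using AE_grid_max_tendsto AE_sup_limit by eventually_elim auto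

lemma AE_sup_limit_nonneg: "AE \<omega> in M. 0 \<le> sup_limit X \<omega>"
  using AE_sup_limit_tendsto grid_max_nonneg
  by eventually_elim (auto intro: LIMSEQ_le_const)

lemma real_distribution_exp_sup_law: "real_distribution (exp_sup_law M X \<alpha>)"
proof -
  interpret E: prob_space exp_law by (rule prob_space_exp_law)
  interpret P: pair_prob_space exp_law M ..
  show ?thesis unfolding exp_sup_law_def
    by (rule real_distribution_distrI) (auto intro: P.prob_space_axioms)
qed

lemma AE_pair_nonneg: "AE p in exp_law \<Otimes>\<^sub>M M. 0 \<le> (case p of (t, \<omega>) \<Rightarrow> t powr (1 / \<alpha>) * sup_limit X \<omega>)"
proof -
  interpret E: prob_space exp_law by (rule prob_space_exp_law)
  interpret P: pair_prob_space exp_law M ..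
  have *: "AE \<omega> in M. 0 \<le> t powr (1 / \<alpha>) * sup_limit X \<omega>" for t
    using AE_sup_limit_nonneg by eventually_elim simp
  show ?thesis
  proof (rule P.AE_pair_measure)
    show "{p \<in> space (exp_law \<Otimes>\<^sub>M M). 0 \<le> (case p of (t, \<omega>) \<Rightarrow> t powr (1 / \<alpha>) * sup_limit X \<omega>)}
      \<in> sets (exp_law \<Otimes>\<^sub>M M)" by measurable
  qed (use * in \<open>auto intro!: AE_I2\<close>)
qed

lemma exp_sup_law_nonneg: "AE x in exp_sup_law M X \<alpha>. 0 \<le> x"
  unfolding exp_sup_law_def using AE_pair_nonneg by (subst AE_distr_iff) auto

lemma laplace_exp_sup_law:
  assumes "0 \<le> Re z"
  shows "laplace (exp_sup_law M X \<alpha>) z =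
    (LINT t|exp_law. LINT \<omega>|M. exp (- z * of_real (t powr (1 / \<alpha>) * sup_limit X \<omega>)))"
proof -
  interpret E: prob_space exp_law by (rule prob_space_exp_law)
  interpret P: pair_prob_space exp_law M ..
  let ?f = "\<lambda>p. exp (- z * of_real (case p of (t, \<omega>) \<Rightarrow> t powr (1 / \<alpha>) * sup_limit X \<omega>))"
  have "AE p in exp_law \<Otimes>\<^sub>M M. norm (?f p) \<le> 1"
    using AE_pair_nonneg by eventually_elim (use assms in simp)
  then have "integrable (exp_law \<Otimes>\<^sub>M M) ?f"
    by (intro P.integrable_const_bound[where B = 1]) auto
  then show ?thesis
    unfolding exp_sup_law_def
    by (subst laplace_distr, measurable) (subst P.integral_fst'[symmetric], auto)
qed

text \<open>
  The maximum over the first \<open>n\<close> points of the grid with mesh \<open>1 / N\<close> has the law of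
  \<open>(n / N) powr (1 / \<alpha>)\<close> times the maximum over the grid with mesh \<open>1 / n\<close> in the unit interval. With
  the exponential time \<open>t\<close> rounded to the grid, \<open>n / N\<close> tends to \<open>t\<close> and the maxima in the unit
  interval converge almost surely, so that dominated convergence applies twice.
\<close>
lemma geometric_max_tendsto:
  assumes z: "0 \<le> Re z"
  shows "(\<lambda>N. geometric_max (distr M borel (X (1 / real N))) (exp (- 1 / real N)) z)
    \<longlonglongrightarrow> laplace (exp_sup_law M X \<alpha>) z"
proof -
  interpret E: prob_space exp_law by (rule prob_space_exp_law)
  define \<nu> where "\<nu> N = distr M borel (X (1 / real N))" for N
  have \<nu>: "real_distribution (\<nu> N)" for N unfolding \<nu>_def by (intro real_distribution_X) auto
  define g where "g N n = laplace (walk_max (\<nu> N) n) z" for N n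
  have g1: "norm (g N n) \<le> 1" for N n
    unfolding g_def by (rule norm_laplace_le_1[OF real_distribution_walk_max[OF \<nu>] walk_max_nonneg[OF \<nu>] z])
  define Z where "Z n \<omega> = grid_max X (1 / real n) n \<omega>" for n \<omega>
  have [measurable]: "random_variable borel (Z n)" for n
    unfolding Z_def[abs_def] by (rule grid_max_measurable) auto
  \<comment> \<open>for \<open>n = 0\<close> both sides are \<open>1\<close>, because \<open>0 powr (1 / \<alpha>) = 0\<close> removes the degenerate grid\<close>
  have g_eq: "g N n = (LINT \<omega>|M. exp (- z * of_real ((real n / real N) powr (1 / \<alpha>) * Z n \<omega>)))" if N: "N > 0" for N n
  proof (cases "n = 0")
    case True
    then show ?thesis using prob_space by (simp add: g_def laplace_def integral_return)
  next
    case False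
    let ?c = "(real n / real N) powr (1 / \<alpha>)"
    have "\<nu> N = distr (\<nu> n) borel ((*) ?c)"
      unfolding \<nu>_def using False N distr_X_scale[of "1 / real N" "1 / real n"] by simp
    then have "walk_max (\<nu> N) n = distr (walk_max (\<nu> n) n) borel ((*) ?c)"
      using walk_max_scale[OF \<nu>] by simp
    also have "walk_max (\<nu> n) n = distr M borel (Z n)"
      unfolding \<nu>_def Z_def[abs_def] by (rule distr_grid_max[symmetric]) auto
    finally have "walk_max (\<nu> N) n = distr M borel (\<lambda>\<omega>. ?c * Z n \<omega>)"
      by (simp add: distr_distr o_def)
    then show ?thesis unfolding g_def by (simp add: laplace_distr)
  qed
  have "(\<lambda>N. LINT t|exp_law. g N (nat \<lceil>t * real N\<rceil> - 1)) \<longlonglongrightarrow>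
     (LINT t|exp_law. LINT \<omega>|M. exp (- z * of_real (t powr (1 / \<alpha>) * sup_limit X \<omega>)))"
  proof (rule integral_dominated_convergence[where w = "\<lambda>_. 1"])
    show "AE t in exp_law. (\<lambda>N. g N (nat \<lceil>t * real N\<rceil> - 1)) \<longlonglongrightarrow>
      (LINT \<omega>|M. exp (- z * of_real (t powr (1 / \<alpha>) * sup_limit X \<omega>)))"
      using AE_exp_law_pos
    proof eventually_elim
      case (elim t)
      define k where "k N = nat \<lceil>t * real N\<rceil> - 1" for N
      have k: "t * real N - 1 \<le> real (k N)" "real (k N) \<le> t * real N" for N
      proof -
        have "0 \<le> t * real N" using elim by simp
        then show "t * real N - 1 \<le> real (k N)" "real (k N) \<le> t * real N"
          unfolding k_def by linarith+
      qed
      have k_lim: "filterlim k at_top sequentially"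
      proof -
        have "filterlim (\<lambda>N. t * real N) at_top sequentially"
          using elim by (intro filterlim_tendsto_pos_mult_at_top[OF tendsto_const] filterlim_real_sequentially)
        then have "filterlim (\<lambda>N. -1 + t * real N) at_top sequentially"
          by (rule filterlim_tendsto_add_at_top[OF tendsto_const])
        then have "filterlim (\<lambda>N. real (k N)) at_top sequentially"
          by (rule filterlim_at_top_mono) (use k(1) in \<open>auto simp: algebra_simps\<close>)
        then show ?thesis by (simp add: filterlim_sequentially_iff_filterlim_real)
      qed
      have ratio: "(\<lambda>N. real (k N) / real N) \<longlonglongrightarrow> t"
      proof (rule tendsto_sandwich)
        show "\<forall>\<^sub>F N in sequentially. t - 1 / real N \<le> real (k N) / real N"
          using eventually_gt_at_top[of 0]
        proof eventually_elim
          case (elim N)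
          have "(t * real N - 1) / real N \<le> real (k N) / real N"
            by (intro divide_right_mono k) auto
          then show ?case using elim by (simp add: diff_divide_distrib)
        qed
        show "\<forall>\<^sub>F N in sequentially. real (k N) / real N \<le> t"
          using eventually_gt_at_top[of 0] by eventually_elim (use k(2) in \<open>simp add: field_simps\<close>)
        show "(\<lambda>N. t - 1 / real N) \<longlonglongrightarrow> t"
          using tendsto_diff[OF tendsto_const[of t] lim_1_over_n] by simp
      qed simp
      have "(\<lambda>N. LINT \<omega>|M. exp (- z * of_real ((real (k N) / real N) powr (1 / \<alpha>) * Z (k N) \<omega>)))
        \<longlonglongrightarrow> (LINT \<omega>|M. exp (- z * of_real (t powr (1 / \<alpha>) * sup_limit X \<omega>)))"
      proof (rule integral_dominated_convergence[where w = "\<lambda>_. 1"])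
        show "AE \<omega> in M. (\<lambda>N. exp (- z * of_real ((real (k N) / real N) powr (1 / \<alpha>) * Z (k N) \<omega>)))
           \<longlonglongrightarrow> exp (- z * of_real (t powr (1 / \<alpha>) * sup_limit X \<omega>))"
          using AE_sup_limit_tendsto
        proof eventually_elim
          case (elim \<omega>)
          have "(\<lambda>N. Z (k N) \<omega>) \<longlonglongrightarrow> sup_limit X \<omega>"
            unfolding Z_def by (rule filterlim_compose[OF elim k_lim])
          then show ?case
            using \<open>0 < t\<close> by (intro tendsto_intros ratio) auto
        qed
        show "AE \<omega> in M. norm (exp (- z * of_real ((real (k N) / real N) powr (1 / \<alpha>) * Z (k N) \<omega>))) \<le> 1" for N
          using grid_max_nonneg by eventually_elim (use z in \<open>auto simp: Z_def\<close>)
      qed auto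
      moreover have "\<forall>\<^sub>F N in sequentially. (LINT \<omega>|M. exp (- z * of_real ((real (k N) / real N) powr (1 / \<alpha>) * Z (k N) \<omega>))) = g N (k N)"
        using eventually_gt_at_top[of 0] by eventually_elim (simp add: g_eq)
      ultimately show ?case unfolding k_def by (rule Lim_transform_eventually)
    qed
    show "AE t in exp_law. norm (g N (nat \<lceil>t * real N\<rceil> - 1)) \<le> 1" for N
      by (intro AE_I2 g1)
  qed auto
  moreover have "\<forall>\<^sub>F N in sequentially. (LINT t|exp_law. g N (nat \<lceil>t * real N\<rceil> - 1)) =
     geometric_max (\<nu> N) (exp (- 1 / real N)) z"
    using eventually_gt_at_top[of 0]
  proof eventually_elim
    case (elim N)
    show ?case unfolding exp_law_geometric[of "g N", OF g1 elim] unfolding geometric_max_def g_def ..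
  qed
  ultimately show ?thesis
    unfolding laplace_exp_sup_law[OF z] \<nu>_def by (rule Lim_transform_eventually)
qed

end

lemma cadlag_minus:
  assumes "cadlag f" shows "cadlag (\<lambda>t. - f t)"
  unfolding cadlag_def
proof (intro conjI allI impI)
  show "((\<lambda>t. - f t) \<longlongrightarrow> - f t) (at_right t)" if "0 \<le> t" for t
    using assms that by (intro tendsto_minus) (simp add: cadlag_def)
  show "\<exists>l. ((\<lambda>t. - f t) \<longlongrightarrow> l) (at_left t)" if t: "0 < t" for t
  proof -
    obtain l where "(f \<longlongrightarrow> l) (at_left t)" using assms t unfolding cadlag_def by blast
    then show ?thesis by (intro exI[of _ "- l"] tendsto_minus)
  qed
qed

lemma stable_exponent_minus: "stable_exponent \<alpha> (1 - \<rho>) z = stable_exponent \<alpha> \<rho> (- z)"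
proof -
  have "\<alpha> * (1 - 2 * (1 - \<rho>)) = - (\<alpha> * (1 - 2 * \<rho>))" by (simp add: algebra_simps)
  then show ?thesis by (simp add: stable_exponent_def Let_def)
qed

context stable_process
begin

lemma dual_stable_process: "stable_process M (\<lambda>t \<omega>. - X t \<omega>) \<alpha> (1 - \<rho>)"
proof
  show "random_variable borel (\<lambda>\<omega>. - X t \<omega>)" if "0 \<le> t" for t using measurable_X[OF that] by measurable
  show "AE \<omega> in M. - X 0 \<omega> = 0" using X_zero by eventually_elim simp
  show "AE \<omega> in M. cadlag (\<lambda>t. - X t \<omega>)"
    using cadlag_paths by eventually_elim (rule cadlag_minus)
  show "indep_vars (\<lambda>_. borel) (\<lambda>i \<omega>. - X (t (Suc i)) \<omega> - - X (t i) \<omega>) {..<n}"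
    if "0 \<le> t 0" "\<And>i. i < n \<Longrightarrow> t i \<le> t (Suc i)" for n t
    using indep_vars_compose2[OF independent_increments[OF that], of n "\<lambda>_. uminus" "\<lambda>_. borel"] by simp
  show "distr M borel (\<lambda>\<omega>. - X (s + t) \<omega> - - X s \<omega>) = distr M borel (\<lambda>\<omega>. - X t \<omega>)"
    if "0 \<le> s" "0 \<le> t" for s t
  proof -
    have [measurable]: "random_variable borel (X (s + t))" "random_variable borel (X s)" "random_variable borel (X t)"
      using that by (auto intro: measurable_X)
    have "distr M borel (\<lambda>\<omega>. - X (s + t) \<omega> - - X s \<omega>) = distr (distr M borel (\<lambda>\<omega>. X (s + t) \<omega> - X s \<omega>)) borel uminus"
      by (simp add: distr_distr o_def)
    also have "\<dots> = distr M borel (\<lambda>\<omega>. - X t \<omega>)"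
      unfolding stationary_increments[OF that] by (simp add: distr_distr o_def)
    finally show ?thesis .
  qed
  show "(\<alpha>, 1 - \<rho>) \<in> admissible" using parameters by (auto simp: admissible_def field_simps)
  show "char (distr M borel (\<lambda>\<omega>. - X t \<omega>)) z = exp (- (of_real t * stable_exponent \<alpha> (1 - \<rho>) z))"
    if t: "0 \<le> t" for t z
  proof -
    have [measurable]: "random_variable borel (X t)" using t by (rule measurable_X)
    have "char (distr M borel (\<lambda>\<omega>. - X t \<omega>)) z = char (distr M borel (X t)) (- z)"
      by (simp add: char_def integral_distr)
    then show ?thesis using char_X[OF t] by (simp add: stable_exponent_minus)
  qed
qed

end

section \<open>Wiener-Hopf factorization of a stable process\<close>

context stable_process
begin

text \<open>
  The two Wiener-Hopf factors of the process at unit killing rate.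
\<close>
definition sup_transform :: "complex \<Rightarrow> complex" where
  "sup_transform = laplace (exp_sup_law M X \<alpha>)"

definition inf_transform :: "complex \<Rightarrow> complex" where
  "inf_transform = laplace (exp_sup_law M (\<lambda>t \<omega>. - X t \<omega>) \<alpha>)"

lemma laplace_step:
  assumes "Re z = 0" "N > 0"
  shows "of_real (exp (- 1 / real N)) * laplace (distr M borel (X (1 / real N))) z =
    exp (- (1 + stable_exponent \<alpha> \<rho> (- Im z)) / of_nat N)"
proof -
  have "laplace (distr M borel (X (1 / real N))) z = exp (- (of_real (1 / real N) * stable_exponent \<alpha> \<rho> (- Im z)))"
    using char_X[of "1 / real N" "- Im z"] by (simp only: laplace_eq_char[OF assms(1)]) simp
  then show ?thesis
    using assms(2) by (simp add: exp_of_real[symmetric] exp_add[symmetric] field_simps)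
qed

text \<open>
  The Wiener-Hopf factorization, as the limit of \<open>geometric_wiener_hopf\<close> multiplied by \<open>N\<close>.
\<close>
lemma sup_inf_transform:
  assumes z: "Re z = 0"
  shows "sup_transform z * inf_transform (- z) * (1 + stable_exponent \<alpha> \<rho> (- Im z)) = 1"
proof -
  interpret dual: stable_process M "\<lambda>t \<omega>. - X t \<omega>" \<alpha> "1 - \<rho>" by (rule dual_stable_process)
  define \<nu> where "\<nu> N = distr M borel (X (1 / real N))" for N
  define \<nu>' where "\<nu>' N = distr M borel (\<lambda>\<omega>. - X (1 / real N) \<omega>)" for N
  define r where "r N = exp (- 1 / real N)" for N
  define w where "w = 1 + stable_exponent \<alpha> \<rho> (- Im z)"
  have \<nu>: "real_distribution (\<nu> N)" for N unfolding \<nu>_def by (intro real_distribution_X) auto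
  have \<nu>': "\<nu>' N = distr (\<nu> N) borel uminus" for N
    using measurable_X[of "1 / real N"] by (simp add: \<nu>_def \<nu>'_def distr_distr o_def)
  have lim: "(\<lambda>N. geometric_max (\<nu> N) (r N) z * geometric_max (\<nu>' N) (r N) (- z) * ((1 - exp (- w / of_nat N)) * of_nat N))
    \<longlonglongrightarrow> sup_transform z * inf_transform (- z) * w"
    unfolding sup_transform_def inf_transform_def \<nu>_def \<nu>'_def r_def
    using z by (intro tendsto_mult geometric_max_tendsto dual.geometric_max_tendsto exp_scaled_limit) auto
  have "\<forall>\<^sub>F N in sequentially. geometric_max (\<nu> N) (r N) z * geometric_max (\<nu>' N) (r N) (- z) * ((1 - exp (- w / of_nat N)) * of_nat N)
     = (1 - exp (- 1 / of_nat N)) * of_nat N"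
    using eventually_gt_at_top[of 0]
  proof eventually_elim
    case (elim N)
    have r: "0 \<le> r N" "r N < 1" using elim by (auto simp: r_def)
    have "geometric_max (\<nu> N) (r N) z * geometric_max (\<nu>' N) (r N) (- z) * (1 - of_real (r N) * laplace (\<nu> N) z) = 1 - of_real (r N)"
      by (rule geometric_wiener_hopf[OF \<nu> \<nu>' r z])
    moreover have "of_real (r N) * laplace (\<nu> N) z = exp (- w / of_nat N)"
      unfolding r_def \<nu>_def w_def by (rule laplace_step[OF z elim])
    moreover have "complex_of_real (r N) = exp (- 1 / of_nat N)"
      by (simp add: r_def exp_of_real[symmetric])
    ultimately show ?case by (metis (no_types, lifting) mult.assoc)
  qed
  then have "(\<lambda>N. (1 - exp (- 1 / of_nat N)) * of_nat N) \<longlonglongrightarrow> sup_transform z * inf_transform (- z) * w"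
    using lim by (rule Lim_transform_eventually[rotated])
  from LIMSEQ_unique[OF this exp_scaled_limit] show ?thesis by (simp add: w_def)
qed

text \<open>
  Here the uniformity in \<open>r\<close> of \<open>geometric_max_lower_bound\<close> is used: on the axis,
  \<open>(1 - r * laplace \<nu> z) / (1 - r)\<close> is bounded by a multiple of \<open>1 + \<bar>\<Psi>\<bar>\<close>, which grows at most
  quadratically as \<open>\<alpha> < 2\<close>.
\<close>
lemma sup_transform_lower_bound:
  assumes z: "0 \<le> Re z"
  shows "1 \<le> norm (sup_transform z) * (2 * exp 1 * norm (1 + z) ^ 2)"
proof -
  define \<nu> where "\<nu> N = distr M borel (X (1 / real N))" for N
  define r where "r N = exp (- 1 / real N)" for N
  have \<nu>: "real_distribution (\<nu> N)" for N unfolding \<nu>_def by (intro real_distribution_X) auto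
  have "(\<lambda>N. norm (geometric_max (\<nu> N) (r N) z) * (2 * exp 1 * norm (1 + z) ^ 2)) \<longlonglongrightarrow> norm (sup_transform z) * (2 * exp 1 * norm (1 + z) ^ 2)"
    unfolding sup_transform_def \<nu>_def r_def by (intro tendsto_intros geometric_max_tendsto z)
  moreover have "\<forall>\<^sub>F N in sequentially. 1 \<le> norm (geometric_max (\<nu> N) (r N) z) * (2 * exp 1 * norm (1 + z) ^ 2)"
    using eventually_gt_at_top[of 0]
  proof eventually_elim
    case (elim N)
    have r: "0 \<le> r N" "r N < 1" using elim by (auto simp: r_def)
    show ?case
    proof (rule geometric_max_lower_bound[OF \<nu> refl r _ _ z])
      fix u :: complex assume u: "Re u = 0"
      define w where "w = 1 + stable_exponent \<alpha> \<rho> (- Im u)"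
      have "norm (1 - of_real (r N) * laplace (\<nu> N) u) = norm (1 - exp (- (w / of_nat N)))"
        unfolding r_def \<nu>_def laplace_step[OF u elim] w_def by (simp only: minus_divide_left)
      also have "\<dots> \<le> norm (w / of_nat N)"
        using Re_stable_exponent[of "- Im u"] by (intro norm_one_minus_exp_le) (auto simp: w_def)
      also have "\<dots> = 1 / real N * norm w" by (simp add: norm_divide)
      also have "\<dots> \<le> ((1 - r N) * exp 1) * (2 * norm (1 + u) ^ 2)"
      proof (intro mult_mono)
        have "1 + 1 / real N \<le> exp (1 / real N)" by (rule exp_ge_add_one_self)
        then have "1 / real N \<le> exp (1 / real N) - 1" by linarith
        then have "1 / real N * r N \<le> (exp (1 / real N) - 1) * r N"
          using r(1) by (rule mult_right_mono)
        also have "\<dots> = 1 - r N" by (simp add: r_def left_diff_distrib exp_add[symmetric])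
        finally have *: "1 / real N * r N \<le> 1 - r N" .
        have "1 / real N = (1 / real N * r N) * exp (1 / real N)"
          by (simp add: r_def exp_add[symmetric])
        also have "\<dots> \<le> (1 - r N) * exp 1"
          using elim r by (intro mult_mono *) auto
        finally show "1 / real N \<le> (1 - r N) * exp 1" .
        have "norm w \<le> 1 + norm (stable_exponent \<alpha> \<rho> (- Im u))"
          unfolding w_def using norm_triangle_ineq[of 1 "stable_exponent \<alpha> \<rho> (- Im u)"] by simp
        also have "\<dots> \<le> 1 + (1 + (Im u)\<^sup>2)" using norm_stable_exponent[of "- Im u"] by simp
        also have "\<dots> \<le> 2 * norm (1 + u) ^ 2"
          using u unfolding cmod_power2 by simp
        finally show "norm w \<le> 2 * norm (1 + u) ^ 2" .
      qed (use r in auto)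
      finally show "norm (1 - of_real (r N) * laplace (\<nu> N) u) \<le> (1 - r N) * (2 * exp 1 * norm (1 + u) ^ 2)"
        by (simp add: mult_ac)
    qed auto
  qed
  ultimately show ?thesis by (rule tendsto_lowerbound) simp
qed

lemma sup_transform_decay:
  assumes x: "1 \<le> x"
  shows "norm (sup_transform 1) \<le> x * norm (sup_transform (of_real x))"
proof -
  define \<nu> where "\<nu> N = distr M borel (X (1 / real N))" for N
  define r where "r N = exp (- 1 / real N)" for N
  have \<nu>: "real_distribution (\<nu> N)" for N unfolding \<nu>_def by (intro real_distribution_X) auto
  have l1: "(\<lambda>N. norm (geometric_max (\<nu> N) (r N) 1)) \<longlonglongrightarrow> norm (sup_transform 1)"
    unfolding sup_transform_def \<nu>_def r_def by (intro tendsto_intros geometric_max_tendsto) auto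
  have l2: "(\<lambda>N. x * norm (geometric_max (\<nu> N) (r N) (of_real x))) \<longlonglongrightarrow> x * norm (sup_transform (of_real x))"
    unfolding sup_transform_def \<nu>_def r_def using x by (intro tendsto_intros geometric_max_tendsto) auto
  have "\<forall>\<^sub>F N in sequentially. norm (geometric_max (\<nu> N) (r N) 1) \<le> x * norm (geometric_max (\<nu> N) (r N) (of_real x))"
    using eventually_gt_at_top[of 0]
    by eventually_elim (rule geometric_max_decay[OF \<nu> refl _ _ x], auto simp: r_def)
  then show ?thesis by (rule tendsto_le[OF _ l2 l1, rotated]) simp
qed

lemma sup_transform_holomorphic: "sup_transform holomorphic_on {z. 0 < Re z}"
  and sup_transform_continuous: "continuous_on {z. 0 \<le> Re z} sup_transform"
  and sup_transform_0: "sup_transform 0 = 1"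
  unfolding sup_transform_def
  by (rule laplace_holomorphic laplace_continuous laplace_0; rule real_distribution_exp_sup_law exp_sup_law_nonneg)+

lemma inf_transform_holomorphic: "inf_transform holomorphic_on {z. 0 < Re z}"
  and inf_transform_continuous: "continuous_on {z. 0 \<le> Re z} inf_transform"
  and norm_inf_transform: "0 \<le> Re z \<Longrightarrow> norm (inf_transform z) \<le> 1"
proof -
  interpret dual: stable_process M "\<lambda>t \<omega>. - X t \<omega>" \<alpha> "1 - \<rho>" by (rule dual_stable_process)
  note d = dual.real_distribution_exp_sup_law dual.exp_sup_law_nonneg
  show "inf_transform holomorphic_on {z. 0 < Re z}" "continuous_on {z. 0 \<le> Re z} inf_transform"
    "0 \<le> Re z \<Longrightarrow> norm (inf_transform z) \<le> 1"
    unfolding inf_transform_def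
    by (rule laplace_holomorphic[OF d] laplace_continuous[OF d] norm_laplace_le_1[OF d], assumption?)+
qed

text \<open>
  By the factorization, \<open>\<phi> / sup_transform\<close> on the right continues to \<open>\<Delta>\<close> times the reflected factor
  on the left. The lower bound makes this entire function a polynomial. It equals \<open>1\<close> at the origin,
  and since \<open>sup_transform x\<close> is at least a multiple of \<open>1 / x\<close> for large real \<open>x\<close>, it grows more
  slowly than linearly there.
\<close>
lemma sup_transform_unique:
  fixes \<phi> \<Delta> :: "complex \<Rightarrow> complex"
  assumes \<phi>: "\<phi> holomorphic_on {z. 0 < Re z}" "continuous_on {z. 0 \<le> Re z} \<phi>" "\<phi> 0 = 1"
    and \<Delta>: "\<Delta> holomorphic_on {z. Re z < 0}" "continuous_on {z. Re z \<le> 0} \<Delta>"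
    and axis: "\<And>z. Re z = 0 \<Longrightarrow> \<phi> z * (1 + stable_exponent \<alpha> \<rho> (- Im z)) = \<Delta> z"
    and growth: "\<And>z. 0 \<le> Re z \<Longrightarrow> norm (\<phi> z) \<le> B * (1 + norm z) ^ m"
      "\<And>z. Re z \<le> 0 \<Longrightarrow> norm (\<Delta> z) \<le> B * (1 + norm z) ^ m"
    and decay: "((\<lambda>x. \<phi> (of_real x)) \<longlongrightarrow> 0) at_top"
    and z: "0 \<le> Re z"
  shows "sup_transform z = \<phi> z"
proof -
  have nz: "sup_transform z \<noteq> 0" if "0 \<le> Re z" for z
    using sup_transform_lower_bound[OF that] by auto
  \<comment> \<open>on the axis both branches agree by \<open>sup_inf_transform\<close>\<close>
  define h where "h z = (if 0 \<le> Re z then \<phi> z / sup_transform z else \<Delta> z * inf_transform (- z))" for z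
  have hol: "h holomorphic_on UNIV"
    unfolding h_def[abs_def]
  proof (rule holomorphic_paste_half_planes)
    show "(\<lambda>z. \<phi> z / sup_transform z) holomorphic_on {z. 0 < Re z}"
      using nz by (intro holomorphic_intros \<phi> sup_transform_holomorphic) auto
    show "continuous_on {z. 0 \<le> Re z} (\<lambda>z. \<phi> z / sup_transform z)"
      using nz by (intro continuous_intros \<phi> sup_transform_continuous) auto
    show "(\<lambda>z. \<Delta> z * inf_transform (- z)) holomorphic_on {z. Re z < 0}"
      by (intro holomorphic_intros \<Delta>
         holomorphic_on_compose_gen[OF _ inf_transform_holomorphic, of uminus, unfolded o_def]) auto
    show "continuous_on {z. Re z \<le> 0} (\<lambda>z. \<Delta> z * inf_transform (- z))"
      by (intro continuous_intros \<Delta> continuous_on_compose2[OF inf_transform_continuous, of _ uminus]) auto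
    show "\<phi> z / sup_transform z = \<Delta> z * inf_transform (- z)" if "Re z = 0" for z
    proof -
      have "sup_transform z * (\<Delta> z * inf_transform (- z)) = \<phi> z * (sup_transform z * inf_transform (- z) * (1 + stable_exponent \<alpha> \<rho> (- Im z)))"
        unfolding axis[OF that, symmetric] by (simp add: mult_ac)
      also have "\<dots> = \<phi> z" using sup_inf_transform[OF that] by simp
      finally show ?thesis using nz[of z] that by (simp add: field_simps)
    qed
  qed
  have B: "0 \<le> B" using order_trans[OF norm_ge_zero growth(1)[of 0]] by simp
  define C where "C = B * (2 * exp 1 + 1)"
  have bound: "norm (h z) \<le> C * (1 + norm z) ^ (m + 2)" for z
  proof (cases "0 \<le> Re z")
    case True
    have "norm (\<phi> z) \<le> norm (\<phi> z) * (norm (sup_transform z) * (2 * exp 1 * norm (1 + z) ^ 2))"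
      using mult_left_mono[OF sup_transform_lower_bound[OF True], of "norm (\<phi> z)"] by simp
    then have "norm (\<phi> z) / norm (sup_transform z) \<le> norm (\<phi> z) * (2 * exp 1 * norm (1 + z) ^ 2)"
      using nz[OF True] by (simp add: pos_divide_le_eq mult_ac)
    also have "\<dots> \<le> (B * (1 + norm z) ^ m) * ((2 * exp 1 + 1) * (1 + norm z) ^ 2)"
      using growth(1)[OF True] norm_triangle_ineq[of 1 z] B by (intro mult_mono power_mono) auto
    finally show ?thesis using True by (simp add: h_def norm_divide C_def power_add mult_ac power2_eq_square)
  next
    case False
    then have "norm (\<Delta> z) * norm (inf_transform (- z)) \<le> (B * (1 + norm z) ^ m) * 1"
      using growth(2)[of z] norm_inf_transform[of "- z"] B by (intro mult_mono) auto
    also have "\<dots> \<le> (B * (1 + norm z) ^ m) * ((2 * exp 1 + 1) * (1 + norm z) ^ 2)"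
    proof (intro mult_left_mono)
      have "1 * 1 \<le> (2 * exp 1 + 1) * (1 + norm z) ^ 2"
        by (intro mult_mono one_le_power) auto
      then show "1 \<le> (2 * exp 1 + 1) * (1 + norm z) ^ 2" by simp
    qed (use B in auto)
    finally show ?thesis using False by (simp add: h_def norm_mult C_def power_add mult_ac power2_eq_square)
  qed
  have C: "0 \<le> C" using B by (simp add: C_def)
  have bound': "norm (h z) \<le> (C * 2 ^ (m + 2)) * norm z ^ (m + 2)" if "1 \<le> norm z" for z
  proof -
    have "(1 + norm z) ^ (m + 2) \<le> (2 * norm z) ^ (m + 2)" using that by (intro power_mono) auto
    then have "C * (1 + norm z) ^ (m + 2) \<le> C * (2 * norm z) ^ (m + 2)" using C by (intro mult_left_mono)
    with bound[of z] show ?thesis by (simp add: power_mult_distrib mult_ac)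
  qed
  have poly: "h z = (\<Sum>k\<le>m + 2. (deriv ^^ k) h 0 / fact k * z ^ k)" for z
    by (rule Liouville_polynomial[OF hol bound'])
  define p where "p = (\<Sum>k\<le>m + 2. monom ((deriv ^^ k) h 0 / fact k) k)"
  have h_p: "h z = poly p z" for z
    unfolding poly[of z] p_def by (simp add: poly_sum poly_monom)
  have "degree p = 0"
  proof (rule ccontr)
    assume deg: "degree p \<noteq> 0"
    \<comment> \<open>dividing \<open>p x - a\<close> by \<open>x\<close> leaves the polynomial \<open>p0\<close>, which would have to tend to zero\<close>
    obtain p0 a where p: "p = pCons a p0" by (cases p)
    with deg have "p0 \<noteq> 0" by auto
    have "((\<lambda>x. h (of_real x) / of_real x) \<longlongrightarrow> 0) at_top"
    proof (rule Lim_null_comparison)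
      show "((\<lambda>x. norm (\<phi> (of_real x)) / norm (sup_transform 1)) \<longlongrightarrow> 0) at_top"
        using tendsto_divide[OF tendsto_norm[OF decay] tendsto_const[of "norm (sup_transform 1)"]] nz[of 1] by simp
      show "\<forall>\<^sub>F x in at_top. norm (h (of_real x) / of_real x) \<le> norm (\<phi> (of_real x)) / norm (sup_transform 1)"
        using eventually_ge_at_top[of "1::real"]
      proof eventually_elim
        case (elim x)
        have pos: "0 < norm (sup_transform 1)" "0 < norm (sup_transform (of_real x))"
          using nz[of 1] nz[of "of_real x"] elim by auto
        have "norm (h (of_real x) / of_real x) = norm (\<phi> (of_real x)) / (x * norm (sup_transform (of_real x)))"
          using elim by (simp add: h_def norm_divide norm_mult mult.commute)
        also have "\<dots> \<le> norm (\<phi> (of_real x)) / norm (sup_transform 1)"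
          using sup_transform_decay[OF elim] pos elim by (intro divide_left_mono mult_pos_pos) auto
        finally show ?case .
      qed
    qed
    then have "((\<lambda>x. h (of_real x) / of_real x - a / of_real x) \<longlongrightarrow> 0 - 0) at_top"
    proof (rule tendsto_diff)
      have "((\<lambda>x. of_real (inverse x)) \<longlongrightarrow> (of_real 0 :: complex)) at_top"
        by (intro tendsto_of_real tendsto_inverse_0_at_top filterlim_ident)
      from tendsto_mult[OF tendsto_const[of a] this] show "((\<lambda>x. a / complex_of_real x) \<longlongrightarrow> 0) at_top" by (simp add: divide_inverse)
    qed
    moreover have "\<forall>\<^sub>F x in at_top. h (of_real x) / of_real x - a / of_real x = poly p0 (of_real x)"
      using eventually_gt_at_top[of "0::real"]
      by eventually_elim (simp add: h_p p field_simps)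
    ultimately have "((\<lambda>x. poly p0 (of_real x)) \<longlongrightarrow> 0 - 0) at_top"
      by (rule Lim_transform_eventually)
    then have lim: "((\<lambda>x. poly p0 (of_real x)) \<longlongrightarrow> 0) at_top" by simp
    show False
    proof (cases "degree p0 = 0")
      case True
      then obtain c where c: "p0 = [:c:]" by (metis degree_eq_zeroE)
      with lim have "((\<lambda>x::real. c) \<longlongrightarrow> 0) at_top" by simp
      then have "c = 0" by (simp add: tendsto_const_iff)
      with c \<open>p0 \<noteq> 0\<close> show False by simp
    next
      case False
      have "filterlim (\<lambda>x. complex_of_real x) at_infinity at_top"
        by (rule filterlim_of_real_at_infinity)
      then have "filterlim (\<lambda>x. poly p0 (of_real x)) at_infinity at_top"
        using filterlim_compose[OF filterlim_poly_at_infinity[of p0]] False by simp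
      with lim show False
        by (intro not_tendsto_and_filterlim_at_infinity[OF trivial_limit_at_top_linorder])
    qed
  qed
  then obtain c where "p = [:c:]" by (metis degree_eq_zeroE)
  then have "h z = h 0" for z by (simp add: h_p)
  moreover have "h 0 = 1" by (simp add: h_def \<phi>(3) sup_transform_0)
  ultimately have "h z = 1" by simp
  then show ?thesis using z nz[OF z] by (simp add: h_def)
qed

end

section \<open>Sines, removable zeros and the Mellin transform of 1 / (1 + x)\<close>

lemma holomorphic_divide_simple_zeros:
  fixes f g :: "complex \<Rightarrow> complex"
  assumes S: "open S" and f: "f holomorphic_on S" and g: "g holomorphic_on S"
    and zero: "\<And>z. z \<in> S \<Longrightarrow> g z = 0 \<Longrightarrow> f z = 0 \<and> deriv g z \<noteq> 0"
  obtains h where "h holomorphic_on S" "\<And>z. z \<in> S \<Longrightarrow> f z = h z * g z"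
proof
  define h where "h z = (if g z = 0 then deriv f z / deriv g z else f z / g z)" for z
  show "f z = h z * g z" if "z \<in> S" for z
    using zero[OF that] by (auto simp: h_def)
  have "\<exists>t. open t \<and> z0 \<in> t \<and> t \<subseteq> S \<and> h holomorphic_on t" if z0: "z0 \<in> S" for z0
  proof (cases "g z0 = 0")
    case False
    define t where "t = S \<inter> g -` (- {0})"
    have "open t" unfolding t_def
      using S by (intro continuous_open_preimage holomorphic_on_imp_continuous_on[OF g]) auto
    moreover have "(\<lambda>z. f z / g z) holomorphic_on t"
      by (intro holomorphic_intros holomorphic_on_subset[OF f] holomorphic_on_subset[OF g]) (auto simp: t_def)
    then have "h holomorphic_on t"
      by (rule holomorphic_transform) (auto simp: h_def t_def)
    ultimately show ?thesis using z0 False by (intro exI[of _ t]) (auto simp: t_def)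
  next
    case True
    define F where "F z = (if z = z0 then deriv f z0 else (f z - f z0) / (z - z0))" for z
    define G where "G z = (if z = z0 then deriv g z0 else (g z - g z0) / (z - z0))" for z
    have F: "F holomorphic_on S" and G: "G holomorphic_on S"
      unfolding F_def[abs_def] G_def[abs_def]
      using pole_lemma_open[OF f S] pole_lemma_open[OF g S] by auto
    have f0: "f z0 = 0" and dg: "deriv g z0 \<noteq> 0" using zero[OF z0 True] by auto
    define t where "t = S \<inter> G -` (- {0})"
    have "open t" unfolding t_def
      using S by (intro continuous_open_preimage holomorphic_on_imp_continuous_on[OF G]) auto
    moreover have "(\<lambda>z. F z / G z) holomorphic_on t"
      by (intro holomorphic_intros holomorphic_on_subset[OF F] holomorphic_on_subset[OF G]) (auto simp: t_def)
    then have "h holomorphic_on t"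
      by (rule holomorphic_transform) (auto simp: h_def t_def F_def G_def f0 True split: if_splits)
    ultimately show ?thesis using z0 dg by (intro exI[of _ t]) (auto simp: t_def G_def)
  qed
  then show "h holomorphic_on S"
    by (metis field_differentiable_at_within holomorphic_on_imp_differentiable_at holomorphic_on_def)
qed

text \<open>
  The factors of the denominator are divided out one at a time. A zero of the factor that is removed is
  no zero of the other factors, so it is still a zero of the quotient.
\<close>
lemma holomorphic_divide_prod_simple_zeros:
  fixes f :: "complex \<Rightarrow> complex" and g :: "'q \<Rightarrow> complex \<Rightarrow> complex"
  assumes S: "open S" and Q: "finite Q" and f: "f holomorphic_on S"
    and g: "\<And>q. q \<in> Q \<Longrightarrow> g q holomorphic_on S"
    and zero: "\<And>q z. q \<in> Q \<Longrightarrow> z \<in> S \<Longrightarrow> g q z = 0 \<Longrightarrow> f z = 0 \<and> deriv (g q) z \<noteq> 0"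
    and disj: "\<And>q q' z. q \<in> Q \<Longrightarrow> q' \<in> Q \<Longrightarrow> q \<noteq> q' \<Longrightarrow> z \<in> S \<Longrightarrow> g q z = 0 \<Longrightarrow> g q' z \<noteq> 0"
  shows "\<exists>h. h holomorphic_on S \<and> (\<forall>z\<in>S. f z = h z * (\<Prod>q\<in>Q. g q z))"
  using Q g zero disj
proof (induction Q rule: finite_induct)
  case empty
  then show ?case using f by auto
next
  case (insert q Q)
  have "\<exists>h. h holomorphic_on S \<and> (\<forall>z\<in>S. f z = h z * (\<Prod>q\<in>Q. g q z))"
    by (rule insert.IH) (use insert.prems in blast)+
  then obtain h where h: "h holomorphic_on S" "\<And>z. z \<in> S \<Longrightarrow> f z = h z * (\<Prod>q\<in>Q. g q z)" by blast
  have "h z = 0 \<and> deriv (g q) z \<noteq> 0" if z: "z \<in> S" "g q z = 0" for z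
  proof -
    have "(\<Prod>q\<in>Q. g q z) \<noteq> 0"
      using insert.hyps insert.prems(3)[of q _ z] z by (auto simp: prod_zero_iff)
    then show ?thesis using insert.prems(2)[of q z] h(2)[of z] z by auto
  qed
  then obtain h' where h': "h' holomorphic_on S" "\<And>z. z \<in> S \<Longrightarrow> h z = h' z * g q z"
    using holomorphic_divide_simple_zeros[OF S h(1) insert.prems(1)[of q]] by (metis insertI1)
  show ?case
    using insert.hyps h' h(2) by (intro exI[of _ h']) (auto simp: mult.assoc)
qed

lemma norm_sin_le: "norm (sin (z::complex)) \<le> exp \<bar>Im z\<bar>"
proof -
  have "norm (exp (\<i> * z) - exp (- (\<i> * z))) \<le> norm (exp (\<i> * z)) + norm (exp (- (\<i> * z)))"
    by (rule norm_triangle_ineq4)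
  also have "\<dots> = exp (- Im z) + exp (Im z)" by simp
  also have "\<dots> \<le> exp \<bar>Im z\<bar> + exp \<bar>Im z\<bar>" by (intro add_mono) auto
  finally show ?thesis by (simp add: sin_exp_eq norm_divide norm_mult)
qed

lemma norm_sin_ge:
  fixes z :: complex
  assumes "1 \<le> \<bar>Im z\<bar>" shows "exp \<bar>Im z\<bar> / 4 \<le> norm (sin z)"
proof -
  have e: "exp (- \<bar>Im z\<bar>) \<le> exp \<bar>Im z\<bar> / 2"
  proof -
    have "2 \<le> exp (1 :: real)" using exp_ge_add_one_self[of 1] by simp
    also have "\<dots> \<le> exp (2 * \<bar>Im z\<bar>)" using assms by simp
    finally have "2 * exp (- \<bar>Im z\<bar>) \<le> exp (2 * \<bar>Im z\<bar>) * exp (- \<bar>Im z\<bar>)" by (intro mult_right_mono) auto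
    then show ?thesis by (simp add: exp_add[symmetric])
  qed
  have "exp \<bar>Im z\<bar> - exp (- \<bar>Im z\<bar>) \<le> norm (exp (\<i> * z) - exp (- (\<i> * z)))"
  proof (cases "0 \<le> Im z")
    case True
    then show ?thesis
      using norm_triangle_ineq2[of "exp (- (\<i> * z))" "exp (\<i> * z)"] by (simp add: norm_minus_commute)
  next
    case False
    then show ?thesis
      using norm_triangle_ineq2[of "exp (\<i> * z)" "exp (- (\<i> * z))"] by simp
  qed
  moreover have "norm (sin z) = norm (exp (\<i> * z) - exp (- (\<i> * z))) / 2"
    by (simp add: sin_exp_eq norm_divide norm_mult)
  ultimately show ?thesis using e by simp
qed

lemma sin_pi_eq_0_iff: "sin (of_real pi * z) = 0 \<longleftrightarrow> (\<exists>n::int. z = of_int n)" for z :: complex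
proof -
  have "of_real pi * z = of_real (of_int n * pi) \<longleftrightarrow> z = of_int n" for n :: int
    by (auto simp: field_simps)
  then show ?thesis unfolding sin_eq_0 by (simp add: mult.commute)
qed

lemma deriv_sin_pi_nonzero:
  fixes a z :: complex
  assumes "sin (of_real pi * (a + z)) = 0"
  shows "deriv (\<lambda>z. sin (of_real pi * (a + z))) z \<noteq> 0"
proof -
  have "((\<lambda>z. sin (of_real pi * (a + z))) has_field_derivative of_real pi * cos (of_real pi * (a + z))) (at z)"
    by (auto intro!: derivative_eq_intros)
  then have "deriv (\<lambda>z. sin (of_real pi * (a + z))) z = of_real pi * cos (of_real pi * (a + z))"
    by (rule DERIV_imp_deriv)
  moreover have "cos (of_real pi * (a + z)) \<noteq> 0"
    using sin_cos_squared_add[of "of_real pi * (a + z)"] assms by auto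
  ultimately show ?thesis by simp
qed

text \<open>
  Compactness fills in the part of the strip near the real axis.
\<close>
lemma strip_bound:
  fixes f :: "complex \<Rightarrow> complex"
  assumes cont: "continuous_on {s. p \<le> Re s \<and> Re s \<le> q} f"
    and far: "\<And>s. p \<le> Re s \<Longrightarrow> Re s \<le> q \<Longrightarrow> 1 \<le> \<bar>Im s\<bar> \<Longrightarrow> norm (f s) \<le> C * exp (- \<kappa> * \<bar>Im s\<bar>)"
    and \<kappa>: "0 \<le> \<kappa>"
  obtains C' where "0 < C'" "\<And>s. p \<le> Re s \<Longrightarrow> Re s \<le> q \<Longrightarrow> norm (f s) \<le> C' * exp (- \<kappa> * \<bar>Im s\<bar>)"
proof -
  let ?K = "cbox (Complex p (-1)) (Complex q 1)"
  have "compact (f ` ?K)"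
    by (intro compact_continuous_image continuous_on_subset[OF cont] compact_cbox) (auto simp: in_cbox_complex_iff)
  then have "bounded (f ` ?K)" by (rule compact_imp_bounded)
  then obtain B where "\<forall>x\<in>f ` ?K. norm x \<le> B" unfolding bounded_iff by (rule exE)
  then have B: "\<And>s. s \<in> ?K \<Longrightarrow> norm (f s) \<le> B" by blast
  define C' where "C' = \<bar>C\<bar> + \<bar>B\<bar> * exp \<kappa> + 1"
  show thesis
  proof (rule that[of C'])
    show "0 < C'" by (simp add: C'_def add_nonneg_pos)
    fix s assume s: "p \<le> Re s" "Re s \<le> q"
    show "norm (f s) \<le> C' * exp (- \<kappa> * \<bar>Im s\<bar>)"
    proof (cases "1 \<le> \<bar>Im s\<bar>")
      case True
      have "C * exp (- \<kappa> * \<bar>Im s\<bar>) \<le> C' * exp (- \<kappa> * \<bar>Im s\<bar>)"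
      proof (intro mult_right_mono)
        have "C \<le> \<bar>C\<bar>" "0 \<le> \<bar>B\<bar> * exp \<kappa>" by auto
        then show "C \<le> C'" unfolding C'_def by linarith
      qed auto
      with far[OF s True] show ?thesis by linarith
    next
      case False
      then have "s \<in> ?K" using s by (auto simp: in_cbox_complex_iff not_le abs_less_iff)
      then have "norm (f s) \<le> \<bar>B\<bar>" by (rule order_trans[OF B abs_ge_self])
      also have "\<dots> = (\<bar>B\<bar> * exp \<kappa>) * exp (- \<kappa> * 1)" by (simp add: exp_minus)
      also have "\<dots> \<le> C' * exp (- \<kappa> * \<bar>Im s\<bar>)"
      proof (intro mult_mono)
        have "\<kappa> * \<bar>Im s\<bar> \<le> \<kappa> * 1" using False \<kappa> by (intro mult_left_mono) auto
        then show "exp (- \<kappa> * 1) \<le> exp (- \<kappa> * \<bar>Im s\<bar>)" by simp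
        have "0 \<le> \<bar>C\<bar>" "0 \<le> \<bar>B\<bar> * exp \<kappa>" by auto
        then show "\<bar>B\<bar> * exp \<kappa> \<le> C'" "0 \<le> C'" unfolding C'_def by linarith+
      qed auto
      finally show ?thesis .
    qed
  qed
qed

lemma norm_exp_cmult: "norm (exp (- s * \<zeta>)) = exp (- Re s * Re \<zeta> + Im s * Im \<zeta>)" for s \<zeta> :: complex
  by simp

text \<open>
  The kernel \<open>pi / sin (pi * s)\<close> with its pole at the origin divided out, as required by
  \<open>vertical_line_shift_pole\<close>.
\<close>
definition sinc_inv :: "complex \<Rightarrow> complex" where
  "sinc_inv s = (if s = 0 then 1 else of_real pi * s / sin (of_real pi * s))"

lemma sinc_inv_holomorphic: "sinc_inv holomorphic_on {s. -1 < Re s \<and> Re s < 1}"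
proof -
  let ?S = "{s. -1 < Re s \<and> Re s < 1}"
  have S: "open ?S"
    by (intro open_Collect_conj open_halfspace_Re_gt open_halfspace_Re_lt)
  define g where "g s = sin (of_real pi * s)" for s :: complex
  define G where "G s = (if s = 0 then deriv g 0 else (g s - g 0) / (s - 0))" for s
  have "(g has_field_derivative of_real pi) (at 0)"
    unfolding g_def by (auto intro!: derivative_eq_intros)
  then have dg: "deriv g 0 = of_real pi" by (rule DERIV_imp_deriv)
  have "g holomorphic_on ?S" unfolding g_def by (intro holomorphic_intros)
  then have "G holomorphic_on ?S"
    unfolding G_def[abs_def] using S by (rule pole_lemma_open)
  moreover have "G s \<noteq> 0" if s: "s \<in> ?S" for s
  proof (cases "s = 0")
    case False
    have "g s \<noteq> 0"
    proof
      assume "g s = 0"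
      then obtain n :: int where n: "s = of_int n" unfolding g_def using sin_pi_eq_0_iff by blast
      then have "-1 < real_of_int n" "real_of_int n < 1" using s by auto
      then show False using n False by simp
    qed
    then show ?thesis using False by (simp add: G_def g_def)
  qed (simp add: G_def dg)
  ultimately have "(\<lambda>s. of_real pi / G s) holomorphic_on ?S"
    by (intro holomorphic_intros) auto
  then show ?thesis
    by (rule holomorphic_transform) (simp add: sinc_inv_def G_def dg g_def)
qed

text \<open>
  The rate stays below \<open>pi\<close> because of the factor \<open>s\<close>.
\<close>
lemma sinc_inv_bound:
  assumes pq: "-1 < p" "q < 1" and \<kappa>: "0 \<le> \<kappa>" "\<kappa> < pi"
  obtains C where "0 < C" "\<And>s. p \<le> Re s \<Longrightarrow> Re s \<le> q \<Longrightarrow> norm (sinc_inv s) \<le> C * exp (- \<kappa> * \<bar>Im s\<bar>)"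
proof (rule strip_bound[of p q sinc_inv "4 * pi * (1 + 1 / (pi - \<kappa>))" \<kappa>])
  show "continuous_on {s. p \<le> Re s \<and> Re s \<le> q} sinc_inv"
    using pq by (intro continuous_on_subset[OF holomorphic_on_imp_continuous_on[OF sinc_inv_holomorphic]]) auto
  fix s assume s: "p \<le> Re s" "Re s \<le> q" "1 \<le> \<bar>Im s\<bar>"
  define y where "y = \<bar>Im s\<bar>"
  have y: "1 \<le> y" using s by (simp add: y_def)
  have n: "norm s \<le> 1 + y" using cmod_le[of s] s pq by (auto simp: y_def)
  have "1 \<le> pi * y" using y pi_ge_two mult_mono[of 1 pi 1 y] by simp
  then have sin: "exp (pi * y) / 4 \<le> norm (sin (of_real pi * s))"
    using norm_sin_ge[of "of_real pi * s"] by (simp add: y_def abs_mult)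
  have "s \<noteq> 0" using s by auto
  then have "norm (sinc_inv s) = pi * norm s / norm (sin (of_real pi * s))"
    by (simp add: sinc_inv_def norm_divide norm_mult)
  also have "\<dots> \<le> pi * (1 + y) / (exp (pi * y) / 4)"
    using sin n y by (intro frac_le mult_left_mono) auto
  also have "\<dots> = 4 * pi * ((1 + y) * exp (- (pi - \<kappa>) * y)) * exp (- \<kappa> * y)"
    by (simp add: exp_minus exp_diff field_simps)
  also have "(1 + y) * exp (- (pi - \<kappa>) * y) \<le> 1 + 1 / (pi - \<kappa>)"
  proof -
    define d where "d = pi - \<kappa>"
    have d: "d > 0" using \<kappa> by (simp add: d_def)
    have "1 + y \<le> (1 + 1 / d) * (1 + d * y)" using d y by (simp add: field_simps)
    also have "\<dots> \<le> (1 + 1 / d) * exp (d * y)" using d exp_ge_add_one_self[of "d * y"] by (intro mult_left_mono) auto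
    finally have "(1 + y) * exp (- d * y) \<le> (1 + 1 / d) * exp (d * y) * exp (- d * y)" by (intro mult_right_mono) auto
    also have "\<dots> = 1 + 1 / d" by (simp add: mult.assoc exp_add[symmetric])
    finally show ?thesis by (simp add: d_def)
  qed
  finally show "norm (sinc_inv s) \<le> 4 * pi * (1 + 1 / (pi - \<kappa>)) * exp (- \<kappa> * \<bar>Im s\<bar>)"
    by (simp add: y_def mult_left_mono mult_right_mono)
qed (use \<kappa> in auto)

text \<open>
  The inverse Mellin transform along the line \<open>Re s = c\<close>, as a function of the logarithm \<open>\<zeta>\<close> of the
  argument. The logarithm is kept as the variable since the arguments will range over the cut plane
  and reach both sides of the cut.
\<close>
definition mellin_barnes :: "(complex \<Rightarrow> complex) \<Rightarrow> real \<Rightarrow> complex \<Rightarrow> complex" where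
  "mellin_barnes f c \<zeta> = (LINT y|lborel. f (Complex c y) * exp (- Complex c y * \<zeta>)) / (2 * of_real pi)"

text \<open>
  Shifting the line by one reproduces the integral with the factor \<open>- exp \<zeta>\<close>, and the pole at the origin
  contributes \<open>1\<close>; so the integral \<open>J\<close> satisfies \<open>J = - exp \<zeta> * J + 1\<close>.
\<close>
lemma mellin_barnes_logistic:
  assumes c: "0 < c" "c < 1" and \<zeta>: "\<bar>Im \<zeta>\<bar> < pi"
  shows "mellin_barnes (\<lambda>s. of_real pi / sin (of_real pi * s)) c \<zeta> = 1 / (1 + exp \<zeta>)"
    and "integrable lborel (\<lambda>y. of_real pi / sin (of_real pi * Complex c y) * exp (- Complex c y * \<zeta>))"
proof -
  define \<kappa> where "\<kappa> = (pi + \<bar>Im \<zeta>\<bar>) / 2"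
  have \<kappa>: "0 \<le> \<kappa>" "\<kappa> < pi" "\<bar>Im \<zeta>\<bar> < \<kappa>" using \<zeta> by (auto simp: \<kappa>_def)
  obtain C where C: "0 < C" "\<And>s. c - 1 \<le> Re s \<Longrightarrow> Re s \<le> c \<Longrightarrow> norm (sinc_inv s) \<le> C * exp (- \<kappa> * \<bar>Im s\<bar>)"
    using sinc_inv_bound[of "c - 1" c \<kappa>] c \<kappa> by auto
  define h where "h s = sinc_inv s * exp (- s * \<zeta>)" for s
  let ?f = "\<lambda>c y. of_real pi / sin (of_real pi * Complex c y) * exp (- Complex c y * \<zeta>)"
  have eq: "h (Complex d y) / Complex d y = ?f d y" if "d \<noteq> 0" for d y
    using that by (simp add: h_def sinc_inv_def complex_eq_iff)
  have hol: "h holomorphic_on {s. -1 < Re s \<and> Re s < 1}"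
    unfolding h_def by (intro holomorphic_intros sinc_inv_holomorphic)
  have decay: "norm (h s) \<le> (C * exp \<bar>Re \<zeta>\<bar>) * exp (- (\<kappa> - \<bar>Im \<zeta>\<bar>) * \<bar>Im s\<bar>)"
    if s: "c - 1 \<le> Re s" "Re s \<le> c" for s
  proof -
    have "- Re s * Re \<zeta> \<le> \<bar>Re s\<bar> * \<bar>Re \<zeta>\<bar>" by (metis abs_ge_self abs_minus_cancel abs_mult minus_mult_left)
    also have "\<dots> \<le> 1 * \<bar>Re \<zeta>\<bar>" using s c by (intro mult_right_mono) auto
    finally have 1: "- Re s * Re \<zeta> \<le> \<bar>Re \<zeta>\<bar>" by simp
    have 2: "Im s * Im \<zeta> \<le> \<bar>Im s\<bar> * \<bar>Im \<zeta>\<bar>" by (metis abs_ge_self abs_mult)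
    have "norm (h s) \<le> (C * exp (- \<kappa> * \<bar>Im s\<bar>)) * exp (\<bar>Re \<zeta>\<bar> + \<bar>Im s\<bar> * \<bar>Im \<zeta>\<bar>)"
      unfolding h_def norm_mult norm_exp_cmult using C s 1 2 by (intro mult_mono) auto
    also have "\<dots> = (C * exp \<bar>Re \<zeta>\<bar>) * exp (- (\<kappa> - \<bar>Im \<zeta>\<bar>) * \<bar>Im s\<bar>)"
      by (simp add: exp_add[symmetric] mult.assoc algebra_simps)
    finally show ?thesis .
  qed
  note shift = vertical_line_shift_pole[OF hol, of "c - 1" c "\<kappa> - \<bar>Im \<zeta>\<bar>" "C * exp \<bar>Re \<zeta>\<bar>", OF _ _ c _ decay]
  have c0: "c \<noteq> 0" "c - 1 \<noteq> 0" using c by auto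
  show "integrable lborel (?f c)"
    using shift(1) c \<kappa> c0 by (simp add: eq)
  have "(LINT y|lborel. ?f c y) = (LINT y|lborel. ?f (c - 1) y) + 2 * pi"
    using shift(3) c \<kappa> c0 by (simp add: eq) (simp add: h_def sinc_inv_def)
  also have "(LINT y|lborel. ?f (c - 1) y) = (LINT y|lborel. - exp \<zeta> * ?f c y)"
  proof (rule Bochner_Integration.integral_cong[OF refl])
    fix y
    have C1: "Complex (c - 1) y = Complex c y - 1" by (simp add: complex_eq_iff)
    have "sin (of_real pi * (Complex c y - 1)) = - sin (of_real pi * Complex c y)"
      by (simp add: right_diff_distrib sin_diff)
    then show "?f (c - 1) y = - exp \<zeta> * ?f c y"
      unfolding C1 by (simp add: left_diff_distrib exp_diff exp_minus field_simps)
  qed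
  also have "\<dots> = - exp \<zeta> * (LINT y|lborel. ?f c y)" by (rule integral_mult_right_zero)
  finally have eq: "(LINT y|lborel. ?f c y) * (1 + exp \<zeta>) = 2 * of_real pi"
    unfolding of_real_mult of_real_numeral by algebra
  have nz: "1 + exp \<zeta> \<noteq> 0"
  proof
    assume "1 + exp \<zeta> = 0"
    with eq have "2 * complex_of_real pi = 0" by (simp only: mult_zero_right)
    then show False by simp
  qed
  have "(LINT y|lborel. ?f c y) = 2 * of_real pi / (1 + exp \<zeta>)"
    by (rule iffD2[OF nonzero_eq_divide_eq[OF nz] eq])
  then show "mellin_barnes (\<lambda>s. of_real pi / sin (of_real pi * s)) c \<zeta> = 1 / (1 + exp \<zeta>)"
    unfolding mellin_barnes_def by simp
qed

section \<open>The sine ratio of a class\<close>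

text \<open>
  These are the reciprocals of the power moments of the two products of gamma quotients in the
  identity, see \<open>sin_ratio_num_inverse\<close> and \<open>sin_ratio_den_inverse\<close>.
\<close>
definition sin_ratio_num :: "real \<Rightarrow> int \<Rightarrow> complex \<Rightarrow> complex" where
  "sin_ratio_num \<alpha> l s = (\<Prod>j\<in>{1..l - 1}. sin (of_real pi * ((of_int j - s) / of_real \<alpha>)) / sin (of_real pi * (of_int j / of_real \<alpha>)))"

definition sin_ratio_den :: "real \<Rightarrow> int \<Rightarrow> complex \<Rightarrow> complex" where
  "sin_ratio_den \<alpha> k s = (\<Prod>j\<in>{1..k}. sin (of_real pi * (of_real \<alpha> * of_int j + s)) / sin (of_real pi * (of_real \<alpha> * of_int j)))"

text \<open>
  The analytic part of the argument depends on the process only through these relations. The last two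
  assumptions express the canonical choice of the indices for rational \<open>\<alpha>\<close>: no argument of a sine in
  the denominators is an integer multiple of \<open>pi\<close>.
\<close>
locale stable_indices =
  fixes \<alpha> \<rho> :: real and k l :: int
  assumes \<alpha>: "0 < \<alpha>" "\<alpha> < 2" and \<rho>: "0 < \<rho>" and k: "0 \<le> k" and l: "0 < l"
    and class_eq: "\<rho> + of_int k = of_int l / \<alpha>"
    and alpha_mult: "\<And>p q :: int. 1 \<le> q \<Longrightarrow> q \<le> k \<Longrightarrow> \<alpha> * of_int q \<noteq> of_int p"
    and alpha_div: "\<And>p q :: int. 1 \<le> p \<Longrightarrow> p \<le> l - 1 \<Longrightarrow> \<alpha> * of_int q \<noteq> of_int p"
begin

lemma sin_den_nonzero:
  assumes "j \<in> {1..k}" shows "sin (of_real pi * (of_real \<alpha> * of_int j)) \<noteq> (0 :: complex)"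
proof
  assume "sin (of_real pi * (of_real \<alpha> * of_int j)) = (0 :: complex)"
  then obtain n :: int where "of_real \<alpha> * of_int j = (of_int n :: complex)"
    unfolding sin_pi_eq_0_iff by blast
  then have "complex_of_real (\<alpha> * of_int j) = of_real (of_int n)" by simp
  then have "\<alpha> * of_int j = of_int n" unfolding of_real_eq_iff .
  then show False using alpha_mult[of j n] assms by auto
qed

lemma sin_num_nonzero:
  assumes "j \<in> {1..l - 1}" shows "sin (of_real pi * (of_int j / of_real \<alpha>)) \<noteq> (0 :: complex)"
proof
  assume "sin (of_real pi * (of_int j / of_real \<alpha>)) = (0 :: complex)"
  then obtain n :: int where "of_int j / of_real \<alpha> = (of_int n :: complex)"
    unfolding sin_pi_eq_0_iff by blast
  then have "of_int j = (of_real \<alpha> * of_int n :: complex)" using \<alpha> by (simp add: field_simps)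
  then have "complex_of_real (of_int j) = of_real (\<alpha> * of_int n)" by simp
  then have "of_int j = \<alpha> * of_int n" unfolding of_real_eq_iff .
  then show False using alpha_div[of j n] assms by auto
qed

lemma sin_ratio_0: "sin_ratio_num \<alpha> l 0 = 1" "sin_ratio_den \<alpha> k 0 = 1"
  using sin_num_nonzero sin_den_nonzero by (auto simp: sin_ratio_num_def sin_ratio_den_def intro!: prod.neutral)

text \<open>
  A zero of the factor \<open>j\<close> of the denominator is \<open>s = n - \<alpha> * j\<close> with an integer \<open>n\<close>. In the strip,
  \<open>- \<alpha> < s\<close> forces \<open>n \<ge> 1\<close> because \<open>j \<ge> 1\<close>, and \<open>s < \<alpha> * \<rho> = l - \<alpha> * k\<close> forces \<open>n < l\<close> because
  \<open>j \<le> k\<close>. So the factor \<open>n\<close> of the numerator exists, and it vanishes at \<open>s\<close>. Two factors of the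
  denominator have no common zero, since otherwise \<open>\<alpha> * q\<close> would be an integer for some \<open>0 < q < k\<close>.
\<close>
lemma sin_ratio_exists:
  "\<exists>R. R holomorphic_on {s. -\<alpha> < Re s \<and> Re s < \<alpha> * \<rho>} \<and>
    (\<forall>s. -\<alpha> < Re s \<and> Re s < \<alpha> * \<rho> \<longrightarrow> sin_ratio_num \<alpha> l s = R s * sin_ratio_den \<alpha> k s)"
proof -
  let ?S = "{s. -\<alpha> < Re s \<and> Re s < \<alpha> * \<rho>}"
  have S: "open ?S"
    by (intro open_Collect_conj open_halfspace_Re_gt open_halfspace_Re_lt)
  define g where "g j s = sin (of_real pi * (of_real \<alpha> * of_int j + s))" for j :: int and s :: complex
  define D where "D = (\<Prod>j\<in>{1..k}. sin (of_real pi * (of_real \<alpha> * of_int j)) :: complex)"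
  have zero: "\<exists>n::int. s = of_real (of_int n - \<alpha> * of_int j)" if "g j s = 0" for j s
  proof -
    obtain n :: int where "of_real \<alpha> * of_int j + s = of_int n"
      using \<open>g j s = 0\<close> unfolding g_def sin_pi_eq_0_iff by blast
    then have "s = of_real (of_int n - \<alpha> * of_int j)" by (simp add: algebra_simps)
    then show ?thesis by blast
  qed
  have \<alpha>k: "\<alpha> * \<rho> = of_int l - \<alpha> * of_int k" using class_eq \<alpha> by (simp add: field_simps)
  have "\<exists>h. h holomorphic_on ?S \<and> (\<forall>z\<in>?S. sin_ratio_num \<alpha> l z * D = h z * (\<Prod>j\<in>{1..k}. g j z))"
  proof (rule holomorphic_divide_prod_simple_zeros[OF S])
    show "(\<lambda>s. sin_ratio_num \<alpha> l s * D) holomorphic_on ?S"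
      unfolding sin_ratio_num_def using sin_num_nonzero \<alpha> by (intro holomorphic_intros) auto
    show "g j holomorphic_on ?S" for j unfolding g_def by (intro holomorphic_intros)
    show "sin_ratio_num \<alpha> l s * D = 0 \<and> deriv (g j) s \<noteq> 0" if j: "j \<in> {1..k}" and s: "s \<in> ?S" and g0: "g j s = 0" for j s
    proof
      show "deriv (g j) s \<noteq> 0"
        using deriv_sin_pi_nonzero[of "of_real \<alpha> * of_int j" s] g0 by (simp add: g_def[abs_def])
      obtain n :: int where n: "s = of_real (of_int n - \<alpha> * of_int j)" using zero[OF g0] by blast
      have "- \<alpha> < of_int n - \<alpha> * of_int j" "of_int n - \<alpha> * of_int j < of_int l - \<alpha> * of_int k"
        using s unfolding n \<alpha>k[symmetric] by simp_all
      moreover have "\<alpha> * 1 \<le> \<alpha> * of_int j" "\<alpha> * of_int j \<le> \<alpha> * of_int k"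
        using j \<alpha> by (intro mult_left_mono; simp)+
      ultimately have "0 < real_of_int n" "real_of_int n < real_of_int l" by linarith+
      then have nl: "n \<in> {1..l - 1}" by auto
      have "(of_int n - s) / of_real \<alpha> = of_int j" using \<alpha> by (simp add: n field_simps)
      then have "sin (of_real pi * ((of_int n - s) / of_real \<alpha>)) = 0" using sin_pi_eq_0_iff by metis
      then show "sin_ratio_num \<alpha> l s * D = 0"
        unfolding sin_ratio_num_def using nl by (auto simp: prod_zero_iff intro!: bexI[of _ n])
    qed
    show "g j' s \<noteq> 0" if j: "j \<in> {1..k}" "j' \<in> {1..k}" "j \<noteq> j'" and g0: "g j s = 0" for j j' s
    proof
      assume g0': "g j' s = 0"
      obtain n n' :: int where "s = of_real (of_int n - \<alpha> * of_int j)" "s = of_real (of_int n' - \<alpha> * of_int j')"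
        using zero[OF g0] zero[OF g0'] by blast
      then have eq: "of_int n - \<alpha> * of_int j = of_int n' - \<alpha> * of_int j'" by (metis of_real_eq_iff)
      show False
      proof (cases "j < j'")
        case True
        then show False using eq j alpha_mult[of "j' - j" "n' - n"] by (simp add: algebra_simps)
      next
        case False
        then show False using eq j alpha_mult[of "j - j'" "n - n'"] by (simp add: algebra_simps)
      qed
    qed
  qed auto
  then obtain h where h: "h holomorphic_on ?S" "\<And>z. z \<in> ?S \<Longrightarrow> sin_ratio_num \<alpha> l z * D = h z * (\<Prod>j\<in>{1..k}. g j z)" by blast
  have D: "D \<noteq> 0" using sin_den_nonzero by (auto simp: D_def)
  have den: "sin_ratio_den \<alpha> k z = (\<Prod>j\<in>{1..k}. g j z) / D" for z
    by (simp add: sin_ratio_den_def g_def D_def prod_dividef)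
  have "sin_ratio_num \<alpha> l z = h z * sin_ratio_den \<alpha> k z" if "z \<in> ?S" for z
    unfolding den times_divide_eq_right by (rule iffD2[OF nonzero_eq_divide_eq[OF D] h(2)[OF that]])
  then show ?thesis using h(1) by (intro exI[of _ h]) auto
qed

text \<open>
  The quotient of the two products of sines, with its removable singularities in the strip removed.
\<close>
definition sin_ratio :: "complex \<Rightarrow> complex" where
  "sin_ratio = (SOME R. R holomorphic_on {s. -\<alpha> < Re s \<and> Re s < \<alpha> * \<rho>} \<and>
    (\<forall>s. -\<alpha> < Re s \<and> Re s < \<alpha> * \<rho> \<longrightarrow> sin_ratio_num \<alpha> l s = R s * sin_ratio_den \<alpha> k s))"

lemma sin_ratio_holomorphic: "sin_ratio holomorphic_on {s. -\<alpha> < Re s \<and> Re s < \<alpha> * \<rho>}"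
  and sin_ratio_eq: "-\<alpha> < Re s \<Longrightarrow> Re s < \<alpha> * \<rho> \<Longrightarrow> sin_ratio_num \<alpha> l s = sin_ratio s * sin_ratio_den \<alpha> k s"
  using someI_ex[OF sin_ratio_exists] unfolding sin_ratio_def by auto

lemma alpha_rho_pos: "0 < \<alpha> * \<rho>" using \<alpha> \<rho> by simp

lemma sin_ratio_at_0: "sin_ratio 0 = 1"
  using sin_ratio_eq[of 0] \<alpha> alpha_rho_pos by (simp add: sin_ratio_0)

lemma sin_den_nonreal:
  assumes "Im s \<noteq> 0" shows "sin (of_real pi * (of_real \<alpha> * of_int j + s)) \<noteq> 0"
proof
  assume "sin (of_real pi * (of_real \<alpha> * of_int j + s)) = 0"
  then obtain n :: int where "of_real \<alpha> * of_int j + s = of_int n"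
    unfolding sin_pi_eq_0_iff by blast
  from arg_cong[OF this, of Im] assms show False by simp
qed

text \<open>
  For large imaginary part each sine has the size \<open>exp\<close> of the modulus of its imaginary part, and the
  exponents add up to \<open>(l - 1) / \<alpha> - k = \<rho> - 1 / \<alpha>\<close>.
\<close>
lemma sin_ratio_bound:
  assumes pq: "-\<alpha> < p" "q < \<alpha> * \<rho>" and \<alpha>\<rho>: "\<alpha> * \<rho> \<le> 1"
  obtains C where "0 < C" "\<And>s. p \<le> Re s \<Longrightarrow> Re s \<le> q \<Longrightarrow> norm (sin_ratio s) \<le> C * exp (- (pi * (1 / \<alpha> - \<rho>)) * \<bar>Im s\<bar>)"
proof -
  define Cn where "Cn = (\<Prod>j\<in>{1..l - 1}. 1 / norm (sin (of_real pi * (of_int j / of_real \<alpha> :: complex))))"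
  define Cd where "Cd = (\<Prod>j\<in>{1..k}. 1 / (4 * norm (sin (of_real pi * (of_real \<alpha> * of_int j :: complex)))))"
  have Cd: "0 < Cd" unfolding Cd_def using sin_den_nonzero by (intro prod_pos) auto
  have far: "norm (sin_ratio s) \<le> (Cn / Cd) * exp (- (pi * (1 / \<alpha> - \<rho>)) * \<bar>Im s\<bar>)"
    if s: "p \<le> Re s" "Re s \<le> q" "1 \<le> \<bar>Im s\<bar>" for s
  proof -
    have num: "norm (sin_ratio_num \<alpha> l s) \<le> Cn * exp (pi * \<bar>Im s\<bar> / \<alpha>) ^ nat (l - 1)"
    proof -
      have "norm (sin_ratio_num \<alpha> l s) \<le> (\<Prod>j\<in>{1..l - 1}. 1 / norm (sin (of_real pi * (of_int j / of_real \<alpha> :: complex))) * exp (pi * \<bar>Im s\<bar> / \<alpha>))"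
        unfolding sin_ratio_num_def prod_norm[symmetric]
      proof (intro prod_mono conjI norm_ge_zero)
        fix j :: int
        have "\<bar>Im (of_real pi * ((of_int j - s) / of_real \<alpha>))\<bar> = pi * \<bar>Im s\<bar> / \<alpha>"
          using \<alpha> by (simp add: abs_mult)
        then have "norm (sin (of_real pi * ((of_int j - s) / of_real \<alpha>))) \<le> exp (pi * \<bar>Im s\<bar> / \<alpha>)"
          using norm_sin_le by metis
        then show "norm (sin (of_real pi * ((of_int j - s) / of_real \<alpha>)) / sin (of_real pi * (of_int j / of_real \<alpha>)))
          \<le> 1 / norm (sin (of_real pi * (of_int j / of_real \<alpha> :: complex))) * exp (pi * \<bar>Im s\<bar> / \<alpha>)"
          by (simp add: norm_divide divide_right_mono)
      qed
      then show ?thesis unfolding Cn_def prod.distrib prod_constant card_atLeastAtMost_int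
        by (simp only: diff_add_cancel)
    qed
    have den: "Cd * exp (pi * \<bar>Im s\<bar>) ^ nat k \<le> norm (sin_ratio_den \<alpha> k s)"
    proof -
      have "(\<Prod>j\<in>{1..k}. 1 / (4 * norm (sin (of_real pi * (of_real \<alpha> * of_int j :: complex)))) * exp (pi * \<bar>Im s\<bar>)) \<le> norm (sin_ratio_den \<alpha> k s)"
        unfolding sin_ratio_den_def prod_norm[symmetric]
      proof (intro prod_mono conjI)
        fix j :: int
        have im: "\<bar>Im (of_real pi * (of_real \<alpha> * of_int j + s))\<bar> = pi * \<bar>Im s\<bar>"
          by (simp add: abs_mult)
        have "1 \<le> pi * \<bar>Im s\<bar>" using s pi_ge_two mult_mono[of 1 pi 1 "\<bar>Im s\<bar>"] by simp
        then have "exp (pi * \<bar>Im s\<bar>) / 4 \<le> norm (sin (of_real pi * (of_real \<alpha> * of_int j + s)))"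
          using norm_sin_ge[of "of_real pi * (of_real \<alpha> * of_int j + s)"] im by simp
        then have "exp (pi * \<bar>Im s\<bar>) / 4 / norm (sin (of_real pi * (of_real \<alpha> * of_int j :: complex)))
           \<le> norm (sin (of_real pi * (of_real \<alpha> * of_int j + s))) / norm (sin (of_real pi * (of_real \<alpha> * of_int j :: complex)))"
          by (intro divide_right_mono) auto
        then show "1 / (4 * norm (sin (of_real pi * (of_real \<alpha> * of_int j :: complex)))) * exp (pi * \<bar>Im s\<bar>)
          \<le> norm (sin (of_real pi * (of_real \<alpha> * of_int j + s)) / sin (of_real pi * (of_real \<alpha> * of_int j)))"
          by (simp add: norm_divide mult.commute)
      qed simp
      then show ?thesis unfolding Cd_def prod.distrib prod_constant card_atLeastAtMost_int
        by (simp only: diff_add_cancel)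
    qed
    have pos: "0 < norm (sin_ratio_den \<alpha> k s)" using den Cd by (smt (verit) exp_gt_zero mult_pos_pos zero_less_power)
    have "norm (sin_ratio s) = norm (sin_ratio_num \<alpha> l s) / norm (sin_ratio_den \<alpha> k s)"
      using sin_ratio_eq[of s] s pq pos by (simp add: norm_mult)
    also have "\<dots> \<le> (Cn * exp (pi * \<bar>Im s\<bar> / \<alpha>) ^ nat (l - 1)) / (Cd * exp (pi * \<bar>Im s\<bar>) ^ nat k)"
      using num den Cd by (intro frac_le) (auto intro: order_trans[OF norm_ge_zero])
    also have "\<dots> = (Cn / Cd) * (exp (pi * \<bar>Im s\<bar> / \<alpha>) ^ nat (l - 1) / exp (pi * \<bar>Im s\<bar>) ^ nat k)"
      by simp
    also have "exp (pi * \<bar>Im s\<bar> / \<alpha>) ^ nat (l - 1) / exp (pi * \<bar>Im s\<bar>) ^ nat k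
       = exp (real_of_int (l - 1) * (pi * \<bar>Im s\<bar> / \<alpha>) - real_of_int k * (pi * \<bar>Im s\<bar>))"
      using l k by (simp add: exp_of_nat_mult[symmetric] exp_diff)
    also have "real_of_int (l - 1) * (pi * \<bar>Im s\<bar> / \<alpha>) - real_of_int k * (pi * \<bar>Im s\<bar>) = (pi * \<bar>Im s\<bar>) * ((of_int l / \<alpha> - of_int k) - 1 / \<alpha>)"
      by (simp add: algebra_simps diff_divide_distrib)
    also have "\<dots> = - (pi * (1 / \<alpha> - \<rho>)) * \<bar>Im s\<bar>" using class_eq[symmetric] by (simp add: algebra_simps)
    finally show ?thesis .
  qed
  have "0 \<le> pi * (1 / \<alpha> - \<rho>)" using \<alpha>\<rho> \<alpha> by (simp add: field_simps)
  moreover have "continuous_on {s. p \<le> Re s \<and> Re s \<le> q} sin_ratio"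
    using pq by (intro continuous_on_subset[OF holomorphic_on_imp_continuous_on[OF sin_ratio_holomorphic]]) auto
  ultimately show thesis using strip_bound[OF _ far] that by blast
qed

text \<open>
  A shift by \<open>\<alpha>\<close> changes the sign of every factor of the numerator and telescopes in the denominator,
  which exchanges the factors \<open>0\<close> and \<open>k\<close>. The factor \<open>k\<close> becomes a sine of \<open>s - \<alpha> * \<rho>\<close>, up to sign,
  by \<open>\<alpha> * k = l - \<alpha> * \<rho>\<close>.
\<close>
lemma sin_ratio_shift:
  assumes s: "0 < Re s" "Re s < \<alpha> * \<rho>" "Im s \<noteq> 0"
  shows "sin_ratio (s - of_real \<alpha>) * sin (of_real pi * s) = - (sin_ratio s * sin (of_real pi * (s - of_real (\<alpha> * \<rho>))))"
proof -
  define g where "g j = sin (of_real pi * (of_real \<alpha> * of_int j + s))" for j :: int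
  define d where "d j = (sin (of_real pi * (of_real \<alpha> * of_int j)) :: complex)" for j :: int
  have g: "g j \<noteq> 0" for j unfolding g_def using s(3) by (rule sin_den_nonreal)
  have d: "d j \<noteq> 0" if "j \<in> {1..k}" for j unfolding d_def using that by (rule sin_den_nonzero)
  define D where "D = (\<Prod>j\<in>{1..k}. d j)"
  have D: "D \<noteq> 0" using d by (auto simp: D_def)
  have den: "sin_ratio_den \<alpha> k s * D = (\<Prod>j\<in>{1..k}. g j)"
    using D by (simp add: sin_ratio_den_def g_def d_def D_def prod_dividef)
  have "sin_ratio_den \<alpha> k (s - of_real \<alpha>) * D = (\<Prod>j\<in>{1..k}. sin (of_real pi * (of_real \<alpha> * of_int j + (s - of_real \<alpha>))))"
    using D by (simp add: sin_ratio_den_def d_def D_def prod_dividef)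
  also have "\<dots> = (\<Prod>j\<in>{1..k}. g (j - 1))"
    by (intro prod.cong) (auto simp: g_def algebra_simps)
  also have "\<dots> = (\<Prod>j\<in>{0..k - 1}. g j)"
    by (rule prod.reindex_bij_witness[of _ "\<lambda>j. j + 1" "\<lambda>j. j - 1"]) auto
  finally have den': "sin_ratio_den \<alpha> k (s - of_real \<alpha>) * D = (\<Prod>j\<in>{0..k - 1}. g j)" .
  have tele: "(\<Prod>j\<in>{0..k - 1}. g j) * g k = g 0 * (\<Prod>j\<in>{1..k}. g j)"
  proof -
    have e1: "{0..k} = insert k {0..k - 1}" and e2: "{0..k} = insert 0 {1..k}" using k by auto
    have "(\<Prod>j\<in>{0..k}. g j) = g k * (\<Prod>j\<in>{0..k - 1}. g j)" unfolding e1 by (rule prod.insert) auto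
    moreover have "(\<Prod>j\<in>{0..k}. g j) = g 0 * (\<Prod>j\<in>{1..k}. g j)" unfolding e2 by (rule prod.insert) auto
    ultimately show ?thesis by (simp add: mult.commute)
  qed
  have num: "sin_ratio_num \<alpha> l (s - of_real \<alpha>) = (- 1) ^ nat (l - 1) * sin_ratio_num \<alpha> l s"
  proof -
    have "sin (of_real pi * ((of_int j - (s - of_real \<alpha>)) / of_real \<alpha>)) = - sin (of_real pi * ((of_int j - s) / of_real \<alpha>))" for j :: int
    proof -
      have "of_real pi * ((of_int j - (s - of_real \<alpha>)) / of_real \<alpha>) = of_real pi * ((of_int j - s) / of_real \<alpha>) + of_real pi"
        using \<alpha> by (simp add: field_simps)
      then show ?thesis by (simp add: sin_add)
    qed
    then have "sin_ratio_num \<alpha> l (s - of_real \<alpha>) = (\<Prod>j\<in>{1..l - 1}. (- 1) * (sin (of_real pi * ((of_int j - s) / of_real \<alpha>)) / sin (of_real pi * (of_int j / of_real \<alpha>))))"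
      unfolding sin_ratio_num_def by (intro prod.cong) auto
    also have "\<dots> = (- 1) ^ nat (l - 1) * sin_ratio_num \<alpha> l s"
      unfolding prod.distrib sin_ratio_num_def by simp
    finally show ?thesis .
  qed
  have gk: "g k = (- 1) ^ nat l * sin (of_real pi * (s - of_real (\<alpha> * \<rho>)))"
  proof -
    have "\<alpha> * of_int k = of_int l - \<alpha> * \<rho>" using class_eq \<alpha> by (simp add: field_simps)
    then have "complex_of_real (\<alpha> * of_int k) = of_int l - of_real (\<alpha> * \<rho>)" by simp
    then have ak: "of_real \<alpha> * of_int k = (of_int l - of_real (\<alpha> * \<rho>) :: complex)" by simp
    have e: "of_real pi * (of_real \<alpha> * of_int k + s) = of_real pi * (s - of_real (\<alpha> * \<rho>)) + of_nat (nat l) * of_real pi"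
      unfolding ak using l by (simp add: algebra_simps)
    have "sin (x + of_nat n * of_real pi) = (- 1) ^ n * sin x" for x :: complex and n
      by (induction n) (auto simp: distrib_right add.assoc[symmetric] sin_add)
    then show ?thesis unfolding g_def e .
  qed
  have sg: "(- 1) ^ nat (l - 1) = - ((- 1 :: complex) ^ nat l)"
  proof -
    have "nat l = Suc (nat (l - 1))" using l by simp
    then show ?thesis by simp
  qed
  have E1: "sin_ratio_num \<alpha> l s = sin_ratio s * sin_ratio_den \<alpha> k s"
    using s \<alpha> by (intro sin_ratio_eq) auto
  have E2: "sin_ratio_num \<alpha> l (s - of_real \<alpha>) = sin_ratio (s - of_real \<alpha>) * sin_ratio_den \<alpha> k (s - of_real \<alpha>)"
    using s \<alpha> by (intro sin_ratio_eq) auto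
  define P where "P = (\<Prod>j\<in>{1..k}. g j)"
  have P: "P \<noteq> 0" using g by (simp add: P_def)
  define e where "e = (- 1 :: complex) ^ nat l"
  have e: "e * e = 1" by (simp add: e_def power_mult_distrib[symmetric])
  have "sin_ratio (s - of_real \<alpha>) * (g 0 * P) = sin_ratio (s - of_real \<alpha>) * (sin_ratio_den \<alpha> k (s - of_real \<alpha>) * D) * g k"
    using tele by (simp add: den' P_def)
  also have "\<dots> = (sin_ratio (s - of_real \<alpha>) * sin_ratio_den \<alpha> k (s - of_real \<alpha>)) * D * g k"
    by (simp only: mult.assoc)
  also have "\<dots> = - e * (sin_ratio_num \<alpha> l s * D) * g k"
    unfolding E2[symmetric] num sg e_def by (simp only: mult.assoc)
  also have "\<dots> = - e * (sin_ratio s * P) * (e * sin (of_real pi * (s - of_real (\<alpha> * \<rho>))))"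
    unfolding E1 gk P_def den[symmetric] e_def by simp
  also have "\<dots> = - (e * e) * (sin_ratio s * sin (of_real pi * (s - of_real (\<alpha> * \<rho>)))) * P"
    by (simp add: mult_ac)
  finally have "(sin_ratio (s - of_real \<alpha>) * g 0) * P = - (sin_ratio s * sin (of_real pi * (s - of_real (\<alpha> * \<rho>)))) * P"
    by (simp add: e mult_ac)
  then show ?thesis unfolding mult_right_cancel[OF P] by (simp add: g_def)
qed

end

section \<open>The Mellin-Barnes integral of the sine ratio\<close>

text \<open>
  If the kernel decays faster than \<open>exp (- pi * \<bar>y\<bar>)\<close>, the integral makes sense beyond both sides of the
  cut \<open>\<bar>Im \<zeta>\<bar> = pi\<close>.
\<close>
lemma mellin_barnes_decay:
  fixes f :: "complex \<Rightarrow> complex"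
  assumes meas: "(\<lambda>y. f (Complex d y)) \<in> borel_measurable borel" and \<delta>: "0 < \<delta>"
    and bound: "\<And>y. norm (f (Complex d y)) \<le> B * exp (- (pi + \<delta>) * \<bar>y\<bar>)"
  shows "\<bar>Im \<zeta>\<bar> \<le> pi \<Longrightarrow> integrable lborel (\<lambda>y. f (Complex d y) * exp (- Complex d y * \<zeta>))"
    and "\<bar>Im \<zeta>\<bar> \<le> pi \<Longrightarrow> norm (mellin_barnes f d \<zeta>) \<le> B * (LINT y|lborel. exp (- \<delta> * \<bar>y\<bar>)) * exp (- d * Re \<zeta>)"
    and "mellin_barnes f d holomorphic_on {\<zeta>. \<bar>Im \<zeta>\<bar> < pi + \<delta> / 2}"
proof -
  have B: "0 \<le> B" using order_trans[OF norm_ge_zero bound[of 0]] by simp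
  have meas': "(\<lambda>y. f (Complex d y) * exp (- Complex d y * \<zeta>)) \<in> borel_measurable lborel" for \<zeta>
  proof -
    have "(\<lambda>y. exp (- Complex d y * \<zeta>)) \<in> borel_measurable borel"
      by (intro borel_measurable_continuous_onI continuous_intros)
    with meas show ?thesis by simp
  qed
  have pt: "norm (f (Complex d y) * exp (- Complex d y * \<zeta>)) \<le> B * exp (- d * Re \<zeta>) * exp (- (pi + \<delta> - \<beta>) * \<bar>y\<bar>)"
    if "\<bar>Im \<zeta>\<bar> \<le> \<beta>" for y \<zeta> \<beta>
  proof -
    have "y * Im \<zeta> \<le> \<bar>y\<bar> * \<bar>Im \<zeta>\<bar>" by (metis abs_ge_self abs_mult)
    also have "\<dots> \<le> \<bar>y\<bar> * \<beta>" using that by (intro mult_left_mono) auto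
    finally have *: "y * Im \<zeta> \<le> \<bar>y\<bar> * \<beta>" .
    have "norm (f (Complex d y) * exp (- Complex d y * \<zeta>)) \<le> (B * exp (- (pi + \<delta>) * \<bar>y\<bar>)) * exp (- d * Re \<zeta> + \<bar>y\<bar> * \<beta>)"
      unfolding norm_mult norm_exp_cmult using * bound B by (intro mult_mono) auto
    also have "\<dots> = B * exp (- d * Re \<zeta>) * exp (- (pi + \<delta> - \<beta>) * \<bar>y\<bar>)"
      by (simp add: mult.assoc exp_add[symmetric] algebra_simps)
    finally show ?thesis .
  qed
  have int: "integrable lborel (\<lambda>y. A * exp (- e * \<bar>y\<bar>))" if "0 < e" for A e :: real
    using integrable_exp_minus_abs[OF that] by simp
  show I: "integrable lborel (\<lambda>y. f (Complex d y) * exp (- Complex d y * \<zeta>))" if "\<bar>Im \<zeta>\<bar> \<le> pi" for \<zeta>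
    by (rule Bochner_Integration.integrable_bound[OF int[OF \<delta>, of "B * exp (- d * Re \<zeta>)"] meas'])
       (use pt[OF that] B in \<open>auto intro!: AE_I2\<close>)
  show "norm (mellin_barnes f d \<zeta>) \<le> B * (LINT y|lborel. exp (- \<delta> * \<bar>y\<bar>)) * exp (- d * Re \<zeta>)" if "\<bar>Im \<zeta>\<bar> \<le> pi" for \<zeta>
  proof -
    have "norm (LINT y|lborel. f (Complex d y) * exp (- Complex d y * \<zeta>)) \<le> (LINT y|lborel. B * exp (- d * Re \<zeta>) * exp (- \<delta> * \<bar>y\<bar>))"
      by (rule order_trans[OF integral_norm_bound integral_mono[OF integrable_norm[OF I[OF that]] int[OF \<delta>]]])
         (use pt[OF that] in simp)
    also have "\<dots> = B * (LINT y|lborel. exp (- \<delta> * \<bar>y\<bar>)) * exp (- d * Re \<zeta>)" by simp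
    finally have 1: "norm (LINT y|lborel. f (Complex d y) * exp (- Complex d y * \<zeta>)) \<le> \<dots>" .
    have "1 \<le> 2 * pi" using pi_ge_two by simp
    have "norm (mellin_barnes f d \<zeta>) = norm (LINT y|lborel. f (Complex d y) * exp (- Complex d y * \<zeta>)) / (2 * pi)"
      by (simp add: mellin_barnes_def norm_divide norm_mult)
    also have "\<dots> \<le> norm (LINT y|lborel. f (Complex d y) * exp (- Complex d y * \<zeta>)) / 1"
      using \<open>1 \<le> 2 * pi\<close> by (intro divide_left_mono) auto
    finally show ?thesis using 1 by simp
  qed
  show "mellin_barnes f d holomorphic_on {\<zeta>. \<bar>Im \<zeta>\<bar> < pi + \<delta> / 2}"
    unfolding holomorphic_on_def
  proof
    fix \<zeta>0 assume \<zeta>0: "\<zeta>0 \<in> {\<zeta>. \<bar>Im \<zeta>\<bar> < pi + \<delta> / 2}"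
    define A where "A = \<bar>Re \<zeta>0\<bar> + 1"
    define S where "S = {\<zeta>. \<bar>Im \<zeta>\<bar> < pi + \<delta> / 2 \<and> \<bar>Re \<zeta>\<bar> < A}"
    have S: "open S" unfolding S_def
      by (intro open_Collect_conj open_Collect_less continuous_intros)
    have "(\<lambda>\<zeta>. LINT y|lborel. f (Complex d y) * exp (- Complex d y * \<zeta>)) holomorphic_on S"
    proof (rule holomorphic_on_lebesgue_integral[OF S _ meas'])
      show "integrable lborel (\<lambda>y. B * exp (\<bar>d\<bar> * A) * exp (- (\<delta> / 2) * \<bar>y\<bar>))" using \<delta> by (intro int) auto
      show "norm (f (Complex d y) * exp (- Complex d y * \<zeta>)) \<le> B * exp (\<bar>d\<bar> * A) * exp (- (\<delta> / 2) * \<bar>y\<bar>)"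
        if "\<zeta> \<in> S" for \<zeta> y
      proof -
        have "- d * Re \<zeta> \<le> \<bar>d\<bar> * \<bar>Re \<zeta>\<bar>" by (metis abs_ge_self abs_minus_cancel abs_mult)
        also have "\<dots> \<le> \<bar>d\<bar> * A" using that by (intro mult_left_mono) (auto simp: S_def)
        finally have "B * exp (- d * Re \<zeta>) * exp (- (\<delta> / 2) * \<bar>y\<bar>) \<le> B * exp (\<bar>d\<bar> * A) * exp (- (\<delta> / 2) * \<bar>y\<bar>)"
          using B by (intro mult_right_mono mult_left_mono) auto
        with pt[of \<zeta> "pi + \<delta> / 2" y] that show ?thesis by (simp add: S_def)
      qed
    qed (intro holomorphic_intros)
    then have "mellin_barnes f d holomorphic_on S"
      unfolding mellin_barnes_def[abs_def] by (intro holomorphic_intros) auto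
    moreover have "\<zeta>0 \<in> S" using \<zeta>0 by (simp add: S_def A_def)
    ultimately show "mellin_barnes f d field_differentiable at \<zeta>0 within {\<zeta>. \<bar>Im \<zeta>\<bar> < pi + \<delta> / 2}"
      using S holomorphic_on_imp_differentiable_at field_differentiable_at_within by blast
  qed
qed

context stable_indices
begin

definition kernel :: "complex \<Rightarrow> complex" where
  "kernel s = of_real pi / sin (of_real pi * s) * sin_ratio s"

lemma kernel_eq: "s \<noteq> 0 \<Longrightarrow> kernel s = sinc_inv s * sin_ratio s / s"
  by (simp add: kernel_def sinc_inv_def)

context
  assumes strict: "\<alpha> * \<rho> < 1"
begin

text \<open>
  Half of the rate of \<open>sin_ratio\<close>; the other half pays for the factor \<open>s\<close> in \<open>sinc_inv\<close>.
\<close>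
definition decay_rate :: real where "decay_rate = pi * (1 / \<alpha> - \<rho>) / 2"

lemma decay_rate_pos: "0 < decay_rate"
  using strict \<alpha> by (simp add: decay_rate_def field_simps)

lemma sinc_sin_ratio_bound:
  assumes pq: "- \<alpha> < p" "-1 < p" "q < \<alpha> * \<rho>"
  obtains C where "0 < C"
    "\<And>s. p \<le> Re s \<Longrightarrow> Re s \<le> q \<Longrightarrow> norm (sinc_inv s * sin_ratio s) \<le> C * exp (- (pi + decay_rate) * \<bar>Im s\<bar>)"
proof -
  \<comment> \<open>for small \<open>\<alpha>\<close> the rate \<open>decay_rate\<close> exceeds \<open>pi\<close>\<close>
  define \<kappa> where "\<kappa> = max 0 (pi - decay_rate)"
  have \<kappa>: "0 \<le> \<kappa>" "\<kappa> < pi" using decay_rate_pos by (auto simp: \<kappa>_def)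
  obtain C1 where C1: "0 < C1" "\<And>s. p \<le> Re s \<Longrightarrow> Re s \<le> q \<Longrightarrow> norm (sinc_inv s) \<le> C1 * exp (- \<kappa> * \<bar>Im s\<bar>)"
    using sinc_inv_bound[of p q \<kappa>] pq strict \<kappa> by auto
  obtain C2 where C2: "0 < C2" "\<And>s. p \<le> Re s \<Longrightarrow> Re s \<le> q \<Longrightarrow> norm (sin_ratio s) \<le> C2 * exp (- (2 * decay_rate) * \<bar>Im s\<bar>)"
    using sin_ratio_bound[of p q] pq strict by (auto simp: decay_rate_def)
  show thesis
  proof (rule that[of "C1 * C2"])
    show "0 < C1 * C2" using C1 C2 by simp
    fix s assume s: "p \<le> Re s" "Re s \<le> q"
    have "norm (sinc_inv s * sin_ratio s) \<le> (C1 * exp (- \<kappa> * \<bar>Im s\<bar>)) * (C2 * exp (- (2 * decay_rate) * \<bar>Im s\<bar>))"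
      unfolding norm_mult using C1 C2 s by (intro mult_mono) auto
    also have "\<dots> = C1 * C2 * exp (- (\<kappa> + 2 * decay_rate) * \<bar>Im s\<bar>)"
      by (simp add: exp_add[symmetric] algebra_simps)
    also have "\<dots> \<le> C1 * C2 * exp (- (pi + decay_rate) * \<bar>Im s\<bar>)"
    proof -
      have "(pi + decay_rate) * \<bar>Im s\<bar> \<le> (\<kappa> + 2 * decay_rate) * \<bar>Im s\<bar>"
        by (intro mult_right_mono) (auto simp: \<kappa>_def)
      then have "exp (- (\<kappa> + 2 * decay_rate) * \<bar>Im s\<bar>) \<le> exp (- (pi + decay_rate) * \<bar>Im s\<bar>)"
        by (simp only: exp_le_cancel_iff mult_minus_left neg_le_iff_le)
      then show ?thesis using C1(1) C2(1) by (intro mult_left_mono) auto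
    qed
    finally show "norm (sinc_inv s * sin_ratio s) \<le> C1 * C2 * exp (- (pi + decay_rate) * \<bar>Im s\<bar>)" .
  qed
qed

lemma kernel_bound:
  assumes d: "- \<alpha> < d" "-1 < d" "d < \<alpha> * \<rho>" "d \<noteq> 0"
  obtains B where "0 < B" "\<And>y. norm (kernel (Complex d y)) \<le> B * exp (- (pi + decay_rate) * \<bar>y\<bar>)"
proof -
  obtain C where C: "0 < C"
    "\<And>s. d \<le> Re s \<Longrightarrow> Re s \<le> d \<Longrightarrow> norm (sinc_inv s * sin_ratio s) \<le> C * exp (- (pi + decay_rate) * \<bar>Im s\<bar>)"
    using sinc_sin_ratio_bound[of d d] d by blast
  show thesis
  proof (rule that[of "C / \<bar>d\<bar>"])
    show "0 < C / \<bar>d\<bar>" using C d by simp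
    fix y
    have "Complex d y \<noteq> 0" using d by (simp add: complex_eq_iff)
    then have "norm (kernel (Complex d y)) = norm (sinc_inv (Complex d y) * sin_ratio (Complex d y)) / norm (Complex d y)"
      by (simp add: kernel_eq norm_divide)
    also have "\<dots> \<le> (C * exp (- (pi + decay_rate) * \<bar>y\<bar>)) / \<bar>d\<bar>"
      using C(2)[of "Complex d y"] abs_Re_le_cmod[of "Complex d y"] d C(1) by (intro frac_le) auto
    finally show "norm (kernel (Complex d y)) \<le> C / \<bar>d\<bar> * exp (- (pi + decay_rate) * \<bar>y\<bar>)" by simp
  qed
qed

lemma kernel_measurable:
  assumes d: "- \<alpha> < d" "-1 < d" "d < \<alpha> * \<rho>" "d \<noteq> 0"
  shows "(\<lambda>y. kernel (Complex d y)) \<in> borel_measurable borel"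
proof -
  have c1: "continuous_on UNIV (\<lambda>y. sinc_inv (Complex d y))"
    using d strict by (intro continuous_on_compose2[OF holomorphic_on_imp_continuous_on[OF sinc_inv_holomorphic]])
      (auto simp: Complex_eq intro!: continuous_intros)
  have c2: "continuous_on UNIV (\<lambda>y. sin_ratio (Complex d y))"
    using d by (intro continuous_on_compose2[OF holomorphic_on_imp_continuous_on[OF sin_ratio_holomorphic]])
      (auto simp: Complex_eq intro!: continuous_intros)
  have nz: "Complex d y \<noteq> 0" for y using d by (simp add: complex_eq_iff)
  have "continuous_on UNIV (\<lambda>y. sinc_inv (Complex d y) * sin_ratio (Complex d y) / Complex d y)"
    by (intro continuous_intros c1 c2) (auto simp: nz Complex_eq[symmetric])
  then show ?thesis using nz by (simp add: kernel_eq borel_measurable_continuous_onI)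
qed

lemma
  assumes d: "- \<alpha> < d" "-1 < d" "d < \<alpha> * \<rho>" "d \<noteq> 0"
  shows kernel_integrable: "\<bar>Im \<zeta>\<bar> \<le> pi \<Longrightarrow> integrable lborel (\<lambda>y. kernel (Complex d y) * exp (- Complex d y * \<zeta>))"
    and norm_kernel_transform: "\<exists>K>0. \<forall>\<zeta>. \<bar>Im \<zeta>\<bar> \<le> pi \<longrightarrow> norm (mellin_barnes kernel d \<zeta>) \<le> K * exp (- d * Re \<zeta>)"
    and kernel_transform_holomorphic: "mellin_barnes kernel d holomorphic_on {\<zeta>. \<bar>Im \<zeta>\<bar> < pi + decay_rate / 2}"
proof -
  obtain B where B: "0 < B" "\<And>y. norm (kernel (Complex d y)) \<le> B * exp (- (pi + decay_rate) * \<bar>y\<bar>)"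
    using kernel_bound[OF d] by blast
  note mb = mellin_barnes_decay[of kernel, OF kernel_measurable[OF d] decay_rate_pos B(2)]
  show "\<bar>Im \<zeta>\<bar> \<le> pi \<Longrightarrow> integrable lborel (\<lambda>y. kernel (Complex d y) * exp (- Complex d y * \<zeta>))" by (rule mb(1))
  show "mellin_barnes kernel d holomorphic_on {\<zeta>. \<bar>Im \<zeta>\<bar> < pi + decay_rate / 2}" by (rule mb(3))
  define K where "K = B * (LINT y|lborel. exp (- decay_rate * \<bar>y\<bar>)) + 1"
  have "0 \<le> (LINT y|lborel. exp (- decay_rate * \<bar>y\<bar>))" by simp
  then have K: "0 < K" "B * (LINT y|lborel. exp (- decay_rate * \<bar>y\<bar>)) \<le> K"
    using B(1) by (auto simp: K_def intro!: add_nonneg_pos mult_nonneg_nonneg)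
  have "norm (mellin_barnes kernel d \<zeta>) \<le> K * exp (- d * Re \<zeta>)" if "\<bar>Im \<zeta>\<bar> \<le> pi" for \<zeta>
    using mb(2)[OF that] K(2) by (meson exp_ge_zero mult_right_mono order_trans)
  then show "\<exists>K>0. \<forall>\<zeta>. \<bar>Im \<zeta>\<bar> \<le> pi \<longrightarrow> norm (mellin_barnes kernel d \<zeta>) \<le> K * exp (- d * Re \<zeta>)"
    using K(1) by blast
qed

text \<open>
  On the right of the pole at the origin the integral decays as \<open>Re \<zeta>\<close> tends to infinity, on the left
  of it as \<open>Re \<zeta>\<close> tends to minus infinity. So it tends to the residue \<open>1\<close> when the argument tends to
  zero.
\<close>
lemma kernel_transform_shift:
  assumes p: "- \<alpha> < p" "-1 < p" "p < 0" and q: "0 < q" "q < \<alpha> * \<rho>" and \<zeta>: "\<bar>Im \<zeta>\<bar> \<le> pi"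
  shows "mellin_barnes kernel q \<zeta> = mellin_barnes kernel p \<zeta> + 1"
proof -
  obtain C where C: "0 < C"
    "\<And>s. p \<le> Re s \<Longrightarrow> Re s \<le> q \<Longrightarrow> norm (sinc_inv s * sin_ratio s) \<le> C * exp (- (pi + decay_rate) * \<bar>Im s\<bar>)"
    using sinc_sin_ratio_bound[of p q] p q by blast
  define h where "h s = sinc_inv s * sin_ratio s * exp (- s * \<zeta>)" for s
  have eq: "h (Complex d y) / Complex d y = kernel (Complex d y) * exp (- Complex d y * \<zeta>)" if "d \<noteq> 0" for d y
  proof -
    have "Complex d y \<noteq> 0" using that by (simp add: complex_eq_iff)
    then show ?thesis by (simp add: h_def kernel_eq)
  qed
  have hol: "h holomorphic_on {s. max (-\<alpha>) (-1) < Re s \<and> Re s < \<alpha> * \<rho>}"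
    unfolding h_def using strict
    by (intro holomorphic_intros holomorphic_on_subset[OF sinc_inv_holomorphic] holomorphic_on_subset[OF sin_ratio_holomorphic]) auto
  have decay: "norm (h s) \<le> (C * exp \<bar>Re \<zeta>\<bar>) * exp (- decay_rate * \<bar>Im s\<bar>)"
    if s: "p \<le> Re s" "Re s \<le> q" for s
  proof -
    have "- Re s * Re \<zeta> \<le> \<bar>Re s\<bar> * \<bar>Re \<zeta>\<bar>" by (metis abs_ge_self abs_minus_cancel abs_mult minus_mult_left)
    also have "\<dots> \<le> 1 * \<bar>Re \<zeta>\<bar>" using s p q strict by (intro mult_right_mono) auto
    finally have 1: "- Re s * Re \<zeta> \<le> \<bar>Re \<zeta>\<bar>" by simp
    have "Im s * Im \<zeta> \<le> \<bar>Im s\<bar> * \<bar>Im \<zeta>\<bar>" by (metis abs_ge_self abs_mult)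
    also have "\<dots> \<le> \<bar>Im s\<bar> * pi" using \<zeta> by (intro mult_left_mono) auto
    finally have 2: "Im s * Im \<zeta> \<le> \<bar>Im s\<bar> * pi" .
    have "norm (h s) \<le> (C * exp (- (pi + decay_rate) * \<bar>Im s\<bar>)) * exp (\<bar>Re \<zeta>\<bar> + \<bar>Im s\<bar> * pi)"
      unfolding h_def norm_mult[of "sinc_inv s * sin_ratio s"] norm_exp_cmult using C s 1 2 by (intro mult_mono) auto
    also have "\<dots> = (C * exp \<bar>Re \<zeta>\<bar>) * exp (- decay_rate * \<bar>Im s\<bar>)"
      by (simp add: exp_add[symmetric] mult.assoc algebra_simps)
    finally show ?thesis .
  qed
  have "(LINT y|lborel. h (Complex q y) / Complex q y) = (LINT y|lborel. h (Complex p y) / Complex p y) + 2 * pi * h 0"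
    by (rule vertical_line_shift_pole(3)[OF hol _ _ q(1) _ decay_rate_pos decay]) (use p q in auto)
  moreover have "h 0 = 1" by (simp add: h_def sinc_inv_def sin_ratio_at_0)
  ultimately show ?thesis
    using p q by (simp add: eq mellin_barnes_def add_divide_distrib)
qed

text \<open>
  By \<open>sin_ratio_shift\<close> the difference of the two sides is, up to a constant factor, the integral of \<open>sin_ratio s * exp (- s * x)\<close>
  along \<open>Re s = c\<close> minus that along \<open>Re s = c - \<alpha>\<close>. Both lines lie in the strip where \<open>sin_ratio\<close> is
  holomorphic.
\<close>
lemma kernel_transform_cut:
  fixes x :: real
  assumes c: "0 < c" "c < \<alpha> * \<rho>"
  defines "\<Phi> \<equiv> mellin_barnes kernel c"
  shows "\<Phi> (Complex x pi) * (1 + exp (of_real (\<alpha> * x) + \<i> * of_real (pi * \<alpha> * \<rho>)))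
       = \<Phi> (Complex x (- pi)) * (1 + exp (of_real (\<alpha> * x) - \<i> * of_real (pi * \<alpha> * \<rho>)))"
proof -
  let ?u = "Complex x pi" and ?v = "Complex x (- pi)"
  let ?a = "exp (of_real (\<alpha> * x) + \<i> * of_real (pi * \<alpha> * \<rho>))" and ?b = "exp (of_real (\<alpha> * x) - \<i> * of_real (pi * \<alpha> * \<rho>))"
  define I where "I \<zeta> y = kernel (Complex c y) * exp (- Complex c y * \<zeta>)" for \<zeta> y
  define J where "J d y = sin_ratio (Complex d y) * exp (- Complex d y * of_real x)" for d y
  have d: "- \<alpha> < c" "-1 < c" "c < \<alpha> * \<rho>" "c \<noteq> 0" using c \<alpha> by auto
  have int: "integrable lborel (I ?u)" "integrable lborel (I ?v)"
    unfolding I_def by (rule kernel_integrable[OF d]; simp)+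
  have "- \<alpha> < c - \<alpha>" using c by simp
  moreover have "pi * (1 / \<alpha> - \<rho>) = 2 * decay_rate" by (simp add: decay_rate_def)
  ultimately obtain C where C: "0 < C" "\<And>s. c - \<alpha> \<le> Re s \<Longrightarrow> Re s \<le> c \<Longrightarrow> norm (sin_ratio s) \<le> C * exp (- (2 * decay_rate) * \<bar>Im s\<bar>)"
    using sin_ratio_bound[of "c - \<alpha>" c] c(2) strict by (metis less_imp_le)
  have shift: "(LINT y|lborel. J c y) = (LINT y|lborel. J (c - \<alpha>) y)"
    unfolding J_def
  proof (rule vertical_line_shift[where f = "\<lambda>s. sin_ratio s * exp (- s * of_real x)"])
    show "(\<lambda>s. sin_ratio s * exp (- s * of_real x)) holomorphic_on {s. - \<alpha> < Re s \<and> Re s < \<alpha> * \<rho>}"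
      by (intro holomorphic_intros sin_ratio_holomorphic)
    show "0 < 2 * decay_rate" using decay_rate_pos by simp
    show "norm (sin_ratio s * exp (- s * of_real x)) \<le> (C * exp (2 * \<bar>x\<bar>)) * exp (- (2 * decay_rate) * \<bar>Im s\<bar>)"
      if s: "c - \<alpha> \<le> Re s" "Re s \<le> c" for s
    proof -
      have "- Re s * x \<le> \<bar>Re s\<bar> * \<bar>x\<bar>" by (metis abs_ge_self abs_minus_cancel abs_mult minus_mult_left)
      also have "\<dots> \<le> 2 * \<bar>x\<bar>" using s c strict \<alpha> by (intro mult_right_mono) auto
      finally have "norm (sin_ratio s * exp (- s * of_real x)) \<le> (C * exp (- (2 * decay_rate) * \<bar>Im s\<bar>)) * exp (2 * \<bar>x\<bar>)"
        unfolding norm_mult norm_exp_cmult using C s by (intro mult_mono) auto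
      then show ?thesis by (simp add: mult_ac)
    qed
  qed (use c \<alpha> in auto)
  \<comment> \<open>at \<open>y = 0\<close> the sines in the denominator may vanish\<close>
  have pt: "I ?u y * (1 + ?a) - I ?v y * (1 + ?b) = - 2 * \<i> * of_real pi * (J c y - J (c - \<alpha>) y)" if y: "y \<noteq> 0" for y
  proof -
    define s where "s = Complex c y"
    have s: "0 < Re s" "Re s < \<alpha> * \<rho>" "Im s \<noteq> 0" using c y by (auto simp: s_def)
    have sin0: "sin (of_real pi * s) \<noteq> 0" using sin_den_nonreal[OF s(3), of 0] by simp
    have sa: "Complex (c - \<alpha>) y = s - of_real \<alpha>" by (simp add: s_def complex_eq_iff)
    define k0 where "k0 = kernel s"
    define X where "X = exp (- s * of_real x)"
    define T where "T = exp (of_real (\<alpha> * x) :: complex)"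
    define p where "p = \<i> * of_real pi * s"
    define r where "r = \<i> * complex_of_real (pi * \<alpha> * \<rho>)"
    have uv: "exp (- s * ?u) = X * exp (- p)" "exp (- s * ?v) = X * exp p"
      by (simp_all add: X_def p_def exp_add[symmetric] Complex_eq algebra_simps)
    have ab: "?a = T * exp r" "?b = T * exp (- r)"
      by (simp_all add: T_def r_def exp_add[symmetric])
    have "I ?u y * (1 + ?a) - I ?v y * (1 + ?b) = k0 * X * ((exp (- p) - exp p) + T * (exp (- p) * exp r - exp p * exp (- r)))"
      unfolding I_def s_def[symmetric] uv ab k0_def by (simp add: algebra_simps)
    also have "exp (- p) - exp p = - 2 * \<i> * sin (of_real pi * s)"
      by (simp add: sin_exp_eq p_def mult.assoc field_simps)
    also have "exp (- p) * exp r - exp p * exp (- r) = - 2 * \<i> * sin (of_real pi * (s - of_real (\<alpha> * \<rho>)))"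
    proof -
      have "\<i> * (of_real pi * (s - of_real (\<alpha> * \<rho>))) = p - r"
        by (simp add: p_def r_def algebra_simps)
      then have "sin (of_real pi * (s - of_real (\<alpha> * \<rho>))) = (exp (p - r) - exp (- (p - r))) / (2 * \<i>)"
        by (simp add: sin_exp_eq)
      then show ?thesis by (simp add: exp_add[symmetric] field_simps)
    qed
    also have "k0 * X * (- 2 * \<i> * sin (of_real pi * s) + T * (- 2 * \<i> * sin (of_real pi * (s - of_real (\<alpha> * \<rho>)))))
      = - 2 * \<i> * X * (k0 * sin (of_real pi * s) + T * (k0 * sin (of_real pi * (s - of_real (\<alpha> * \<rho>)))))"
      by (simp add: algebra_simps)
    also have "k0 * sin (of_real pi * s) = of_real pi * sin_ratio s"
      using sin0 by (simp add: k0_def kernel_def)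
    also have "k0 * sin (of_real pi * (s - of_real (\<alpha> * \<rho>))) = - of_real pi * sin_ratio (s - of_real \<alpha>)"
    proof -
      have "sin_ratio s * sin (of_real pi * (s - of_real (\<alpha> * \<rho>))) = - (sin_ratio (s - of_real \<alpha>) * sin (of_real pi * s))"
        using sin_ratio_shift[OF s] by simp
      then show ?thesis using sin0 by (simp add: k0_def kernel_def field_simps)
    qed
    also have "- 2 * \<i> * X * (of_real pi * sin_ratio s + T * (- of_real pi * sin_ratio (s - of_real \<alpha>)))
      = - 2 * \<i> * of_real pi * (sin_ratio s * X - sin_ratio (s - of_real \<alpha>) * (X * T))"
      by (simp add: algebra_simps)
    also have "X * T = exp (- (s - of_real \<alpha>) * of_real x)"
      by (simp add: X_def T_def exp_add[symmetric] algebra_simps)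
    finally show ?thesis by (simp add: J_def sa s_def X_def)
  qed
  have J_int: "integrable lborel (J e)" if "e = c \<or> e = c - \<alpha>" for e
  proof (rule Bochner_Integration.integrable_bound)
    show "integrable lborel (\<lambda>y. (C * exp (- e * x)) * exp (- (2 * decay_rate) * \<bar>y\<bar>))"
      using integrable_exp_minus_abs[of "2 * decay_rate"] decay_rate_pos by simp
    have "continuous_on UNIV (\<lambda>y. sin_ratio (Complex e y))"
      using that c \<alpha> by (intro continuous_on_compose2[OF holomorphic_on_imp_continuous_on[OF sin_ratio_holomorphic]])
        (auto simp: Complex_eq intro!: continuous_intros)
    then have "continuous_on UNIV (J e)"
      unfolding J_def by (intro continuous_intros) (auto simp: Complex_eq intro!: continuous_intros)
    then show "J e \<in> borel_measurable lborel" using borel_measurable_continuous_onI by simp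
    have "norm (J e y) \<le> (C * exp (- e * x)) * exp (- (2 * decay_rate) * \<bar>y\<bar>)" for y
      using C(2)[of "Complex e y"] that \<alpha> by (auto simp: J_def norm_mult mult_ac mult_left_mono)
    then show "AE y in lborel. norm (J e y) \<le> norm ((C * exp (- e * x)) * exp (- (2 * decay_rate) * \<bar>y\<bar>))"
      using C(1) by (intro AE_I2) (simp add: abs_mult)
  qed
  have "(LINT y|lborel. I ?u y) * (1 + ?a) - (LINT y|lborel. I ?v y) * (1 + ?b)
     = (LINT y|lborel. I ?u y * (1 + ?a) - I ?v y * (1 + ?b))"
    using int by simp
  also have "\<dots> = (LINT y|lborel. - 2 * \<i> * of_real pi * (J c y - J (c - \<alpha>) y))"
  proof (rule integral_cong_AE)
    show "AE y in lborel. I ?u y * (1 + ?a) - I ?v y * (1 + ?b) = - 2 * \<i> * of_real pi * (J c y - J (c - \<alpha>) y)"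
      using AE_lborel_singleton[of "0::real"] by eventually_elim (rule pt)
  qed (use int J_int in auto)
  also have "\<dots> = 0" using J_int shift by simp
  finally have eq: "(LINT y|lborel. I ?u y) * (1 + ?a) = (LINT y|lborel. I ?v y) * (1 + ?b)" by simp
  have \<Phi>: "\<Phi> \<zeta> = (LINT y|lborel. I \<zeta> y) / (2 * of_real pi)" for \<zeta>
    by (simp add: \<Phi>_def mellin_barnes_def I_def)
  show ?thesis unfolding \<Phi> times_divide_eq_left eq ..
qed

end
end

section \<open>Identification of the Wiener-Hopf factor\<close>

lemma continuous_on_remove_point:
  fixes f :: "'a::t1_space \<Rightarrow> 'b::topological_space"
  assumes "continuous_on (S - {a}) f" "(f \<longlongrightarrow> f a) (at a within S)"
  shows "continuous_on S f"
  unfolding continuous_on_def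
proof
  fix x assume x: "x \<in> S"
  show "(f \<longlongrightarrow> f x) (at x within S)"
  proof (cases "x = a")
    case False
    have "at x within S = at x within (S - {a})"
      by (rule at_within_nhd[of _ "- {a}"]) (use False in auto)
    then show ?thesis using assms(1) x False by (auto simp: continuous_on_def)
  qed (use assms in simp)
qed

lemma norm_exp_Ln: "w \<noteq> 0 \<Longrightarrow> norm (exp (of_real a * Ln w + \<i> * of_real b)) = norm w powr a"
  by (simp add: powr_def)

lemma tendsto_norm_powr_0:
  fixes S :: "complex set"
  assumes "0 < a" shows "((\<lambda>w. norm w powr a) \<longlongrightarrow> 0) (at 0 within S)"
  by (rule tendsto_zero_powrI[where b = a]) (use assms in \<open>auto intro!: tendsto_norm_zero tendsto_ident_at\<close>)

lemma norm_powr_le: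
  fixes w :: complex
  assumes "0 \<le> a" "a \<le> 2" shows "norm w powr a \<le> (1 + norm w) ^ 2"
proof -
  have "norm w powr a \<le> (1 + norm w) powr a" using assms by (intro powr_mono2) auto
  also have "\<dots> \<le> (1 + norm w) powr 2" using assms by (intro powr_mono) auto
  also have "\<dots> = (1 + norm w) ^ 2" by (simp add: powr_numeral add_nonneg_pos add_pos_nonneg)
  finally show ?thesis .
qed

lemma stable_exponent_Ln:
  assumes w: "Re w = 0" "w \<noteq> 0"
  shows "stable_exponent \<alpha> \<rho> (Im w) =
    (if 0 \<le> Im w then exp (of_real \<alpha> * Ln w - \<i> * of_real (pi * \<alpha> * \<rho>)) else exp (of_real \<alpha> * Ln w + \<i> * of_real (pi * \<alpha> * \<rho>)))"
proof -
  define t where "t = \<bar>Im w\<bar>"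
  have t: "t > 0" using w by (auto simp: t_def complex_eq_iff)
  have pw: "complex_of_real (t powr \<alpha>) = exp (of_real (\<alpha> * ln t))"
    using t by (simp add: powr_def exp_of_real[symmetric])
  show ?thesis
  proof (cases "0 \<le> Im w")
    case True
    then have im: "Im w = t" by (simp add: t_def)
    then have "w = of_real t * \<i>" using w by (simp add: complex_eq_iff)
    then have "Ln w = of_real (ln t) + \<i> * of_real pi / 2"
      using Ln_times_of_real[OF t, of \<i>] t by (simp add: Ln_of_real)
    then have "exp (of_real \<alpha> * Ln w - \<i> * of_real (pi * \<alpha> * \<rho>)) = exp (\<i> * of_real (pi * (\<alpha> * (1 - 2 * \<rho>)) / 2)) * exp (of_real (\<alpha> * ln t))"
      by (simp add: exp_add[symmetric] algebra_simps diff_divide_distrib)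
    then show ?thesis using True im t by (simp add: stable_exponent_def Let_def pw)
  next
    case False
    then have im: "Im w = - t" by (simp add: t_def)
    then have "w = of_real t * (- \<i>)" using w by (simp add: complex_eq_iff)
    then have "Ln w = of_real (ln t) + - (\<i> * of_real pi / 2)"
      using Ln_times_of_real[OF t, of "- \<i>"] t by (simp add: Ln_of_real)
    then have "exp (of_real \<alpha> * Ln w + \<i> * of_real (pi * \<alpha> * \<rho>)) = exp (- (\<i> * of_real (pi * (\<alpha> * (1 - 2 * \<rho>)) / 2))) * exp (of_real (\<alpha> * ln t))"
      by (simp only:) (simp add: exp_add[symmetric] algebra_simps diff_divide_distrib)
    then show ?thesis using False im t by (simp add: stable_exponent_def Let_def pw)
  qed
qed

lemma Im_Ln_half_plane:
  assumes "0 \<le> Re w" "w \<noteq> 0"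
  shows "\<bar>Im (Ln w)\<bar> \<le> pi / 2" "0 \<le> Im w \<Longrightarrow> 0 \<le> Im (Ln w)" "Im w \<le> 0 \<Longrightarrow> Im (Ln w) \<le> 0" "w \<notin> \<real>\<^sub>\<le>\<^sub>0"
proof -
  show "\<bar>Im (Ln w)\<bar> \<le> pi / 2" using assms Re_Ln_pos_le[of w] by auto
  show nr: "w \<notin> \<real>\<^sub>\<le>\<^sub>0"
    using assms by (auto simp: complex_nonpos_Reals_iff complex_eq_iff)
  show "0 \<le> Im w \<Longrightarrow> 0 \<le> Im (Ln w)" using assms Im_Ln_pos_le[of w] by auto
  show "Im w \<le> 0 \<Longrightarrow> Im (Ln w) \<le> 0"
    using Im_Ln_pos_lt[OF assms(2)] Re_Ln_pos_le[OF assms(2)] assms(1) pi_gt_zero by linarith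
qed

context stable_process
begin

text \<open>
  The process has no positive jumps in this case. Here \<open>1 + \<Psi>\<close> continues to \<open>1 - (- z) powr \<alpha>\<close>, so the product
  with \<open>1 / (1 + z)\<close> is a difference quotient of the power function at \<open>- z = 1\<close>.
\<close>
lemma sup_transform_spectrally_negative:
  assumes \<alpha>\<rho>: "\<alpha> * \<rho> = 1" and z: "0 \<le> Re z"
  shows "sup_transform z = 1 / (1 + z)"
proof -
  define g where "g w = exp (of_real \<alpha> * Ln w)" for w
  define G where "G w = (if w = 1 then deriv g 1 else (g w - g 1) / (w - 1))" for w
  define \<Delta> where "\<Delta> z = (if z = 0 then 1 else G (- z))" for z
  have opS: "open (- \<real>\<^sub>\<le>\<^sub>0 :: complex set)" by (intro open_Compl closed_nonpos_Reals_complex)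
  have g: "g holomorphic_on (- \<real>\<^sub>\<le>\<^sub>0)" unfolding g_def by (intro holomorphic_intros) auto
  have G: "G holomorphic_on (- \<real>\<^sub>\<le>\<^sub>0)" unfolding G_def[abs_def] by (rule pole_lemma_open[OF g opS])
  have g1: "g 1 = 1" by (simp add: g_def)
  have ng: "norm (g w) = norm w powr \<alpha>" if "w \<noteq> 0" for w
    using norm_exp_Ln[OF that, of \<alpha> 0] by (simp add: g_def)
  have nz: "1 + z \<noteq> 0" if "0 \<le> Re z" for z :: complex using that by (auto simp: complex_eq_iff)
  have "cball 1 (1 / 2) \<subseteq> (- \<real>\<^sub>\<le>\<^sub>0 :: complex set)"
  proof
    fix w :: complex assume "w \<in> cball 1 (1 / 2)"
    then have "\<bar>Re (1 - w)\<bar> \<le> 1 / 2" using abs_Re_le_cmod[of "1 - w"] by (simp add: dist_norm)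
    then have "\<bar>1 - Re w\<bar> \<le> 1 / 2" by simp
    then have "0 < Re w" by linarith
    then show "w \<in> - \<real>\<^sub>\<le>\<^sub>0" by (auto simp: complex_nonpos_Reals_iff)
  qed
  then have "bounded (G ` cball 1 (1 / 2))"
    by (intro compact_imp_bounded compact_continuous_image compact_cball
        continuous_on_subset[OF holomorphic_on_imp_continuous_on[OF G]])
  then obtain b where "\<forall>x\<in>G ` cball 1 (1 / 2). norm x \<le> b" unfolding bounded_iff by (rule exE)
  then have b: "norm (G w) \<le> b" if "w \<in> cball 1 (1 / 2)" for w using that by blast
  have b0: "0 \<le> b" using b[of 1] order_trans[OF norm_ge_zero] by fastforce
  have Gw: "norm (G w) \<le> (b + 4) * (1 + norm w) ^ 2" if w: "w \<noteq> 0" for w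
  proof (cases "w \<in> cball 1 (1 / 2)")
    case True
    have "norm (G w) \<le> (b + 4) * 1" using b[OF True] by simp
    also have "\<dots> \<le> (b + 4) * (1 + norm w) ^ 2" using b0 by (intro mult_left_mono one_le_power) auto
    finally show ?thesis .
  next
    case False
    then have w1: "1 / 2 \<le> norm (w - 1)" "w \<noteq> 1" by (auto simp: dist_norm norm_minus_commute)
    have "norm (g w - g 1) \<le> norm w powr \<alpha> + 1"
      using norm_triangle_ineq4[of "g w" "g 1"] ng[OF w] by (simp add: g1)
    also have "\<dots> \<le> (1 + norm w) ^ 2 + (1 + norm w) ^ 2"
      using alpha_pos alpha_less_2 by (intro add_mono norm_powr_le one_le_power) auto
    finally have "norm (g w - g 1) / norm (w - 1) \<le> (2 * (1 + norm w) ^ 2) / (1 / 2)"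
      using w1 by (intro frac_le) auto
    then have "norm (G w) \<le> 4 * (1 + norm w) ^ 2" using w1 by (simp add: G_def norm_divide)
    also have "\<dots> \<le> (b + 4) * (1 + norm w) ^ 2" using b0 by (intro mult_right_mono) auto
    finally show ?thesis .
  qed
  have lim: "(\<Delta> \<longlongrightarrow> \<Delta> 0) (at 0 within {z. Re z \<le> 0})"
  proof -
    have "((\<lambda>z. g (- z)) \<longlongrightarrow> 0) (at 0 within {z. Re z \<le> 0})"
    proof (rule Lim_null_comparison[OF _ tendsto_norm_powr_0[OF alpha_pos]])
      show "\<forall>\<^sub>F z in at 0 within {z. Re z \<le> 0}. norm (g (- z)) \<le> norm z powr \<alpha>"
        using ng[of "- _"] by (auto simp: eventually_at_filter)
    qed
    then have "((\<lambda>z. (g (- z) - 1) / (- z - 1)) \<longlongrightarrow> (0 - 1) / (- 0 - 1)) (at 0 within {z. Re z \<le> 0})"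
      by (intro tendsto_intros) auto
    moreover have "\<forall>\<^sub>F z in at 0 within {z. Re z \<le> 0}. (g (- z) - 1) / (- z - 1) = \<Delta> z"
    proof -
      have "\<forall>\<^sub>F z in at 0 within {z. Re z \<le> 0}. z \<in> ball 0 1 \<and> z \<noteq> 0"
        by (auto simp: eventually_at intro!: exI[of _ 1])
      then show ?thesis by eventually_elim (auto simp: \<Delta>_def G_def g1 minus_equation_iff[of _ 1])
    qed
    ultimately show ?thesis by (simp add: \<Delta>_def Lim_transform_eventually)
  qed
  show ?thesis
  proof (rule sup_transform_unique[where \<phi> = "\<lambda>z. 1 / (1 + z)" and \<Delta> = \<Delta> and m = 2 and B = "b + 4"])
    show "(\<lambda>z. 1 / (1 + z)) holomorphic_on {z. 0 < Re z}"
      using nz by (intro holomorphic_intros) auto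
    show "continuous_on {z. 0 \<le> Re z} (\<lambda>z. 1 / (1 + z))"
      using nz by (intro continuous_intros) auto
    have "(\<lambda>z. G (- z)) holomorphic_on {z. Re z < 0}"
      by (rule holomorphic_on_compose_gen[OF _ G, of uminus, unfolded o_def])
         (auto intro!: holomorphic_intros simp: complex_nonpos_Reals_iff)
    then show "\<Delta> holomorphic_on {z. Re z < 0}"
      by (rule holomorphic_transform) (auto simp: \<Delta>_def)
    have "continuous_on ({z. Re z \<le> 0} - {0}) (\<lambda>z. G (- z))"
      by (rule continuous_on_compose2[OF holomorphic_on_imp_continuous_on[OF G]])
         (auto intro!: continuous_intros simp: complex_nonpos_Reals_iff complex_eq_iff)
    then have "continuous_on ({z. Re z \<le> 0} - {0}) \<Delta>"
      by (rule continuous_on_eq) (auto simp: \<Delta>_def)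
    then show "continuous_on {z. Re z \<le> 0} \<Delta>" using lim by (rule continuous_on_remove_point)
    show "1 / (1 + z) * (1 + stable_exponent \<alpha> \<rho> (- Im z)) = \<Delta> z" if "Re z = 0" for z
    proof (cases "z = 0")
      case False
      have e: "exp (of_real \<alpha> * Ln (- z) - \<i> * of_real (pi * \<alpha> * \<rho>)) = - g (- z)"
        "exp (of_real \<alpha> * Ln (- z) + \<i> * of_real (pi * \<alpha> * \<rho>)) = - g (- z)"
        using \<alpha>\<rho> by (simp_all add: g_def exp_diff exp_add mult.assoc)
      have "stable_exponent \<alpha> \<rho> (- Im z) = - g (- z)"
        using stable_exponent_Ln[of "- z" \<alpha> \<rho>] that False unfolding e by simp
      moreover have "- z \<noteq> 1" using that by (auto simp: complex_eq_iff)
      then have "\<Delta> z = (g (- z) - 1) / (- z - 1)" using False by (simp add: \<Delta>_def G_def g1)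
      moreover have "(g (- z) - 1) / (- z - 1) = (1 - g (- z)) / (1 + z)"
      proof -
        have "- z - 1 = - (1 + z)" "g (- z) - 1 = - (1 - g (- z))" by simp_all
        then show ?thesis by (simp only: minus_divide_divide)
      qed
      ultimately show ?thesis by simp
    qed (simp add: \<Delta>_def stable_exponent_def)
    show "norm (1 / (1 + z)) \<le> (b + 4) * (1 + norm z) ^ 2" if "0 \<le> Re z" for z :: complex
    proof -
      have "1 \<le> Re (1 + z)" using that by simp
      also have "\<dots> \<le> norm (1 + z)" by (rule complex_Re_le_cmod)
      finally have "1 / norm (1 + z) \<le> 1 / 1" by (intro divide_left_mono) auto
      moreover have "1 * 1 \<le> (b + 4) * (1 + norm z) ^ 2" using b0 by (intro mult_mono one_le_power) auto
      ultimately show ?thesis by (simp add: norm_divide)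
    qed
    show "norm (\<Delta> z) \<le> (b + 4) * (1 + norm z) ^ 2" for z
      using Gw[of "- z"] b0 by (auto simp: \<Delta>_def)
    have "((\<lambda>x. inverse (1 + x)) \<longlongrightarrow> (0::real)) at_top"
      by (intro tendsto_inverse_0_at_top filterlim_tendsto_add_at_top[OF tendsto_const filterlim_ident])
    then have "((\<lambda>x. complex_of_real (inverse (1 + x))) \<longlongrightarrow> of_real 0) at_top" by (rule tendsto_of_real)
    then show "((\<lambda>x. 1 / (1 + complex_of_real x)) \<longlongrightarrow> 0) at_top" by (simp add: divide_inverse)
  qed (use z in auto)
qed

end

context stable_indices
begin

text \<open>
  The candidate for the Wiener-Hopf factor on the right half plane, and the continuations of its product
  with \<open>1 + \<Psi>\<close>. The latter are written in \<open>w = - z\<close>; the upper one belongs to \<open>0 \<le> Im w\<close> and reaches the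
  logarithm of \<open>z\<close> as \<open>Ln w - \<i> * pi\<close>, the lower one uses \<open>Ln w + \<i> * pi\<close>. They agree for positive \<open>w\<close> by
  \<open>kernel_transform_cut\<close>.
\<close>
definition wh_factor :: "real \<Rightarrow> complex \<Rightarrow> complex" where
  "wh_factor c z = (if z = 0 then 1 else mellin_barnes kernel c (Ln z))"

definition wh_upper :: "real \<Rightarrow> complex \<Rightarrow> complex" where
  "wh_upper c w = mellin_barnes kernel c (Ln w - \<i> * of_real pi) * (1 + exp (of_real \<alpha> * Ln w - \<i> * of_real (pi * \<alpha> * \<rho>)))"

definition wh_lower :: "real \<Rightarrow> complex \<Rightarrow> complex" where
  "wh_lower c w = mellin_barnes kernel c (Ln w + \<i> * of_real pi) * (1 + exp (of_real \<alpha> * Ln w + \<i> * of_real (pi * \<alpha> * \<rho>)))"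

definition wh_dual :: "real \<Rightarrow> complex \<Rightarrow> complex" where
  "wh_dual c w = (if w = 0 then 1 else if 0 \<le> Im w then wh_upper c w else wh_lower c w)"

text \<open>
  These are the hypotheses of \<open>sup_transform_unique\<close>.
\<close>
lemma wh_candidate:
  assumes strict: "\<alpha> * \<rho> < 1" and c: "0 < c" "c < \<alpha> * \<rho>"
  shows "\<exists>B. wh_factor c holomorphic_on {z. 0 < Re z} \<and> continuous_on {z. 0 \<le> Re z} (wh_factor c) \<and>
    wh_dual c holomorphic_on {w. 0 < Re w} \<and> continuous_on {w. 0 \<le> Re w} (wh_dual c) \<and>
    (\<forall>z. 0 \<le> Re z \<longrightarrow> norm (wh_factor c z) \<le> B * (1 + norm z) ^ 2) \<and>
    (\<forall>w. 0 \<le> Re w \<longrightarrow> norm (wh_dual c w) \<le> B * (1 + norm w) ^ 2) \<and>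
    ((\<lambda>x. wh_factor c (of_real x)) \<longlongrightarrow> 0) at_top \<and>
    (\<forall>z. Re z = 0 \<longrightarrow> wh_factor c z * (1 + stable_exponent \<alpha> \<rho> (- Im z)) = wh_dual c (- z))"
proof -
  define mb where "mb = mellin_barnes kernel c"
  \<comment> \<open>any abscissa on the left of the origin, but on the right of \<open>- \<alpha>\<close> and of \<open>- 1\<close>, would do\<close>
  define p where "p = - min \<alpha> 1 / 2"
  have d: "- \<alpha> < c" "-1 < c" "c < \<alpha> * \<rho>" "c \<noteq> 0" using c \<alpha> by auto
  have p: "- \<alpha> < p" "-1 < p" "p < 0" using \<alpha> by (auto simp: p_def)
  have p': "p < \<alpha> * \<rho>" "p \<noteq> 0" using p c by auto
  obtain K where K: "0 < K" "\<And>\<zeta>. \<bar>Im \<zeta>\<bar> \<le> pi \<Longrightarrow> norm (mb \<zeta>) \<le> K * exp (- c * Re \<zeta>)"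
    using norm_kernel_transform[OF strict d] unfolding mb_def by blast
  obtain K' where K': "0 < K'" "\<And>\<zeta>. \<bar>Im \<zeta>\<bar> \<le> pi \<Longrightarrow> norm (mellin_barnes kernel p \<zeta>) \<le> K' * exp (- p * Re \<zeta>)"
    using norm_kernel_transform[OF strict p(1,2) p'] by blast
  have near: "norm (mb \<zeta> - 1) \<le> K' * exp (- p * Re \<zeta>)" if "\<bar>Im \<zeta>\<bar> \<le> pi" for \<zeta>
    using kernel_transform_shift[OF strict p c that] K'(2)[OF that] by (simp add: mb_def)
  have hol: "mb holomorphic_on {\<zeta>. \<bar>Im \<zeta>\<bar> < pi + decay_rate / 2}"
    unfolding mb_def by (rule kernel_transform_holomorphic[OF strict d])
  have cont: "continuous_on {\<zeta>. \<bar>Im \<zeta>\<bar> < pi + decay_rate / 2} mb"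
    using hol by (rule holomorphic_on_imp_continuous_on)
  have dr: "0 < decay_rate" by (rule decay_rate_pos[OF strict])
  define B where "B = 1 + K + K'"
  have B: "norm (mb \<zeta>) \<le> B" if im: "\<bar>Im \<zeta>\<bar> \<le> pi" for \<zeta>
  proof (cases "0 \<le> Re \<zeta>")
    case True
    then have "K * exp (- c * Re \<zeta>) \<le> K * 1" using K(1) c by (intro mult_left_mono) auto
    then show ?thesis using K(2)[OF im] K'(1) by (simp add: B_def)
  next
    case False
    then have "K' * exp (- p * Re \<zeta>) \<le> K' * 1" using K'(1) p by (intro mult_left_mono) (auto simp: mult_nonpos_nonpos)
    then have "norm (mb \<zeta> - 1) \<le> K'" using near[OF im] by simp
    then show ?thesis using norm_triangle_ineq[of "mb \<zeta> - 1" 1] K(1) by (simp add: B_def)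
  qed
  have B1: "1 \<le> B" using K K' by (simp add: B_def)
  have shifted: "\<bar>Im (Ln w - \<i> * of_real pi)\<bar> \<le> pi" if "0 \<le> Re w" "w \<noteq> 0" "0 \<le> Im w" for w
    using Im_Ln_half_plane[OF that(1,2)] that(3) by (auto simp: abs_le_iff)
  have shifted': "\<bar>Im (Ln w + \<i> * of_real pi)\<bar> \<le> pi" if "0 \<le> Re w" "w \<noteq> 0" "Im w \<le> 0" for w
    using Im_Ln_half_plane[OF that(1,2)] that(3) by (auto simp: abs_le_iff)
  have unshifted: "\<bar>Im (Ln w)\<bar> \<le> pi" if "0 \<le> Re w" "w \<noteq> 0" for w
    using Im_Ln_half_plane(1)[OF that] pi_gt_zero by linarith
  have in_strip: "\<zeta> \<in> {\<zeta>. \<bar>Im \<zeta>\<bar> < pi + decay_rate / 2}" if "\<bar>Im \<zeta>\<bar> \<le> pi" for \<zeta> using that dr by simp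
  have ReLn: "exp (a * Re (Ln w)) = norm w powr a" if "w \<noteq> 0" for w a using that by (simp add: powr_def)
  have nexp: "norm (exp (of_real \<alpha> * Ln w - \<i> * of_real (pi * \<alpha> * \<rho>))) = norm w powr \<alpha>"
    "norm (exp (of_real \<alpha> * Ln w + \<i> * of_real (pi * \<alpha> * \<rho>))) = norm w powr \<alpha>" if "w \<noteq> 0" for w
    using norm_exp_Ln[OF that, of \<alpha> "- (pi * \<alpha> * \<rho>)"] norm_exp_Ln[OF that, of \<alpha> "pi * \<alpha> * \<rho>"] by simp_all
  have wf: "wh_factor c z = mb (Ln z)" if "z \<noteq> 0" for z using that by (simp add: wh_factor_def mb_def)
  have 1: "wh_factor c holomorphic_on {z. 0 < Re z}"
  proof (rule holomorphic_transform)
    have "(mb \<circ> Ln) holomorphic_on {z. 0 < Re z}"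
    proof (rule holomorphic_on_compose_gen[OF _ hol])
      show "Ln ` {z. 0 < Re z} \<subseteq> {\<zeta>. \<bar>Im \<zeta>\<bar> < pi + decay_rate / 2}"
      proof (intro image_subsetI in_strip unshifted)
        fix w assume "w \<in> {w. 0 < Re w}"
        then show "0 \<le> Re w" "w \<noteq> 0" by auto
      qed
    qed (auto intro!: holomorphic_intros simp: complex_nonpos_Reals_iff)
    then show "(\<lambda>z. mb (Ln z)) holomorphic_on {z. 0 < Re z}" by (simp add: o_def)
    show "mb (Ln z) = wh_factor c z" if "z \<in> {z. 0 < Re z}" for z
      using that wf[of z] by (cases "z = 0") auto
  qed
  have cont_Ln: "continuous_on S Ln" if "\<And>w. w \<in> S \<Longrightarrow> 0 \<le> Re w \<and> w \<noteq> 0" for S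
    by (rule continuous_on_Ln) (use that Im_Ln_half_plane(4) in blast)
  have 2: "continuous_on {z. 0 \<le> Re z} (wh_factor c)"
  proof (rule continuous_on_remove_point[where a = 0])
    have "continuous_on ({z. 0 \<le> Re z} - {0}) (\<lambda>z. mb (Ln z))"
    proof (rule continuous_on_compose2[OF cont])
      show "continuous_on ({z. 0 \<le> Re z} - {0}) Ln" by (rule cont_Ln) auto
      show "Ln ` ({z. 0 \<le> Re z} - {0}) \<subseteq> {\<zeta>. \<bar>Im \<zeta>\<bar> < pi + decay_rate / 2}"
        by (intro image_subsetI in_strip unshifted) auto
    qed
    then show "continuous_on ({z. 0 \<le> Re z} - {0}) (wh_factor c)"
      by (rule continuous_on_eq) (simp add: wf)
    have "((\<lambda>z. wh_factor c z - 1) \<longlongrightarrow> 0) (at 0 within {z. 0 \<le> Re z})"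
    proof (rule Lim_null_comparison)
      show "((\<lambda>z. K' * norm z powr (- p)) \<longlongrightarrow> 0) (at 0 within {z. 0 \<le> Re z})"
        using tendsto_mult[OF tendsto_const[of K'] tendsto_norm_powr_0[of "- p"]] p by simp
      show "\<forall>\<^sub>F z in at 0 within {z. 0 \<le> Re z}. norm (wh_factor c z - 1) \<le> K' * norm z powr (- p)"
        unfolding eventually_at_filter
      proof (intro always_eventually allI impI)
        fix z :: complex assume z: "z \<noteq> 0" "z \<in> {z. 0 \<le> Re z}"
        then have "norm (mb (Ln z) - 1) \<le> K' * exp (- p * Re (Ln z))" by (intro near unshifted) auto
        then show "norm (wh_factor c z - 1) \<le> K' * norm z powr (- p)"
          unfolding wf[OF z(1)] ReLn[OF z(1)] .
      qed
    qed
    then show "(wh_factor c \<longlongrightarrow> wh_factor c 0) (at 0 within {z. 0 \<le> Re z})"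
      unfolding LIM_zero_iff by (simp only: wh_factor_def[of c 0] if_True simp_thms)
  qed
  have up: "wh_upper c w = mb (Ln w - \<i> * of_real pi) * (1 + exp (of_real \<alpha> * Ln w - \<i> * of_real (pi * \<alpha> * \<rho>)))" for w
    by (simp add: wh_upper_def mb_def)
  have lo: "wh_lower c w = mb (Ln w + \<i> * of_real pi) * (1 + exp (of_real \<alpha> * Ln w + \<i> * of_real (pi * \<alpha> * \<rho>)))" for w
    by (simp add: wh_lower_def mb_def)
  have cut: "wh_upper c w = wh_lower c w" if "Im w = 0" "0 \<le> Re w" "w \<noteq> 0" for w
  proof -
    define x where "x = Re w"
    have x: "0 < x" "w = of_real x" using that by (auto simp: x_def complex_eq_iff less_le)
    have Ln: "Ln w = of_real (ln x)" using x by (simp add: Ln_of_real)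
    have "Complex (ln x) pi = Ln w + \<i> * of_real pi" "Complex (ln x) (- pi) = Ln w - \<i> * of_real pi"
      by (simp_all add: Ln complex_eq_iff)
    then show ?thesis
      using kernel_transform_cut[OF strict c, of "ln x"] unfolding up lo mb_def by (simp add: Ln)
  qed
  have cont_up: "continuous_on {w. 0 \<le> Re w \<and> w \<noteq> 0 \<and> 0 \<le> Im w} (wh_upper c)"
  proof -
    let ?S = "{w. 0 \<le> Re w \<and> w \<noteq> 0 \<and> 0 \<le> Im w}"
    have cL: "continuous_on ?S Ln" by (rule cont_Ln) auto
    have "continuous_on ?S (\<lambda>w. mb (Ln w - \<i> * of_real pi))"
    proof (rule continuous_on_compose2[OF cont])
      show "continuous_on ?S (\<lambda>w. Ln w - \<i> * of_real pi)"
        by (intro continuous_on_diff cL continuous_on_const)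
      show "(\<lambda>w. Ln w - \<i> * of_real pi) ` ?S \<subseteq> {\<zeta>. \<bar>Im \<zeta>\<bar> < pi + decay_rate / 2}"
        by (intro image_subsetI in_strip shifted) auto
    qed
    then show ?thesis unfolding up[abs_def]
      by (intro continuous_on_mult continuous_on_add continuous_on_diff continuous_on_exp cL continuous_on_const)
  qed
  have cont_lo: "continuous_on {w. 0 \<le> Re w \<and> w \<noteq> 0 \<and> Im w \<le> 0} (wh_lower c)"
  proof -
    let ?S = "{w. 0 \<le> Re w \<and> w \<noteq> 0 \<and> Im w \<le> 0}"
    have cL: "continuous_on ?S Ln" by (rule cont_Ln) auto
    have "continuous_on ?S (\<lambda>w. mb (Ln w + \<i> * of_real pi))"
    proof (rule continuous_on_compose2[OF cont])
      show "continuous_on ?S (\<lambda>w. Ln w + \<i> * of_real pi)"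
        by (intro continuous_on_add cL continuous_on_const)
      show "(\<lambda>w. Ln w + \<i> * of_real pi) ` ?S \<subseteq> {\<zeta>. \<bar>Im \<zeta>\<bar> < pi + decay_rate / 2}"
        by (intro image_subsetI in_strip shifted') auto
    qed
    then show ?thesis unfolding lo[abs_def]
      by (intro continuous_on_mult continuous_on_add continuous_on_exp cL continuous_on_const)
  qed
  define H where "H = {w :: complex. 0 \<le> Re w} - {0}"
  have cont_H: "continuous_on H (wh_dual c)"
  proof -
    have "continuous_on H (\<lambda>w. if - Im w \<le> 0 then wh_upper c w else wh_lower c w)"
    proof (rule continuous_on_cases_le)
      show "continuous_on {w \<in> H. - Im w \<le> 0} (wh_upper c)"
        by (rule continuous_on_subset[OF cont_up]) (auto simp: H_def)
      show "continuous_on {w \<in> H. 0 \<le> - Im w} (wh_lower c)"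
        by (rule continuous_on_subset[OF cont_lo]) (auto simp: H_def)
      show "continuous_on H (\<lambda>w. - Im w)" by (intro continuous_intros)
      show "wh_upper c w = wh_lower c w" if "w \<in> H" "- Im w = 0" for w
        using that by (intro cut) (auto simp: H_def)
    qed
    then show ?thesis
      by (rule continuous_on_eq) (auto simp: H_def wh_dual_def)
  qed
  have 3: "wh_dual c holomorphic_on {w. 0 < Re w}"
  proof (rule holomorphic_on_paste_across_line[of _ \<i> _ 0])
    show "open {w. 0 < Re w}" by (rule open_halfspace_Re_gt)
    show "continuous_on {w. 0 < Re w} (wh_dual c)"
      by (rule continuous_on_subset[OF cont_H]) (auto simp: H_def)
    have "wh_lower c holomorphic_on {w. 0 < Re w \<and> Im w < 0}"
      unfolding lo[abs_def]
    proof (intro holomorphic_intros)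
      have "(mb \<circ> (\<lambda>w. Ln w + \<i> * of_real pi)) holomorphic_on {w. 0 < Re w \<and> Im w < 0}"
      proof (rule holomorphic_on_compose_gen[OF _ hol])
        show "(\<lambda>w. Ln w + \<i> * of_real pi) ` {w. 0 < Re w \<and> Im w < 0} \<subseteq> {\<zeta>. \<bar>Im \<zeta>\<bar> < pi + decay_rate / 2}"
        proof (intro image_subsetI in_strip shifted')
          fix w assume "w \<in> {w. 0 < Re w \<and> Im w < 0}"
          then show "0 \<le> Re w" "w \<noteq> 0" "Im w \<le> 0" by auto
        qed
      qed (auto intro!: holomorphic_intros simp: complex_nonpos_Reals_iff)
      then show "(\<lambda>w. mb (Ln w + \<i> * of_real pi)) holomorphic_on {w. 0 < Re w \<and> Im w < 0}" by (simp add: o_def)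
    qed (auto simp: complex_nonpos_Reals_iff)
    then show "wh_dual c holomorphic_on {w. 0 < Re w} \<inter> {w. \<i> \<bullet> w < 0}"
      by (rule holomorphic_transform[THEN holomorphic_on_subset]) (auto simp: wh_dual_def)
    have "wh_upper c holomorphic_on {w. 0 < Re w \<and> 0 < Im w}"
      unfolding up[abs_def]
    proof (intro holomorphic_intros)
      have "(mb \<circ> (\<lambda>w. Ln w - \<i> * of_real pi)) holomorphic_on {w. 0 < Re w \<and> 0 < Im w}"
      proof (rule holomorphic_on_compose_gen[OF _ hol])
        show "(\<lambda>w. Ln w - \<i> * of_real pi) ` {w. 0 < Re w \<and> 0 < Im w} \<subseteq> {\<zeta>. \<bar>Im \<zeta>\<bar> < pi + decay_rate / 2}"
        proof (intro image_subsetI in_strip shifted)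
          fix w assume "w \<in> {w. 0 < Re w \<and> 0 < Im w}"
          then show "0 \<le> Re w" "w \<noteq> 0" "0 \<le> Im w" by auto
        qed
      qed (auto intro!: holomorphic_intros simp: complex_nonpos_Reals_iff)
      then show "(\<lambda>w. mb (Ln w - \<i> * of_real pi)) holomorphic_on {w. 0 < Re w \<and> 0 < Im w}" by (simp add: o_def)
    qed (auto simp: complex_nonpos_Reals_iff)
    then show "wh_dual c holomorphic_on {w. 0 < Re w} \<inter> {w. 0 < \<i> \<bullet> w}"
      by (rule holomorphic_transform[THEN holomorphic_on_subset]) (auto simp: wh_dual_def)
  qed auto
  have dual_form: "\<exists>\<zeta> e. wh_dual c w = mb \<zeta> * (1 + e) \<and> \<bar>Im \<zeta>\<bar> \<le> pi \<and> Re \<zeta> = Re (Ln w) \<and> norm e = norm w powr \<alpha>"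
    if w: "0 \<le> Re w" "w \<noteq> 0" for w
  proof (cases "0 \<le> Im w")
    case True
    then show ?thesis using shifted[OF w True] nexp(1)[OF w(2)] w
      by (intro exI[of _ "Ln w - \<i> * of_real pi"] exI[of _ "exp (of_real \<alpha> * Ln w - \<i> * of_real (pi * \<alpha> * \<rho>))"])
         (simp add: wh_dual_def up)
  next
    case False
    then show ?thesis using shifted'[OF w] nexp(2)[OF w(2)] w
      by (intro exI[of _ "Ln w + \<i> * of_real pi"] exI[of _ "exp (of_real \<alpha> * Ln w + \<i> * of_real (pi * \<alpha> * \<rho>))"])
         (simp add: wh_dual_def lo)
  qed
  have 4: "continuous_on {w. 0 \<le> Re w} (wh_dual c)"
  proof (rule continuous_on_remove_point[where a = 0])
    show "continuous_on ({w. 0 \<le> Re w} - {0}) (wh_dual c)" using cont_H by (simp add: H_def)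
    have "((\<lambda>w. wh_dual c w - 1) \<longlongrightarrow> 0) (at 0 within {w. 0 \<le> Re w})"
    proof (rule Lim_null_comparison)
      have "((\<lambda>w. K' * norm w powr (- p) * (1 + norm w powr \<alpha>) + norm w powr \<alpha>) \<longlongrightarrow> K' * 0 * (1 + 0) + 0) (at 0 within {w. 0 \<le> Re w})"
        using p \<alpha> by (intro tendsto_intros tendsto_norm_powr_0) auto
      then show "((\<lambda>w. K' * norm w powr (- p) * (1 + norm w powr \<alpha>) + norm w powr \<alpha>) \<longlongrightarrow> 0) (at 0 within {w. 0 \<le> Re w})" by simp
      show "\<forall>\<^sub>F w in at 0 within {w. 0 \<le> Re w}. norm (wh_dual c w - 1) \<le> K' * norm w powr (- p) * (1 + norm w powr \<alpha>) + norm w powr \<alpha>"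
        unfolding eventually_at_filter
      proof (intro always_eventually allI impI)
        fix w :: complex assume w: "w \<noteq> 0" "w \<in> {w. 0 \<le> Re w}"
        obtain \<zeta> e where f: "wh_dual c w = mb \<zeta> * (1 + e)" "\<bar>Im \<zeta>\<bar> \<le> pi" "Re \<zeta> = Re (Ln w)" "norm e = norm w powr \<alpha>"
          using dual_form[of w] w by auto
        have n: "norm (mb \<zeta> - 1) \<le> K' * norm w powr (- p)"
          using near[OF f(2)] unfolding f(3) ReLn[OF w(1)] .
        have "wh_dual c w - 1 = (mb \<zeta> - 1) * (1 + e) + e" by (simp add: f(1) algebra_simps)
        then have "norm (wh_dual c w - 1) \<le> norm (mb \<zeta> - 1) * norm (1 + e) + norm e"
          using norm_triangle_ineq[of "(mb \<zeta> - 1) * (1 + e)" e] by (simp add: norm_mult)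
        also have "\<dots> \<le> (K' * norm w powr (- p)) * (1 + norm w powr \<alpha>) + norm w powr \<alpha>"
          using n norm_triangle_ineq[of 1 e] K'(1) f(4) by (intro add_mono mult_mono) auto
        finally show "norm (wh_dual c w - 1) \<le> K' * norm w powr (- p) * (1 + norm w powr \<alpha>) + norm w powr \<alpha>" .
      qed
    qed
    then show "(wh_dual c \<longlongrightarrow> wh_dual c 0) (at 0 within {w. 0 \<le> Re w})"
      unfolding LIM_zero_iff by (simp only: wh_dual_def[of c 0] if_True simp_thms)
  qed
  have one_le: "1 \<le> (1 + norm w) ^ 2" for w :: complex by (intro one_le_power) auto
  have 5: "norm (wh_factor c z) \<le> (2 * B) * (1 + norm z) ^ 2" if "0 \<le> Re z" for z
  proof -
    have "norm (wh_factor c z) \<le> B"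
    proof (cases "z = 0")
      case False
      then show ?thesis using B[OF unshifted[OF that False]] by (simp add: wf)
    qed (use B1 in \<open>simp add: wh_factor_def\<close>)
    also have "B * 1 \<le> (2 * B) * (1 + norm z) ^ 2" using B1 one_le by (intro mult_mono) auto
    finally show ?thesis by simp
  qed
  have 6: "norm (wh_dual c w) \<le> (2 * B) * (1 + norm w) ^ 2" if w: "0 \<le> Re w" for w
  proof (cases "w = 0")
    case True
    then show ?thesis using B1 by (simp add: wh_dual_def)
  next
    case False
    obtain \<zeta> e where f: "wh_dual c w = mb \<zeta> * (1 + e)" "\<bar>Im \<zeta>\<bar> \<le> pi" "norm e = norm w powr \<alpha>"
      using dual_form[OF w False] by auto
    have "norm (1 + e) \<le> 1 + norm w powr \<alpha>" using norm_triangle_ineq[of 1 e] f(3) by simp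
    also have "\<dots> \<le> (1 + norm w) ^ 2 + (1 + norm w) ^ 2" using \<alpha> by (intro add_mono one_le norm_powr_le) auto
    finally have "norm (mb \<zeta>) * norm (1 + e) \<le> B * (2 * (1 + norm w) ^ 2)"
      using B[OF f(2)] B1 by (intro mult_mono) auto
    then show ?thesis by (simp add: f(1) norm_mult mult_ac)
  qed
  have 7: "((\<lambda>x. wh_factor c (of_real x)) \<longlongrightarrow> 0) at_top"
  proof (rule Lim_null_comparison)
    show "((\<lambda>x. K * x powr (- c)) \<longlongrightarrow> 0) at_top"
      using tendsto_mult[OF tendsto_const[of K] tendsto_neg_powr[of "- c", OF _ filterlim_ident]] c by simp
    show "\<forall>\<^sub>F x in at_top. norm (wh_factor c (of_real x)) \<le> K * x powr (- c)"
      using eventually_gt_at_top[of "0::real"]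
    proof eventually_elim
      case (elim x)
      then have "norm (mb (Ln (of_real x))) \<le> K * exp (- c * Re (Ln (of_real x)))"
        by (intro K(2) unshifted) auto
      then show ?case using elim by (simp add: wf ReLn Ln_of_real powr_def)
    qed
  qed
  have 8: "wh_factor c z * (1 + stable_exponent \<alpha> \<rho> (- Im z)) = wh_dual c (- z)" if z: "Re z = 0" for z
  proof (cases "z = 0")
    case True
    then show ?thesis by (simp add: wh_factor_def wh_dual_def stable_exponent_def)
  next
    case False
    then have im: "Im z \<noteq> 0" using z by (auto simp: complex_eq_iff)
    show ?thesis
    proof (cases "0 \<le> Im (- z)")
      case True
      then have "Ln z = Ln (- z) - \<i> * of_real pi" using Ln_minus[of "- z"] im z False by simp
      moreover have "stable_exponent \<alpha> \<rho> (- Im z) = exp (of_real \<alpha> * Ln (- z) - \<i> * of_real (pi * \<alpha> * \<rho>))"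
        using stable_exponent_Ln[of "- z" \<alpha> \<rho>] z False True by simp
      ultimately show ?thesis using True False by (simp only: wf[OF False] wh_dual_def up if_True neg_equal_0_iff_equal if_False)
    next
      case neg: False
      then have "Ln z = Ln (- z) + \<i> * of_real pi" using Ln_minus[of "- z"] im z False by simp
      moreover have "stable_exponent \<alpha> \<rho> (- Im z) = exp (of_real \<alpha> * Ln (- z) + \<i> * of_real (pi * \<alpha> * \<rho>))"
        using stable_exponent_Ln[of "- z" \<alpha> \<rho>] z False neg by simp
      ultimately show ?thesis using neg False by (simp only: wf[OF False] wh_dual_def lo if_True neg_equal_0_iff_equal if_False)
    qed
  qed
  show ?thesis
    using 1 2 3 4 5 6 7 8 by (intro exI[of _ "2 * B"]) blast
qed

end

section \<open>Exponential and gamma variables\<close>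

lemma laplace_exp_law:
  assumes z: "0 \<le> Re z"
  shows "laplace exp_law z = 1 / (1 + z)"
proof -
  define f where "f t = exp (- (1 + z) * of_real t)" for t :: real
  define F where "F t = - f t / (1 + z)" for t
  have nz: "1 + z \<noteq> 0" using z by (auto simp: complex_eq_iff)
  have nf: "norm (f t) \<le> exp (- t)" if "0 \<le> t" for t
  proof -
    have "- (1 + Re z) * t \<le> - t" using mult_nonneg_nonneg[OF z that] by (simp add: algebra_simps)
    then show ?thesis by (simp add: f_def)
  qed
  have "integrable lborel (\<lambda>t. exp (- 1 * \<bar>t\<bar>) :: real)" by (rule integrable_exp_minus_abs) simp
  then have int: "set_integrable lborel {0<..} f"
    unfolding set_integrable_def
  proof (rule Bochner_Integration.integrable_bound)
    have "f \<in> borel_measurable borel" unfolding f_def by (intro borel_measurable_continuous_onI continuous_intros)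
    then show "(\<lambda>t. indicator {0<..} t *\<^sub>R f t) \<in> borel_measurable lborel" by simp
    show "AE t in lborel. norm (indicator {0<..} t *\<^sub>R f t) \<le> norm (exp (- 1 * \<bar>t\<bar>))"
      by (intro AE_I2) (auto simp: indicator_def intro: nf[simplified])
  qed
  have "(LBINT t=0..\<infinity>. f t) = 0 - (- 1 / (1 + z))"
  proof (rule interval_integral_FTC_integrable[where F = F])
    show "(F has_vector_derivative f t) (at t)" for t
    proof -
      have "((\<lambda>s. - exp (- q * s) / q) has_field_derivative exp (- q * w)) (at w)" if "q \<noteq> 0" for q w :: complex
        using that by (auto intro!: derivative_eq_intros)
      from this[OF nz, of "of_real t"]
      have "((\<lambda>s. - exp (- (1 + z) * s) / (1 + z)) has_field_derivative f t) (at (of_real t))"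
        unfolding f_def .
      then show ?thesis unfolding F_def f_def by (rule has_vector_derivative_real_field)
    qed
    show "isCont f t" for t unfolding f_def by (intro continuous_intros)
    show "set_integrable lborel (einterval 0 \<infinity>) f"
      using int by (simp add: einterval_def greaterThan_def zero_ereal_def)
    have "isCont F 0" unfolding F_def f_def by (intro continuous_intros) (use nz in auto)
    then have "(F \<longlongrightarrow> F 0) (at_right 0)" by (simp add: isCont_def filterlim_at_split)
    then show "((F \<circ> real_of_ereal) \<longlongrightarrow> - 1 / (1 + z)) (at_right 0)"
      by (simp add: zero_ereal_def ereal_tendsto_simps F_def f_def)
    have "(F \<longlongrightarrow> 0) at_top"
    proof (rule Lim_null_comparison)
      show "\<forall>\<^sub>F t in at_top. norm (F t) \<le> exp (- t) / norm (1 + z)"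
        using eventually_gt_at_top[of "0 :: real"]
        by eventually_elim (auto simp: F_def norm_divide intro!: divide_right_mono nf)
      have "((\<lambda>t. exp (- t)) \<longlongrightarrow> (0 :: real)) at_top"
        by (rule filterlim_compose[OF exp_at_bot]) (rule filterlim_uminus_at_bot_at_top)
      then show "((\<lambda>t. exp (- t) / norm (1 + z)) \<longlongrightarrow> 0) at_top"
        using tendsto_divide[OF _ tendsto_const[of "norm (1 + z)"]] nz by fastforce
    qed
    then show "((F \<circ> real_of_ereal) \<longlongrightarrow> 0) (at_left \<infinity>)" by (simp add: ereal_tendsto_simps)
  qed auto
  moreover have "(LBINT t=0..\<infinity>. f t) = (LINT t|lborel. indicator {0<..} t *\<^sub>R f t)"
    by (simp add: interval_lebesgue_integral_def set_lebesgue_integral_def einterval_def greaterThan_def zero_ereal_def)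
  moreover have "laplace exp_law z = (LINT t|lborel. indicator {0<..} t *\<^sub>R f t)"
  proof -
    have m: "(\<lambda>t. exp (- z * of_real t)) \<in> borel_measurable borel"
      by (intro borel_measurable_continuous_onI continuous_intros)
    have "laplace exp_law z = (LINT t|lborel. exponential_density 1 t *\<^sub>R exp (- z * of_real t))"
      unfolding laplace_def using m by (subst integral_density) (auto simp: exponential_density_def)
    also have "\<dots> = (LINT t|lborel. indicator {0<..} t *\<^sub>R f t)"
    proof (rule integral_cong_AE)
      show "AE t in lborel. exponential_density 1 t *\<^sub>R exp (- z * of_real t) = indicator {0<..} t *\<^sub>R f t"
        using AE_lborel_singleton[of "0 :: real"]
        by eventually_elim (auto simp: exponential_density_def f_def scaleR_conv_of_real exp_of_real[symmetric] exp_add[symmetric] algebra_simps)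
      have "f \<in> borel_measurable borel" unfolding f_def by (intro borel_measurable_continuous_onI continuous_intros)
      then show "(\<lambda>t. indicator {0<..} t *\<^sub>R f t) \<in> borel_measurable lborel" by simp
    qed (use m in auto)
    finally show ?thesis .
  qed
  ultimately show ?thesis by simp
qed

lemma gamma_density_moment:
  fixes a :: real and p :: complex
  assumes a: "0 < a" and p: "0 < a + Re p"
  shows "integrable lborel (\<lambda>x. gamma_density a x *\<^sub>R exp (p * of_real (ln x)))"
    and "(LINT x|lborel. gamma_density a x *\<^sub>R exp (p * of_real (ln x))) = Gamma (of_real a + p) / Gamma (of_real a)"
proof -
  define w where "w = of_real a + p"
  have w: "0 < Re w" using p by (simp add: w_def)
  define h where "h x = indicator {0<..} x *\<^sub>R (exp ((w - 1) * of_real (ln x)) * exp (- complex_of_real x))" for x :: real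
  have h_eq: "h x = indicator {0<..} x *\<^sub>R (of_real x powr (w - 1) / of_real (exp x))" for x
    by (auto simp: h_def indicator_def powr_def Ln_of_real exp_minus exp_of_real divide_inverse)
  have meas: "h \<in> borel_measurable lborel" unfolding h_def by measurable
  have "integrable lebesgue h"
    using absolutely_integrable_Gamma_integral'[OF w] unfolding set_integrable_def h_eq[abs_def] .
  then have int: "integrable lborel h" using integrable_completion[of h lborel] meas by simp
  have "(LINT x|lborel. h x) = (LINT x|lebesgue. h x)"
    using integral_completion[of h lborel] meas by simp
  also have "\<dots> = integral {0<..} (\<lambda>x. of_real x powr (w - 1) / of_real (exp x))"
    unfolding h_eq using set_lebesgue_integral_eq_integral(2)[OF absolutely_integrable_Gamma_integral'[OF w]]
    by (simp add: set_lebesgue_integral_def)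
  also have "\<dots> = Gamma w" using Gamma_integral_complex'[OF w] by (rule integral_unique)
  finally have val: "(LINT x|lborel. h x) = Gamma w" .
  have Ga: "Gamma (complex_of_real a) = of_real (Gamma a)" by (rule Gamma_complex_of_real)
  have eq: "gamma_density a x *\<^sub>R exp (p * of_real (ln x)) = h x / Gamma (of_real a)" for x
  proof (cases "0 < x")
    case True
    have "complex_of_real (x powr (a - 1) * exp (- x)) = exp (of_real ((a - 1) * ln x)) * exp (- of_real x)"
      using True by (simp add: powr_def exp_of_real[symmetric] exp_minus)
    then have "of_real (x powr (a - 1) * exp (- x)) * exp (p * of_real (ln x)) = exp ((w - 1) * of_real (ln x)) * exp (- complex_of_real x)"
      by (simp only:) (simp add: w_def exp_add[symmetric] algebra_simps)
    then show ?thesis using True by (simp add: gamma_density_def h_def scaleR_conv_of_real Ga mult.commute mult.left_commute)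
  qed (simp add: gamma_density_def h_def)
  show "integrable lborel (\<lambda>x. gamma_density a x *\<^sub>R exp (p * of_real (ln x)))"
    unfolding eq using int by simp
  show "(LINT x|lborel. gamma_density a x *\<^sub>R exp (p * of_real (ln x))) = Gamma (of_real a + p) / Gamma (of_real a)"
    unfolding eq using val by (simp add: w_def)
qed

context prob_space
begin

lemma distributed_moment:
  assumes D: "distributed M lborel X (gamma_density a)" and a: "0 < a" and p: "0 < a + Re p"
  shows "integrable M (\<lambda>\<omega>. exp (p * of_real (ln (X \<omega>))))"
    and "expectation (\<lambda>\<omega>. exp (p * of_real (ln (X \<omega>)))) = Gamma (of_real a + p) / Gamma (of_real a)"
    and "AE \<omega> in M. 0 < X \<omega>"
proof -
  have X: "X \<in> borel_measurable M" using D by (auto dest: distributed_measurable)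
  have d: "distr M lborel X = density lborel (\<lambda>x. ennreal (gamma_density a x))" using D by (rule distributed_distr_eq_density)
  have nonneg: "0 \<le> gamma_density a x" for x using a by (auto simp: gamma_density_def Gamma_real_pos less_imp_le)
  have m: "(\<lambda>x. gamma_density a x) \<in> borel_measurable borel"
    unfolding gamma_density_def by measurable
  let ?g = "\<lambda>x. exp (p * complex_of_real (ln x))"
  have g: "?g \<in> borel_measurable borel" by measurable
  have "integrable (density lborel (\<lambda>x. ennreal (gamma_density a x))) ?g"
    using gamma_density_moment(1)[OF a p] m g nonneg by (subst integrable_density) auto
  then have "integrable (distr M lborel X) ?g" unfolding d .
  then show "integrable M (\<lambda>\<omega>. exp (p * of_real (ln (X \<omega>))))"
    using X g by (subst (asm) integrable_distr_eq) auto
  have "expectation (\<lambda>\<omega>. ?g (X \<omega>)) = (LINT x|distr M lborel X. ?g x)"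
    using X g by (subst integral_distr) auto
  also have "\<dots> = (LINT x|lborel. gamma_density a x *\<^sub>R ?g x)"
    unfolding d using m g nonneg by (subst integral_density) auto
  finally show "expectation (\<lambda>\<omega>. exp (p * of_real (ln (X \<omega>)))) = Gamma (of_real a + p) / Gamma (of_real a)"
    using gamma_density_moment(2)[OF a p] by simp
  have "AE x in density lborel (\<lambda>x. ennreal (gamma_density a x)). 0 < x"
    using m by (subst AE_density) (auto simp: gamma_density_def intro!: AE_I2)
  then have "AE x in distr M lborel X. 0 < x" unfolding d .
  then show "AE \<omega> in M. 0 < X \<omega>" using X by (subst (asm) AE_distr_iff) auto
qed

text \<open>
  Multiplying the argument of a Mellin-Barnes integral by an independent factor multiplies the kernel by
  the moments of that factor.
\<close>
lemma expectation_mellin_barnes: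
  fixes f :: "complex \<Rightarrow> complex" and K :: "'a \<Rightarrow> real"
  assumes f: "(\<lambda>y. f (Complex c y)) \<in> borel_measurable borel"
    and bound: "\<And>y. norm (f (Complex c y)) \<le> B * exp (- \<kappa> * \<bar>y\<bar>)" and \<kappa>: "pi / 2 < \<kappa>"
    and \<zeta>: "\<bar>Im \<zeta>\<bar> \<le> pi / 2"
    and K: "random_variable borel K" and int: "integrable M (\<lambda>\<omega>. exp (- c * ln (K \<omega>)))"
  shows "expectation (\<lambda>\<omega>. mellin_barnes f c (\<zeta> + of_real (ln (K \<omega>)))) =
    mellin_barnes (\<lambda>s. f s * expectation (\<lambda>\<omega>. exp (- s * of_real (ln (K \<omega>))))) c \<zeta>"
proof -
  interpret P: pair_sigma_finite M lborel ..
  note f[measurable] K[measurable]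
  define u where "u y = f (Complex c y) * exp (- Complex c y * \<zeta>)" for y
  define F where "F \<omega> y = u y * exp (- Complex c y * of_real (ln (K \<omega>)))" for \<omega> y
  have [measurable]: "(\<lambda>y. Complex c y) \<in> borel_measurable borel"
    by (intro borel_measurable_continuous_onI continuous_intros)
  have u[measurable]: "u \<in> borel_measurable borel"
    unfolding u_def by measurable
  have nF: "norm (F \<omega> y) = norm (u y) * exp (- c * ln (K \<omega>))" for \<omega> y
    by (simp add: F_def norm_mult)
  have nu: "norm (u y) \<le> (B * exp (- c * Re \<zeta>)) * exp (- (\<kappa> - pi / 2) * \<bar>y\<bar>)" for y
  proof -
    have "y * Im \<zeta> \<le> \<bar>y\<bar> * \<bar>Im \<zeta>\<bar>" by (metis abs_ge_self abs_mult)
    also have "\<dots> \<le> \<bar>y\<bar> * (pi / 2)" using \<zeta> by (intro mult_left_mono) auto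
    finally have *: "y * Im \<zeta> \<le> \<bar>y\<bar> * (pi / 2)" .
    have "norm (u y) \<le> (B * exp (- \<kappa> * \<bar>y\<bar>)) * exp (- c * Re \<zeta> + \<bar>y\<bar> * (pi / 2))"
      unfolding u_def norm_mult norm_exp_cmult using * bound order_trans[OF norm_ge_zero bound] by (intro mult_mono) auto
    also have "\<dots> = (B * exp (- c * Re \<zeta>)) * exp (- (\<kappa> - pi / 2) * \<bar>y\<bar>)"
      by (simp add: mult.assoc exp_add[symmetric] algebra_simps)
    finally show ?thesis .
  qed
  have iu: "integrable lborel u"
  proof (rule Bochner_Integration.integrable_bound)
    show "integrable lborel (\<lambda>y. (B * exp (- c * Re \<zeta>)) * exp (- (\<kappa> - pi / 2) * \<bar>y\<bar>))"
      using integrable_exp_minus_abs[of "\<kappa> - pi / 2"] \<kappa> by simp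
    show "AE y in lborel. norm (u y) \<le> norm ((B * exp (- c * Re \<zeta>)) * exp (- (\<kappa> - pi / 2) * \<bar>y\<bar>))"
      by (intro AE_I2 order_trans[OF nu]) simp
  qed simp
  have "integrable (M \<Otimes>\<^sub>M lborel) (case_prod F)"
  proof (rule P.Fubini_integrable)
    show "case_prod F \<in> borel_measurable (M \<Otimes>\<^sub>M lborel)" unfolding F_def by measurable
    have "(\<lambda>\<omega>. LINT y|lborel. norm (case_prod F (\<omega>, y))) = (\<lambda>\<omega>. (LINT y|lborel. norm (u y)) * exp (- c * ln (K \<omega>)))"
      by (simp add: nF)
    then show "integrable M (\<lambda>\<omega>. LINT y|lborel. norm (case_prod F (\<omega>, y)))" using int by simp
    show "AE \<omega> in M. integrable lborel (\<lambda>y. case_prod F (\<omega>, y))"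
    proof (rule AE_I2)
      fix \<omega> assume \<omega>: "\<omega> \<in> space M"
      have "integrable lborel (\<lambda>y. norm (u y) * exp (- c * ln (K \<omega>)))" using iu by simp
      then show "integrable lborel (\<lambda>y. case_prod F (\<omega>, y))"
        by (rule Bochner_Integration.integrable_bound) (auto simp: nF, simp add: F_def)
    qed
  qed
  from P.Fubini_integral[OF this]
  have swap: "(LINT y|lborel. LINT \<omega>|M. F \<omega> y) = (LINT \<omega>|M. LINT y|lborel. F \<omega> y)" .
  have "mellin_barnes f c (\<zeta> + of_real (ln (K \<omega>))) = (LINT y|lborel. F \<omega> y) / (2 * of_real pi)" for \<omega>
    by (simp add: mellin_barnes_def F_def u_def exp_add[symmetric] distrib_left mult.assoc)
  then have "expectation (\<lambda>\<omega>. mellin_barnes f c (\<zeta> + of_real (ln (K \<omega>)))) = (LINT y|lborel. LINT \<omega>|M. F \<omega> y) / (2 * of_real pi)"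
    unfolding swap by simp
  moreover have "(LINT \<omega>|M. F \<omega> y) = u y * expectation (\<lambda>\<omega>. exp (- Complex c y * of_real (ln (K \<omega>))))" for y
    by (simp add: F_def)
  ultimately show ?thesis by (simp add: mellin_barnes_def u_def mult_ac)
qed

text \<open>
  By independence the moment is a product, and the four gamma functions of each index combine by the
  reflection formula.
\<close>
lemma gamma_ratio_moment:
  fixes a :: "int \<Rightarrow> real" and f :: "'l \<Rightarrow> 'a \<Rightarrow> real"
  assumes J: "finite J" and inj: "inj_on N J" "inj_on D J" "N ` J \<inter> D ` J = {}"
    and indep: "indep_vars (\<lambda>_. borel) f (N ` J \<union> D ` J)"
    and num: "\<And>j. j \<in> J \<Longrightarrow> distributed M lborel (f (N j)) (gamma_density (1 - a j))"
    and den: "\<And>j. j \<in> J \<Longrightarrow> distributed M lborel (f (D j)) (gamma_density (a j))"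
    and a: "\<And>j. j \<in> J \<Longrightarrow> 0 < a j \<and> a j < 1"
    and s: "\<And>j. j \<in> J \<Longrightarrow> - a j < Re s \<and> Re s < 1 - a j"
  shows gamma_ratio_pos: "AE \<omega> in M. 0 < (\<Prod>j\<in>J. f (N j) \<omega> / f (D j) \<omega>)"
    and "integrable M (\<lambda>\<omega>. exp (- s * of_real (ln (\<Prod>j\<in>J. f (N j) \<omega> / f (D j) \<omega>))))"
    and "expectation (\<lambda>\<omega>. exp (- s * of_real (ln (\<Prod>j\<in>J. f (N j) \<omega> / f (D j) \<omega>)))) =
      (\<Prod>j\<in>J. sin (of_real pi * of_real (a j)) / sin (of_real pi * (of_real (a j) + s)))"
proof -
  define e where "e i = (if i \<in> N ` J then - s else s)" for i
  define Y where "Y i \<omega> = exp (e i * of_real (ln (f i \<omega>)))" for i \<omega>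
  have eN: "e (N j) = - s" if "j \<in> J" for j using that by (simp add: e_def)
  have eD: "e (D j) = s" if "j \<in> J" for j using that inj(3) by (auto simp: e_def)
  have mN: "integrable M (Y (N j))" "expectation (Y (N j)) = Gamma (of_real (1 - a j) - s) / Gamma (of_real (1 - a j))" "AE \<omega> in M. 0 < f (N j) \<omega>"
    if j: "j \<in> J" for j
    using distributed_moment[OF num[OF j], of "- s"] a[OF j] s[OF j] by (auto simp: Y_def[abs_def] eN[OF j])
  have mD: "integrable M (Y (D j))" "expectation (Y (D j)) = Gamma (of_real (a j) + s) / Gamma (of_real (a j))" "AE \<omega> in M. 0 < f (D j) \<omega>"
    if j: "j \<in> J" for j
    using distributed_moment[OF den[OF j], of s] a[OF j] s[OF j] by (auto simp: Y_def[abs_def] eD[OF j])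
  have "AE \<omega> in M. \<forall>j\<in>J. 0 < f (N j) \<omega> \<and> 0 < f (D j) \<omega>"
    using mN(3) mD(3) by (intro AE_finite_allI[OF J] AE_conjI)
  then have ae: "AE \<omega> in M. (\<forall>j\<in>J. 0 < f (N j) \<omega> \<and> 0 < f (D j) \<omega>)" .
  show pos: "AE \<omega> in M. 0 < (\<Prod>j\<in>J. f (N j) \<omega> / f (D j) \<omega>)"
    using ae by eventually_elim (auto intro!: prod_pos)
  have prodY: "(\<Prod>i\<in>N ` J \<union> D ` J. g i) = (\<Prod>j\<in>J. g (N j) * g (D j))" for g :: "'l \<Rightarrow> complex"
    using J inj by (subst prod.union_disjoint) (auto simp: prod.reindex prod.distrib)
  have Yeq: "AE \<omega> in M. exp (- s * of_real (ln (\<Prod>j\<in>J. f (N j) \<omega> / f (D j) \<omega>))) = (\<Prod>i\<in>N ` J \<union> D ` J. Y i \<omega>)"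
    using ae
  proof eventually_elim
    case (elim \<omega>)
    have "ln (\<Prod>j\<in>J. f (N j) \<omega> / f (D j) \<omega>) = (\<Sum>j\<in>J. ln (f (N j) \<omega>) - ln (f (D j) \<omega>))"
      using elim J by (subst ln_prod) (auto simp: ln_div intro!: sum.cong)
    then have "exp (- s * of_real (ln (\<Prod>j\<in>J. f (N j) \<omega> / f (D j) \<omega>))) = exp (\<Sum>j\<in>J. - s * (of_real (ln (f (N j) \<omega>)) - of_real (ln (f (D j) \<omega>))))"
      by (simp add: sum_distrib_left)
    also have "\<dots> = (\<Prod>j\<in>J. exp (- s * (of_real (ln (f (N j) \<omega>)) - of_real (ln (f (D j) \<omega>)))))"
      using J by (rule exp_sum)
    also have "\<dots> = (\<Prod>j\<in>J. Y (N j) \<omega> * Y (D j) \<omega>)"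
      by (intro prod.cong) (auto simp: Y_def eN eD exp_add[symmetric] algebra_simps)
    finally show ?case unfolding prodY .
  qed
  have fin: "finite (N ` J \<union> D ` J)" using J by simp
  have indY: "indep_vars (\<lambda>_. borel) Y (N ` J \<union> D ` J)"
    unfolding Y_def by (rule indep_vars_compose2[OF indep]) measurable
  have intY: "integrable M (Y i)" if "i \<in> N ` J \<union> D ` J" for i using that mN(1) mD(1) by auto
  have measY: "Y i \<in> borel_measurable M" if "i \<in> N ` J \<union> D ` J" for i using intY[OF that] by auto
  have fm: "f i \<in> borel_measurable M" if "i \<in> N ` J \<union> D ` J" for i using indep that by (auto simp: indep_vars_def)
  have lhs_meas: "(\<lambda>\<omega>. exp (- s * of_real (ln (\<Prod>j\<in>J. f (N j) \<omega> / f (D j) \<omega>)))) \<in> borel_measurable M"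
  proof -
    have "(\<lambda>\<omega>. \<Prod>j\<in>J. f (N j) \<omega> / f (D j) \<omega>) \<in> borel_measurable M"
      using fm by (intro borel_measurable_prod borel_measurable_divide) auto
    then show ?thesis by measurable
  qed
  have rhs_meas: "(\<lambda>\<omega>. \<Prod>i\<in>N ` J \<union> D ` J. Y i \<omega>) \<in> borel_measurable M"
    using measY by (intro borel_measurable_prod) auto
  have "integrable M (\<lambda>\<omega>. \<Prod>i\<in>N ` J \<union> D ` J. Y i \<omega>)"
    by (rule indep_vars_integrable[OF fin indY intY])
  then show "integrable M (\<lambda>\<omega>. exp (- s * of_real (ln (\<Prod>j\<in>J. f (N j) \<omega> / f (D j) \<omega>))))"
    using integrable_cong_AE[OF lhs_meas rhs_meas Yeq] by simp
  have "expectation (\<lambda>\<omega>. exp (- s * of_real (ln (\<Prod>j\<in>J. f (N j) \<omega> / f (D j) \<omega>)))) = expectation (\<lambda>\<omega>. \<Prod>i\<in>N ` J \<union> D ` J. Y i \<omega>)"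
    by (rule integral_cong_AE[OF lhs_meas rhs_meas Yeq])
  also have "\<dots> = (\<Prod>i\<in>N ` J \<union> D ` J. expectation (Y i))"
    by (rule indep_vars_lebesgue_integral[OF fin indY intY])
  also have "\<dots> = (\<Prod>j\<in>J. expectation (Y (N j)) * expectation (Y (D j)))" by (rule prodY)
  also have "\<dots> = (\<Prod>j\<in>J. sin (of_real pi * of_real (a j)) / sin (of_real pi * (of_real (a j) + s)))"
  proof (intro prod.cong refl)
    fix j assume j: "j \<in> J"
    have r: "Gamma w * Gamma (1 - w) = of_real pi / sin (of_real pi * w)" for w :: complex by (rule Gamma_reflection_complex)
    have "expectation (Y (N j)) * expectation (Y (D j)) =
       (Gamma (of_real (a j) + s) * Gamma (1 - (of_real (a j) + s))) / (Gamma (of_real (a j)) * Gamma (1 - of_real (a j)))"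
      using mN(2)[OF j] mD(2)[OF j] by (simp add: algebra_simps)
    also have "\<dots> = sin (of_real pi * of_real (a j)) / sin (of_real pi * (of_real (a j) + s))"
      unfolding r by simp
    finally show "expectation (Y (N j)) * expectation (Y (D j)) = sin (of_real pi * of_real (a j)) / sin (of_real pi * (of_real (a j) + s))" .
  qed
  finally show "expectation (\<lambda>\<omega>. exp (- s * of_real (ln (\<Prod>j\<in>J. f (N j) \<omega> / f (D j) \<omega>)))) =
      (\<Prod>j\<in>J. sin (of_real pi * of_real (a j)) / sin (of_real pi * (of_real (a j) + s)))" .
qed

end

section \<open>Independence and canonical indices\<close>

text \<open>
  In lowest terms \<open>\<alpha> = m / n\<close> with \<open>n \<le> q\<close> and \<open>m \<le> p\<close>, while the canonical indices satisfy \<open>k < n\<close>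
  and \<open>l < m\<close>.
\<close>
lemma canonical_indices_nonresonant:
  assumes can: "canonical_indices \<alpha> k l" and \<alpha>: "0 < \<alpha>" and q: "0 < q" and eq: "\<alpha> * of_int q = of_int p"
  shows "k < q" "l < p"
proof -
  define g where "g = gcd p q"
  have g: "g > 0" using q by (simp add: g_def)
  obtain m n where mn: "p = m * g" "q = n * g" "coprime m n"
    using gcd_coprime_exists[of p q] g unfolding g_def by auto
  have n: "n > 0" using q g mn(2) by (simp add: zero_less_mult_iff)
  have "\<alpha> * (of_int n * of_int g) = of_int m * of_int g" using eq mn by simp
  then have "\<alpha> * of_int n = of_int m" using g by simp
  then have "\<alpha> = of_int m / of_int n" using n by (simp add: field_simps)
  then have c: "k < n" "1 \<le> l" "l < m" using can n mn(3) unfolding canonical_indices_def by auto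
  have ng: "n \<le> n * g" using mult_left_mono[of 1 g n] g n by simp
  have mg: "m \<le> m * g" using mult_left_mono[of 1 g m] g c by simp
  show "k < q" "l < p" using c mn(1,2) ng mg by linarith+
qed

text \<open>
  Both sines change by the same sign.
\<close>
lemma sin_pi_ratio_frac:
  fixes x :: real and w :: complex
  shows "sin (of_real pi * of_real (frac x)) / sin (of_real pi * (of_real (frac x) + w)) =
    sin (of_real pi * of_real x) / sin (of_real pi * (of_real x + w))"
proof -
  define n where "n = \<lfloor>x\<rfloor>"
  define e where "e = cos (of_int n * complex_of_real pi)"
  have s0: "sin (of_int n * complex_of_real pi) = 0"
    using sin_pi_eq_0_iff[of "of_int n"] by (auto simp: mult.commute)
  then have e: "e \<noteq> 0" unfolding e_def using sin_cos_squared_add[of "of_int n * complex_of_real pi"] by auto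
  have shift: "sin (v - of_int n * of_real pi) = e * sin v" for v
    by (simp add: sin_diff s0 e_def)
  have "of_real pi * of_real (frac x) = of_real pi * of_real x - of_int n * complex_of_real pi"
    "of_real pi * (of_real (frac x) + w) = of_real pi * (of_real x + w) - of_int n * complex_of_real pi"
    by (simp_all add: frac_def n_def algebra_simps)
  then show ?thesis using e by (simp only: shift) simp
qed

lemma sin_pi_nonzero: "0 < Re w \<Longrightarrow> Re w < 1 \<Longrightarrow> sin (of_real pi * w) \<noteq> 0"
proof
  assume w: "0 < Re w" "Re w < 1" and "sin (of_real pi * w) = 0"
  then obtain n :: int where "w = of_int n" unfolding sin_pi_eq_0_iff by blast
  with w have "0 < real_of_int n" "real_of_int n < 1" by auto
  then have "0 < n" "n < 1" by simp_all
  then show False by linarith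
qed

context prob_space
begin

lemma indep_vars_pair:
  assumes "indep_vars (\<lambda>_. borel) f I" "i \<in> I" "j \<in> I" "i \<noteq> j"
  shows "indep_var borel (f i) borel (f j :: 'a \<Rightarrow> real)"
proof -
  have "indep_var (PiM {i} (\<lambda>_. borel)) (\<lambda>\<omega>. restrict (\<lambda>i. f i \<omega>) {i}) (PiM {j} (\<lambda>_. borel)) (\<lambda>\<omega>. restrict (\<lambda>i. f i \<omega>) {j})"
    by (rule indep_var_restrict[OF assms(1)]) (use assms in auto)
  then have "indep_var borel ((\<lambda>x. x i) \<circ> (\<lambda>\<omega>. restrict (\<lambda>i. f i \<omega>) {i})) borel ((\<lambda>x. x j) \<circ> (\<lambda>\<omega>. restrict (\<lambda>i. f i \<omega>) {j}))"
    by (rule indep_var_compose) auto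
  then show ?thesis by (simp add: o_def)
qed

lemma expectation_exp_product:
  assumes ind: "indep_var borel T borel K" and z: "Re z = 0"
  shows "expectation (\<lambda>\<omega>. exp (- z * of_real (T \<omega> * K \<omega>))) = expectation (\<lambda>\<omega>. laplace (distr M borel T) (z * of_real (K \<omega>)))"
proof -
  have T[measurable]: "random_variable borel T" and K[measurable]: "random_variable borel K"
    using ind by (auto dest: indep_var_rv1 indep_var_rv2)
  have joint: "distr M borel T \<Otimes>\<^sub>M distr M borel K = distr M (borel \<Otimes>\<^sub>M borel) (\<lambda>\<omega>. (T \<omega>, K \<omega>))"
    using ind unfolding indep_var_distribution_eq by auto
  interpret T: prob_space "distr M borel T" by (rule prob_space_distr) simp
  interpret K: prob_space "distr M borel K" by (rule prob_space_distr) simp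
  interpret P: pair_prob_space "distr M borel T" "distr M borel K" ..
  define F where "F t k = exp (- z * complex_of_real (t * k))" for t k
  have Fm: "case_prod F \<in> borel_measurable (borel \<Otimes>\<^sub>M borel)" unfolding F_def by measurable
  have "integrable (distr M borel T \<Otimes>\<^sub>M distr M borel K) (case_prod F)"
  proof (rule P.integrable_const_bound[where B = 1])
    show "AE p in distr M borel T \<Otimes>\<^sub>M distr M borel K. norm (case_prod F p) \<le> 1"
      using z by (intro AE_I2) (auto simp: F_def)
    have "sets (distr M borel T \<Otimes>\<^sub>M distr M borel K) = sets (borel \<Otimes>\<^sub>M borel)"
      by (intro sets_pair_measure_cong) auto
    then show "case_prod F \<in> borel_measurable (distr M borel T \<Otimes>\<^sub>M distr M borel K)"
      using Fm measurable_cong_sets by blast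
  qed
  note i = this
  have 1: "integral\<^sup>L (distr M borel T \<Otimes>\<^sub>M distr M borel K) (case_prod F) = (LINT k|distr M borel K. LINT t|distr M borel T. F t k)"
    using P.Fubini_integral[OF i] P.integral_fst'[OF i] by simp
  have 2: "integral\<^sup>L (distr M borel T \<Otimes>\<^sub>M distr M borel K) (case_prod F) = expectation (\<lambda>\<omega>. F (T \<omega>) (K \<omega>))"
    unfolding joint using Fm by (subst integral_distr) auto
  have "(\<lambda>(k, t). F t k) \<in> borel_measurable (borel \<Otimes>\<^sub>M distr M borel T)" unfolding F_def by measurable
  then have "(\<lambda>k. LINT t|distr M borel T. F t k) \<in> borel_measurable borel"
    by (rule T.borel_measurable_lebesgue_integral)
  then have 3: "(LINT k|distr M borel K. LINT t|distr M borel T. F t k) = expectation (\<lambda>\<omega>. LINT t|distr M borel T. F t (K \<omega>))"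
    by (intro integral_distr K)
  have "expectation (\<lambda>\<omega>. F (T \<omega>) (K \<omega>)) = expectation (\<lambda>\<omega>. LINT t|distr M borel T. F t (K \<omega>))"
    using 1 2 3 by simp
  then show ?thesis by (simp add: F_def laplace_def mult_ac)
qed

end

context stable_process
begin

lemma distr_sup_times_exponential:
  assumes \<epsilon>: "distributed M lborel \<epsilon> (exponential_density 1)"
    and ind: "indep_var borel \<epsilon> borel (running_sup X 1)"
  shows "distr M borel (\<lambda>\<omega>. \<epsilon> \<omega> powr (1 / \<alpha>) * running_sup X 1 \<omega>) = exp_sup_law M X \<alpha>"
proof -
  have e[measurable]: "random_variable borel \<epsilon>" and R[measurable]: "random_variable borel (running_sup X 1)"
    using ind by (auto dest: indep_var_rv1 indep_var_rv2)
  interpret E: prob_space exp_law by (rule prob_space_exp_law)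
  interpret P: pair_prob_space exp_law M ..
  have d: "distr M borel \<epsilon> = exp_law"
    using distributed_distr_eq_density[OF \<epsilon>] distr_cong[of M M borel lborel \<epsilon> \<epsilon>] by simp
  have s: "distr M borel (running_sup X 1) = distr M borel (sup_limit X)"
    using AE_sup_limit by (intro distr_cong_AE) auto
  interpret S: prob_space "distr M borel (sup_limit X)" by (rule prob_space_distr) simp
  have joint: "exp_law \<Otimes>\<^sub>M distr M borel (sup_limit X) = distr M (borel \<Otimes>\<^sub>M borel) (\<lambda>\<omega>. (\<epsilon> \<omega>, running_sup X 1 \<omega>))"
    using ind unfolding indep_var_distribution_eq d s by auto
  have "distr M borel (\<lambda>\<omega>. \<epsilon> \<omega> powr (1 / \<alpha>) * running_sup X 1 \<omega>) =
     distr (exp_law \<Otimes>\<^sub>M distr M borel (sup_limit X)) borel (\<lambda>(t, x). t powr (1 / \<alpha>) * x)"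
    unfolding joint by (subst distr_distr) (auto simp: o_def)
  also have "exp_law \<Otimes>\<^sub>M distr M borel (sup_limit X) = distr exp_law borel (\<lambda>t. t) \<Otimes>\<^sub>M distr M borel (sup_limit X)"
    by (subst distr_id2) auto
  also have "\<dots> = distr (exp_law \<Otimes>\<^sub>M M) (borel \<Otimes>\<^sub>M borel) (\<lambda>(t, \<omega>). (t, sup_limit X \<omega>))"
    by (rule pair_measure_distr) (auto intro: S.sigma_finite_measure_axioms)
  also have "distr (distr (exp_law \<Otimes>\<^sub>M M) (borel \<Otimes>\<^sub>M borel) (\<lambda>(t, \<omega>). (t, sup_limit X \<omega>))) borel (\<lambda>(t, x). t powr (1 / \<alpha>) * x) = exp_sup_law M X \<alpha>"
    unfolding exp_sup_law_def by (subst distr_distr) (auto simp: o_def split_beta')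
  finally show ?thesis .
qed

end

lemma exponential_AE_pos:
  assumes "distributed M lborel \<epsilon> (exponential_density 1)"
  shows "AE \<omega> in M. 0 < \<epsilon> \<omega>"
proof -
  have d: "distr M lborel \<epsilon> = exp_law" using assms by (rule distributed_distr_eq_density)
  have m: "\<epsilon> \<in> measurable M lborel" using assms by (rule distributed_measurable)
  have "AE x in distr M lborel \<epsilon>. 0 < x" unfolding d by (rule AE_exp_law_pos)
  then show ?thesis using m by (subst (asm) AE_distr_iff) auto
qed

context stable_indices
begin

lemma frac_mult_pos:
  assumes "j \<in> {1..k}" shows "0 < frac (\<alpha> * of_int j)"
proof -
  have "frac (\<alpha> * of_int j) \<noteq> 0"
  proof
    assume "frac (\<alpha> * of_int j) = 0"
    then have "\<alpha> * of_int j = of_int \<lfloor>\<alpha> * of_int j\<rfloor>" by (simp add: frac_def)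
    then show False using alpha_mult[of j] assms by auto
  qed
  then show ?thesis using frac_ge_0[of "\<alpha> * of_int j"] by linarith
qed

lemma frac_div_pos:
  assumes "j \<in> {1..l - 1}" shows "0 < frac (of_int j / \<alpha>)"
proof -
  have "frac (of_int j / \<alpha>) \<noteq> 0"
  proof
    assume "frac (of_int j / \<alpha>) = 0"
    then have "of_int j / \<alpha> = of_int \<lfloor>of_int j / \<alpha>\<rfloor>" by (simp add: frac_def)
    then have "\<alpha> * of_int \<lfloor>of_int j / \<alpha>\<rfloor> = of_int j" using \<alpha> by (simp add: field_simps)
    then show False using alpha_div[of j] assms by auto
  qed
  then show ?thesis using frac_ge_0[of "of_int j / \<alpha>"] by linarith
qed

lemma sin_ratio_num_inverse:
  assumes s: "\<And>j. j \<in> {1..l - 1} \<Longrightarrow> 0 < frac (of_int j / \<alpha>) - Re s / \<alpha> \<and> frac (of_int j / \<alpha>) - Re s / \<alpha> < 1"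
  shows "sin_ratio_num \<alpha> l s * (\<Prod>j\<in>{1..l - 1}. sin (of_real pi * of_real (1 - frac (of_int j / \<alpha>))) / sin (of_real pi * (of_real (1 - frac (of_int j / \<alpha>)) + s / of_real \<alpha>))) = 1"
  unfolding sin_ratio_num_def prod.distrib[symmetric]
proof (rule prod.neutral, rule ballI)
  fix j assume j: "j \<in> {1..l - 1}"
  define f where "f = complex_of_real (frac (of_int j / \<alpha>))"
  have refl: "sin (of_real pi * (1 - w)) = sin (of_real pi * w)" for w :: complex
    by (simp add: right_diff_distrib sin_diff)
  have r1: "sin (of_real pi * of_real (1 - frac (of_int j / \<alpha>))) = sin (of_real pi * f)"
    using refl[of f] by (simp add: f_def)
  have r2: "sin (of_real pi * (of_real (1 - frac (of_int j / \<alpha>)) + s / of_real \<alpha>)) = sin (of_real pi * (f + (- s / of_real \<alpha>)))"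
    using refl[of "f - s / of_real \<alpha>"] by (simp add: f_def algebra_simps)
  have nz: "sin (of_real pi * (f + (- s / of_real \<alpha>))) \<noteq> 0"
    by (rule sin_pi_nonzero) (use s[OF j] in \<open>simp_all add: f_def\<close>)
  have nz0: "sin (of_real pi * (of_int j / of_real \<alpha>)) \<noteq> (0 :: complex)" by (rule sin_num_nonzero[OF j])
  have fr: "sin (of_real pi * f) / sin (of_real pi * (f + (- s / of_real \<alpha>))) =
    sin (of_real pi * (of_int j / of_real \<alpha>)) / sin (of_real pi * ((of_int j - s) / of_real \<alpha>))"
    using sin_pi_ratio_frac[of "of_int j / \<alpha>" "- s / of_real \<alpha>"] by (simp add: f_def diff_divide_distrib)
  have f0: "sin (of_real pi * f) \<noteq> 0"
    by (rule sin_pi_nonzero) (use frac_div_pos[OF j] in \<open>simp_all add: f_def frac_lt_1\<close>)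
  have "sin (of_real pi * ((of_int j - s) / of_real \<alpha>)) \<noteq> 0"
  proof
    assume "sin (of_real pi * ((of_int j - s) / of_real \<alpha>)) = 0"
    with fr have "sin (of_real pi * f) / sin (of_real pi * (f + (- s / of_real \<alpha>))) = 0" by (simp only: div_by_0)
    then show False using nz f0 by (simp only: divide_eq_0_iff simp_thms)
  qed
  then show "sin (of_real pi * ((of_int j - s) / of_real \<alpha>)) / sin (of_real pi * (of_int j / of_real \<alpha>)) *
     (sin (of_real pi * of_real (1 - frac (of_int j / \<alpha>))) / sin (of_real pi * (of_real (1 - frac (of_int j / \<alpha>)) + s / of_real \<alpha>))) = 1"
    unfolding r1 r2 fr using nz0 by simp
qed

lemma sin_ratio_den_inverse:
  assumes s: "\<And>j. j \<in> {1..k} \<Longrightarrow> 0 < frac (\<alpha> * of_int j) + Re s \<and> frac (\<alpha> * of_int j) + Re s < 1"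
  shows "sin_ratio_den \<alpha> k s * (\<Prod>j\<in>{1..k}. sin (of_real pi * of_real (frac (\<alpha> * of_int j))) / sin (of_real pi * (of_real (frac (\<alpha> * of_int j)) + s))) = 1"
  unfolding sin_ratio_den_def prod.distrib[symmetric]
proof (rule prod.neutral, rule ballI)
  fix j assume j: "j \<in> {1..k}"
  define f where "f = complex_of_real (frac (\<alpha> * of_int j))"
  have nz: "sin (of_real pi * (f + s)) \<noteq> 0"
    by (rule sin_pi_nonzero) (use s[OF j] in \<open>simp_all add: f_def\<close>)
  have f0: "sin (of_real pi * f) \<noteq> 0"
    by (rule sin_pi_nonzero) (use frac_mult_pos[OF j] in \<open>simp_all add: f_def frac_lt_1\<close>)
  have nz0: "sin (of_real pi * (of_real \<alpha> * of_int j)) \<noteq> (0 :: complex)" by (rule sin_den_nonzero[OF j])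
  have fr: "sin (of_real pi * f) / sin (of_real pi * (f + s)) =
    sin (of_real pi * (of_real \<alpha> * of_int j)) / sin (of_real pi * (of_real \<alpha> * of_int j + s))"
    using sin_pi_ratio_frac[of "\<alpha> * of_int j" s] by (simp add: f_def)
  have "sin (of_real pi * (of_real \<alpha> * of_int j + s)) \<noteq> 0"
  proof
    assume "sin (of_real pi * (of_real \<alpha> * of_int j + s)) = 0"
    with fr have "sin (of_real pi * f) / sin (of_real pi * (f + s)) = 0" by (simp only: div_by_0)
    then show False using nz f0 by (simp only: divide_eq_0_iff simp_thms)
  qed
  then show "sin (of_real pi * (of_real \<alpha> * of_int j + s)) / sin (of_real pi * (of_real \<alpha> * of_int j)) *
     (sin (of_real pi * of_real (frac (\<alpha> * of_int j))) / sin (of_real pi * (of_real (frac (\<alpha> * of_int j)) + s))) = 1"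
    unfolding f_def[symmetric] fr using nz0 by simp
qed

text \<open>
  On a line this close to the imaginary axis all moments of the gamma variables are finite.
\<close>
lemma line_exists:
  "\<exists>c>0. c < \<alpha> * \<rho> \<and> c < 1 \<and> (\<forall>j\<in>{1..k}. c < 1 - frac (\<alpha> * of_int j)) \<and> (\<forall>j\<in>{1..l - 1}. c / \<alpha> < frac (of_int j / \<alpha>))"
proof -
  define S where "S = insert (\<alpha> * \<rho>) (insert 1 ((\<lambda>j. 1 - frac (\<alpha> * of_int j)) ` {1..k} \<union> (\<lambda>j. \<alpha> * frac (of_int j / \<alpha>)) ` {1..l - 1}))"
  have fin: "finite S" "S \<noteq> {}" by (auto simp: S_def)
  have pos: "0 < x" if x: "x \<in> S" for x
  proof -
    consider "x = \<alpha> * \<rho>" | "x = 1" | j where "j \<in> {1..k}" "x = 1 - frac (\<alpha> * of_int j)"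
      | j where "j \<in> {1..l - 1}" "x = \<alpha> * frac (of_int j / \<alpha>)"
      using x unfolding S_def by blast
    then show ?thesis
      by cases (use alpha_rho_pos frac_div_pos \<alpha> frac_lt_1 in auto)
  qed
  then have m: "0 < Min S" using fin by simp
  have le: "Min S / 2 < x" if "x \<in> S" for x using Min_le[OF fin(1) that] m by linarith
  show ?thesis
  proof (intro exI[of _ "Min S / 2"] conjI ballI)
    show "Min S / 2 / \<alpha> < frac (of_int j / \<alpha>)" if "j \<in> {1..l - 1}" for j
    proof -
      have "\<alpha> * frac (of_int j / \<alpha>) \<in> S" using that unfolding S_def by blast
      from le[OF this] have "Min S / 2 < frac (of_int j / \<alpha>) * \<alpha>" by (simp only: mult.commute)
      then show ?thesis unfolding pos_divide_less_eq[OF \<alpha>(1)] .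
    qed
    show "Min S / 2 < 1 - frac (\<alpha> * of_int j)" if "j \<in> {1..k}" for j
      by (rule le) (use that in \<open>unfold S_def, blast\<close>)
    show "0 < Min S / 2" using m by simp
    show "Min S / 2 < \<alpha> * \<rho>" "Min S / 2 < 1" by (rule le, simp add: S_def)+
  qed
qed

end

section \<open>The identity in distribution\<close>

lemma sup_transform_mellin_barnes:
  assumes X: "stable_process M X \<alpha> \<rho>" and I: "stable_indices \<alpha> \<rho> k l" and strict: "\<alpha> * \<rho> < 1"
    and c: "0 < c" "c < \<alpha> * \<rho>" and z: "0 \<le> Re z" "z \<noteq> 0"
  shows "stable_process.sup_transform M X \<alpha> z = mellin_barnes (stable_indices.kernel \<alpha> \<rho> k l) c (Ln z)"
proof -
  interpret X: stable_process M X \<alpha> \<rho> by (rule X)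
  interpret I: stable_indices \<alpha> \<rho> k l by (rule I)
  define \<phi> where "\<phi> = I.wh_factor c"
  define \<Delta> where "\<Delta> z = I.wh_dual c (- z)" for z
  obtain B where B: "\<phi> holomorphic_on {z. 0 < Re z}" "continuous_on {z. 0 \<le> Re z} \<phi>"
    "I.wh_dual c holomorphic_on {w. 0 < Re w}" "continuous_on {w. 0 \<le> Re w} (I.wh_dual c)"
    "\<And>z. 0 \<le> Re z \<Longrightarrow> norm (\<phi> z) \<le> B * (1 + norm z) ^ 2"
    "\<And>w. 0 \<le> Re w \<Longrightarrow> norm (I.wh_dual c w) \<le> B * (1 + norm w) ^ 2"
    "((\<lambda>x. \<phi> (of_real x)) \<longlongrightarrow> 0) at_top"
    "\<And>z. Re z = 0 \<Longrightarrow> \<phi> z * (1 + stable_exponent \<alpha> \<rho> (- Im z)) = I.wh_dual c (- z)"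
    using I.wh_candidate[OF strict c] unfolding \<phi>_def by blast
  have "X.sup_transform z = \<phi> z"
  proof (rule X.sup_transform_unique[where \<Delta> = \<Delta> and B = B and m = 2])
    show "\<phi> 0 = 1" by (simp add: \<phi>_def I.wh_factor_def)
    show "\<Delta> holomorphic_on {z. Re z < 0}" unfolding \<Delta>_def
      by (rule holomorphic_on_compose_gen[OF _ B(3), of uminus, unfolded o_def]) (auto intro!: holomorphic_intros)
    show "continuous_on {z. Re z \<le> 0} \<Delta>" unfolding \<Delta>_def
      by (rule continuous_on_compose2[OF B(4)]) (auto intro!: continuous_intros)
    show "norm (\<Delta> w) \<le> B * (1 + norm w) ^ 2" if "Re w \<le> 0" for w
      using B(6)[of "- w"] that by (simp add: \<Delta>_def)
  qed (use B z in \<open>auto simp: \<Delta>_def\<close>)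
  then show ?thesis using z by (simp add: \<phi>_def I.wh_factor_def)
qed

theorem corollary5:
  fixes M :: "'a measure" and X :: "real \<Rightarrow> 'a \<Rightarrow> real"
    and \<alpha> \<rho> :: real and k l :: int
    and \<epsilon>\<^sub>1 \<epsilon>\<^sub>2 :: "'a \<Rightarrow> real"
    and A B C D :: "int \<Rightarrow> 'a \<Rightarrow> real"
  assumes "stable_process_class M X \<alpha> \<rho> k l"
    and "canonical_indices \<alpha> k l"
    and "l > 0"
    and "distributed M lborel \<epsilon>\<^sub>1 (exponential_density 1)"
    and "distributed M lborel \<epsilon>\<^sub>2 (exponential_density 1)"
    and "\<And>j. j \<in> {1..l - 1} \<Longrightarrow>
           distributed M lborel (A j) (gamma_density (frac (of_int j / \<alpha>)))"
    and "\<And>j. j \<in> {1..l - 1} \<Longrightarrow>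
           distributed M lborel (B j) (gamma_density (1 - frac (of_int j / \<alpha>)))"
    and "\<And>j. j \<in> {1..k} \<Longrightarrow>
           distributed M lborel (C j) (gamma_density (1 - frac (\<alpha> * of_int j)))"
    and "\<And>j. j \<in> {1..k} \<Longrightarrow>
           distributed M lborel (D j) (gamma_density (frac (\<alpha> * of_int j)))"
    and "prob_space.indep_vars M (\<lambda>_. borel)
           (case_label (running_sup X 1) \<epsilon>\<^sub>1 \<epsilon>\<^sub>2 A B C D) (labels k l)"
  shows "distr M borel
           (\<lambda>\<omega>. running_sup X 1 \<omega> * (\<epsilon>\<^sub>1 \<omega> * (\<Prod>j = 1..l - 1. A j \<omega> / B j \<omega>)) powr (1 / \<alpha>))
       = distr M borel (\<lambda>\<omega>. \<epsilon>\<^sub>2 \<omega> * (\<Prod>j = 1..k. C j \<omega> / D j \<omega>))"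
proof -
  interpret X: stable_process_class M X \<alpha> \<rho> k l by (rule assms(1))
  have X: "stable_process M X \<alpha> \<rho>" ..
  note \<alpha> = X.alpha_pos X.alpha_less_2
  have \<rho>: "0 < \<rho>"
  proof -
    consider "0 < \<rho>" | "1 < \<alpha>" "1 - 1 / \<alpha> \<le> \<rho>"
      using X.parameters by (auto simp: admissible_def)
    then show ?thesis
    proof cases
      case 2
      then have "1 / \<alpha> < 1" by simp
      with 2 show ?thesis by linarith
    qed
  qed
  have k: "0 \<le> k"
  proof -
    have "0 < of_int l / \<alpha>" using assms(3) \<alpha> by simp
    then have "0 < \<rho> + of_int k" using X.class_eq by simp
    then have "-1 < real_of_int k" using X.index_bounds(2) by linarith
    then show ?thesis by linarith
  qed
  have res: "k < q" "l < p" if "0 < q" "\<alpha> * of_int q = of_int p" for p q :: int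
    using canonical_indices_nonresonant[OF assms(2) \<alpha>(1) that] by auto
  have I: "stable_indices \<alpha> \<rho> k l"
  proof
    show "\<alpha> * of_int q \<noteq> of_int p" if "1 \<le> q" "q \<le> k" for p q using res(1)[of q p] that by auto
    show "\<alpha> * of_int q \<noteq> of_int p" if p: "1 \<le> p" "p \<le> l - 1" for p q
    proof
      assume eq: "\<alpha> * of_int q = of_int p"
      then have "0 < \<alpha> * of_int q" using p by simp
      then have "0 < q" using \<alpha> by (simp add: zero_less_mult_iff)
      from res(2)[OF this eq] p show False by simp
    qed
  qed (use \<alpha> \<rho> k assms(3) X.class_eq in auto)
  interpret I: stable_indices \<alpha> \<rho> k l by (rule I)
  define F where "F = case_label (running_sup X 1) \<epsilon>\<^sub>1 \<epsilon>\<^sub>2 A B C D"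
  have ind: "X.indep_vars (\<lambda>_. borel) F (labels k l)" using assms(10) by (simp add: F_def)
  have F_simps: "F Supremum = running_sup X 1" "F Exp_left = \<epsilon>\<^sub>1" "F Exp_right = \<epsilon>\<^sub>2"
    "F (Num_left j) = A j" "F (Den_left j) = B j" "F (Num_right j) = C j" "F (Den_right j) = D j" for j
    by (simp_all add: F_def)
  define LG where "LG = Num_left ` {1..l - 1} \<union> Den_left ` {1..l - 1}"
  define LH where "LH = Num_right ` {1..k} \<union> Den_right ` {1..k}"
  have lab: "labels k l = {Supremum, Exp_left, Exp_right} \<union> LG \<union> LH"
    by (auto simp: labels_def LG_def LH_def)
  define G where "G \<omega> = (\<Prod>j\<in>{1..l - 1}. F (Num_left j) \<omega> / F (Den_left j) \<omega>)" for \<omega>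
  define H where "H \<omega> = (\<Prod>j\<in>{1..k}. F (Num_right j) \<omega> / F (Den_right j) \<omega>)" for \<omega>
  have indLG: "X.indep_vars (\<lambda>_. borel) F LG" and indLH: "X.indep_vars (\<lambda>_. borel) F LH"
    using X.indep_vars_subset[OF ind] by (auto simp: lab)
  have Fm: "F i \<in> borel_measurable M" if "i \<in> labels k l" for i
    using ind that by (auto simp: X.indep_vars_def)
  have gpos: "AE \<omega> in M. 0 < G \<omega>"
    unfolding G_def
    by (rule X.gamma_ratio_pos[where a = "\<lambda>j. 1 - frac (of_int j / \<alpha>)" and s = 0])
       (use indLG assms(6,7) I.frac_div_pos frac_lt_1 in \<open>auto simp: F_simps LG_def inj_on_def\<close>)
  have hpos: "AE \<omega> in M. 0 < H \<omega>"
    unfolding H_def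
    by (rule X.gamma_ratio_pos[where a = "\<lambda>j. frac (\<alpha> * of_int j)" and s = 0])
       (use indLH assms(8,9) I.frac_mult_pos frac_lt_1 in \<open>auto simp: F_simps LH_def inj_on_def\<close>)
  have epos: "AE \<omega> in M. 0 < \<epsilon>\<^sub>1 \<omega>" using assms(4) by (rule exponential_AE_pos)
  \<comment> \<open>\<open>KG\<close> and \<open>KH\<close> agree almost surely with the two products, the first one with the exponent \<open>1 / \<alpha>\<close>;
      unlike the products they are positive everywhere\<close>
  define T where "T \<omega> = \<epsilon>\<^sub>1 \<omega> powr (1 / \<alpha>) * running_sup X 1 \<omega>" for \<omega>
  define KG where "KG \<omega> = exp (ln (G \<omega>) / \<alpha>)" for \<omega>
  define KH where "KH \<omega> = exp (ln (H \<omega>))" for \<omega>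
  have comp: "X.indep_var borel (g1 \<circ> (\<lambda>\<omega>. restrict (\<lambda>i. F i \<omega>) I1)) borel (g2 \<circ> (\<lambda>\<omega>. restrict (\<lambda>i. F i \<omega>) I2))"
    if "I1 \<inter> I2 = {}" "I1 \<subseteq> labels k l" "I2 \<subseteq> labels k l"
      "g1 \<in> borel_measurable (PiM I1 (\<lambda>_. borel))" "g2 \<in> borel_measurable (PiM I2 (\<lambda>_. borel))"
    for I1 I2 and g1 g2 :: "(label \<Rightarrow> real) \<Rightarrow> real"
    by (rule X.indep_var_compose[OF X.indep_var_restrict[OF ind that(1-3)] that(4,5)])
  have indTG: "X.indep_var borel T borel KG"
  proof -
    let ?g1 = "\<lambda>x :: label \<Rightarrow> real. x Exp_left powr (1 / \<alpha>) * x Supremum"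
    let ?g2 = "\<lambda>x :: label \<Rightarrow> real. exp (ln (\<Prod>j\<in>{1..l - 1}. x (Num_left j) / x (Den_left j)) / \<alpha>)"
    have "X.indep_var borel (?g1 \<circ> (\<lambda>\<omega>. restrict (\<lambda>i. F i \<omega>) {Supremum, Exp_left})) borel (?g2 \<circ> (\<lambda>\<omega>. restrict (\<lambda>i. F i \<omega>) LG))"
    proof (rule comp)
      show "?g1 \<in> borel_measurable (PiM {Supremum, Exp_left} (\<lambda>_. borel))" by measurable
      have "(\<lambda>x. \<Prod>j\<in>{1..l - 1}. x (Num_left j) / x (Den_left j)) \<in> borel_measurable (PiM LG (\<lambda>_. borel :: real measure))"
        by (intro borel_measurable_prod borel_measurable_divide measurable_component_singleton) (auto simp: LG_def)
      then show "?g2 \<in> borel_measurable (PiM LG (\<lambda>_. borel))" by measurable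
    qed (auto simp: lab LG_def)
    moreover have "?g1 \<circ> (\<lambda>\<omega>. restrict (\<lambda>i. F i \<omega>) {Supremum, Exp_left}) = T"
      by (auto simp: T_def F_simps)
    moreover have "?g2 \<circ> (\<lambda>\<omega>. restrict (\<lambda>i. F i \<omega>) LG) = KG"
      by (auto simp: KG_def G_def LG_def fun_eq_iff intro!: arg_cong[where f = ln] prod.cong)
    ultimately show ?thesis by simp
  qed
  have indEH: "X.indep_var borel \<epsilon>\<^sub>2 borel KH"
  proof -
    let ?g1 = "\<lambda>x :: label \<Rightarrow> real. x Exp_right"
    let ?g2 = "\<lambda>x :: label \<Rightarrow> real. exp (ln (\<Prod>j\<in>{1..k}. x (Num_right j) / x (Den_right j)))"
    have "X.indep_var borel (?g1 \<circ> (\<lambda>\<omega>. restrict (\<lambda>i. F i \<omega>) {Exp_right})) borel (?g2 \<circ> (\<lambda>\<omega>. restrict (\<lambda>i. F i \<omega>) LH))"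
    proof (rule comp)
      show "?g1 \<in> borel_measurable (PiM {Exp_right} (\<lambda>_. borel))" by measurable
      have "(\<lambda>x. \<Prod>j\<in>{1..k}. x (Num_right j) / x (Den_right j)) \<in> borel_measurable (PiM LH (\<lambda>_. borel :: real measure))"
        by (intro borel_measurable_prod borel_measurable_divide measurable_component_singleton) (auto simp: LH_def)
      then show "?g2 \<in> borel_measurable (PiM LH (\<lambda>_. borel))" by measurable
    qed (auto simp: lab LH_def)
    moreover have "?g1 \<circ> (\<lambda>\<omega>. restrict (\<lambda>i. F i \<omega>) {Exp_right}) = \<epsilon>\<^sub>2"
      by (auto simp: F_simps)
    moreover have "?g2 \<circ> (\<lambda>\<omega>. restrict (\<lambda>i. F i \<omega>) LH) = KH"
      by (auto simp: KH_def H_def LH_def fun_eq_iff intro!: arg_cong[where f = ln] prod.cong)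
    ultimately show ?thesis by simp
  qed
  have indES: "X.indep_var borel \<epsilon>\<^sub>1 borel (running_sup X 1)"
    using X.indep_vars_pair[OF ind, of Exp_left Supremum] by (simp add: F_simps lab)
  have meas[measurable]: "T \<in> borel_measurable M" "KG \<in> borel_measurable M" "KH \<in> borel_measurable M" "\<epsilon>\<^sub>2 \<in> borel_measurable M"
    "\<epsilon>\<^sub>1 \<in> borel_measurable M" "running_sup X 1 \<in> borel_measurable M"
    using indTG indEH indES by (auto dest: X.indep_var_rv1 X.indep_var_rv2)
  have Gm[measurable]: "G \<in> borel_measurable M" "H \<in> borel_measurable M"
    unfolding G_def H_def by (intro borel_measurable_prod borel_measurable_divide Fm; auto simp: lab LG_def LH_def)+
  have lawT: "laplace (distr M borel T) = X.sup_transform"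
    using X.distr_sup_times_exponential[OF assms(4) indES] by (simp add: T_def[abs_def] X.sup_transform_def)
  have lawE: "laplace (distr M borel \<epsilon>\<^sub>2) z = 1 / (1 + z)" if "0 \<le> Re z" for z
  proof -
    have "distr M borel \<epsilon>\<^sub>2 = exp_law"
      using distributed_distr_eq_density[OF assms(5)] distr_cong[of M M borel lborel \<epsilon>\<^sub>2 \<epsilon>\<^sub>2] by simp
    then show ?thesis using laplace_exp_law[OF that] by simp
  qed
  have main: "X.expectation (\<lambda>\<omega>. exp (- z * of_real (T \<omega> * KG \<omega>))) = X.expectation (\<lambda>\<omega>. exp (- z * of_real (\<epsilon>\<^sub>2 \<omega> * KH \<omega>)))"
    if z: "Re z = 0" "z \<noteq> 0" for z
  proof -
    have left: "X.expectation (\<lambda>\<omega>. exp (- z * of_real (T \<omega> * KG \<omega>))) = X.expectation (\<lambda>\<omega>. X.sup_transform (z * of_real (KG \<omega>)))"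
      using X.expectation_exp_product[OF indTG z(1)] by (simp add: lawT)
    have right: "X.expectation (\<lambda>\<omega>. exp (- z * of_real (\<epsilon>\<^sub>2 \<omega> * KH \<omega>))) = X.expectation (\<lambda>\<omega>. 1 / (1 + z * of_real (KH \<omega>)))"
      using X.expectation_exp_product[OF indEH z(1)] z by (simp add: lawE)
    show ?thesis
    proof (cases "\<alpha> * \<rho> < 1")
      case False
      then have one: "\<alpha> * \<rho> = 1" using X.index_bounds(3) by simp
      have ak: "\<alpha> * of_int k = of_int (l - 1)" using X.class_eq \<alpha> one by (simp add: field_simps)
      \<comment> \<open>a positive \<open>k\<close> would contradict the canonical choice of the indices\<close>
      then have k0: "k = 0" using res(1)[of k "l - 1"] k by fastforce
      then have l1: "l = 1" using ak by simp
      have "KG = (\<lambda>_. 1)" "KH = (\<lambda>_. 1)" by (auto simp: KG_def KH_def G_def H_def k0 l1)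
      then show ?thesis
        unfolding left right using X.sup_transform_spectrally_negative[OF one, of z] z by simp
    next
      case strict: True
      obtain c where c: "0 < c" "c < \<alpha> * \<rho>" "c < 1" "\<And>j. j \<in> {1..k} \<Longrightarrow> c < 1 - frac (\<alpha> * of_int j)"
        "\<And>j. j \<in> {1..l - 1} \<Longrightarrow> c / \<alpha> < frac (of_int j / \<alpha>)"
        using I.line_exists by blast
      define \<zeta> where "\<zeta> = Ln z"
      have \<zeta>: "\<bar>Im \<zeta>\<bar> \<le> pi / 2" unfolding \<zeta>_def by (rule Im_Ln_half_plane(1)) (use z in auto)
      have Lnz: "Ln (z * of_real (exp t)) = \<zeta> + of_real t" for t
        using Ln_times_of_real[of "exp t" z] z Ln_of_real[of "exp t"] by (simp add: \<zeta>_def mult.commute add.commute del: of_real_exp)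
      define f2 where "f2 s = of_real pi / sin (of_real pi * s)" for s :: complex
      have L1: "X.sup_transform (z * of_real (KG \<omega>)) = mellin_barnes I.kernel c (\<zeta> + of_real (ln (KG \<omega>)))" for \<omega>
        using sup_transform_mellin_barnes[OF X I strict c(1,2), of "z * of_real (KG \<omega>)"] z
        by (simp add: KG_def Lnz del: of_real_exp)
      have L2: "1 / (1 + z * of_real (KH \<omega>)) = mellin_barnes f2 c (\<zeta> + of_real (ln (KH \<omega>)))" for \<omega>
      proof -
        have "\<bar>Im \<zeta>\<bar> < pi" using \<zeta> pi_gt_zero by linarith
        then have "\<bar>Im (\<zeta> + of_real (ln (KH \<omega>)))\<bar> < pi" by simp
        from mellin_barnes_logistic(1)[OF c(1,3) this]
        have "mellin_barnes f2 c (\<zeta> + of_real (ln (KH \<omega>))) = 1 / (1 + exp (\<zeta> + of_real (ln (KH \<omega>))))" by (simp add: f2_def[abs_def])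
        also have "exp (\<zeta> + of_real (ln (KH \<omega>))) = z * of_real (KH \<omega>)"
          using z by (simp add: exp_add \<zeta>_def KH_def exp_of_real)
        finally show ?thesis by simp
      qed
      have mom_G: "integrable M (\<lambda>\<omega>. exp (- s * of_real (ln (KG \<omega>))))"
        "sin_ratio_num \<alpha> l s * X.expectation (\<lambda>\<omega>. exp (- s * of_real (ln (KG \<omega>)))) = 1" if s: "Re s = c" for s
      proof -
        have eq: "exp (- s * of_real (ln (KG \<omega>))) = exp (- (s / of_real \<alpha>) * of_real (ln (G \<omega>)))" for \<omega>
          by (simp add: KG_def)
        have bounds: "- (1 - frac (of_int j / \<alpha>)) < Re (s / of_real \<alpha>) \<and> Re (s / of_real \<alpha>) < 1 - (1 - frac (of_int j / \<alpha>))"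
          if j: "j \<in> {1..l - 1}" for j
        proof -
          have "0 < c / \<alpha>" using c(1) \<alpha> by simp
          then show ?thesis using c(5)[OF j] frac_lt_1[of "of_int j / \<alpha>"] s by simp
        qed
        note ratio = X.gamma_ratio_moment[of "{1..l - 1}" Num_left Den_left F "\<lambda>j. 1 - frac (of_int j / \<alpha>)" "s / of_real \<alpha>"]
        have prem: "finite {1..l - 1}" "inj_on Num_left {1..l - 1}" "inj_on Den_left {1..l - 1}"
          "Num_left ` {1..l - 1} \<inter> Den_left ` {1..l - 1} = {}" "X.indep_vars (\<lambda>_. borel) F (Num_left ` {1..l - 1} \<union> Den_left ` {1..l - 1})"
          using indLG by (auto simp: inj_on_def LG_def)
        have laws: "\<And>j. j \<in> {1..l - 1} \<Longrightarrow> distributed M lborel (F (Num_left j)) (gamma_density (1 - (1 - frac (of_int j / \<alpha>))))"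
          "\<And>j. j \<in> {1..l - 1} \<Longrightarrow> distributed M lborel (F (Den_left j)) (gamma_density (1 - frac (of_int j / \<alpha>)))"
          "\<And>j. j \<in> {1..l - 1} \<Longrightarrow> 0 < 1 - frac (of_int j / \<alpha>) \<and> 1 - frac (of_int j / \<alpha>) < 1"
          using assms(6,7) I.frac_div_pos frac_lt_1 by (simp_all add: F_simps)
        show "integrable M (\<lambda>\<omega>. exp (- s * of_real (ln (KG \<omega>))))"
          unfolding eq G_def by (rule ratio(2)[OF prem laws bounds])
        have "X.expectation (\<lambda>\<omega>. exp (- s * of_real (ln (KG \<omega>)))) =
          (\<Prod>j\<in>{1..l - 1}. sin (of_real pi * of_real (1 - frac (of_int j / \<alpha>))) / sin (of_real pi * (of_real (1 - frac (of_int j / \<alpha>)) + s / of_real \<alpha>)))"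
          unfolding eq G_def by (rule ratio(3)[OF prem laws bounds])
        moreover have "0 < frac (of_int j / \<alpha>) - Re s / \<alpha> \<and> frac (of_int j / \<alpha>) - Re s / \<alpha> < 1" if "j \<in> {1..l - 1}" for j
          using bounds[OF that] by simp
        ultimately show "sin_ratio_num \<alpha> l s * X.expectation (\<lambda>\<omega>. exp (- s * of_real (ln (KG \<omega>)))) = 1"
          using I.sin_ratio_num_inverse[of s] by (simp only:)
      qed
      have mom_H: "integrable M (\<lambda>\<omega>. exp (- s * of_real (ln (KH \<omega>))))"
        "sin_ratio_den \<alpha> k s * X.expectation (\<lambda>\<omega>. exp (- s * of_real (ln (KH \<omega>)))) = 1" if s: "Re s = c" for s
      proof -
        have eq: "exp (- s * of_real (ln (KH \<omega>))) = exp (- s * of_real (ln (H \<omega>)))" for \<omega>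
          by (simp add: KH_def)
        have bounds: "- frac (\<alpha> * of_int j) < Re s \<and> Re s < 1 - frac (\<alpha> * of_int j)" if j: "j \<in> {1..k}" for j
          unfolding s using c(1) c(4)[OF j] frac_ge_0[of "\<alpha> * of_int j"] by (intro conjI; linarith)
        note ratio = X.gamma_ratio_moment[of "{1..k}" Num_right Den_right F "\<lambda>j. frac (\<alpha> * of_int j)" s]
        have prem: "finite {1..k}" "inj_on Num_right {1..k}" "inj_on Den_right {1..k}"
          "Num_right ` {1..k} \<inter> Den_right ` {1..k} = {}" "X.indep_vars (\<lambda>_. borel) F (Num_right ` {1..k} \<union> Den_right ` {1..k})"
          using indLH by (auto simp: inj_on_def LH_def)
        have laws: "\<And>j. j \<in> {1..k} \<Longrightarrow> distributed M lborel (F (Num_right j)) (gamma_density (1 - frac (\<alpha> * of_int j)))"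
          "\<And>j. j \<in> {1..k} \<Longrightarrow> distributed M lborel (F (Den_right j)) (gamma_density (frac (\<alpha> * of_int j)))"
          "\<And>j. j \<in> {1..k} \<Longrightarrow> 0 < frac (\<alpha> * of_int j) \<and> frac (\<alpha> * of_int j) < 1"
          using assms(8,9) I.frac_mult_pos frac_lt_1 by (simp_all add: F_simps)
        show "integrable M (\<lambda>\<omega>. exp (- s * of_real (ln (KH \<omega>))))"
          unfolding eq H_def by (rule ratio(2)[OF prem laws bounds])
        have "X.expectation (\<lambda>\<omega>. exp (- s * of_real (ln (KH \<omega>)))) =
          (\<Prod>j\<in>{1..k}. sin (of_real pi * of_real (frac (\<alpha> * of_int j))) / sin (of_real pi * (of_real (frac (\<alpha> * of_int j)) + s)))"
          unfolding eq H_def by (rule ratio(3)[OF prem laws bounds])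
        moreover have "0 < frac (\<alpha> * of_int j) + Re s \<and> frac (\<alpha> * of_int j) + Re s < 1" if "j \<in> {1..k}" for j
          using bounds[OF that] by simp
        ultimately show "sin_ratio_den \<alpha> k s * X.expectation (\<lambda>\<omega>. exp (- s * of_real (ln (KH \<omega>)))) = 1"
          using I.sin_ratio_den_inverse[of s] by (simp only:)
      qed
      have real_mom: "integrable M (\<lambda>\<omega>. exp (- c * ln (K \<omega>)))"
        if "integrable M (\<lambda>\<omega>. exp (- of_real c * complex_of_real (ln (K \<omega>))))" for K
        using integrable_norm[OF that] by simp
      have d: "- \<alpha> < c" "-1 < c" "c < \<alpha> * \<rho>" "c \<noteq> 0" using c \<alpha> by auto
      have E1: "X.expectation (\<lambda>\<omega>. X.sup_transform (z * of_real (KG \<omega>))) =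
        mellin_barnes (\<lambda>s. I.kernel s * X.expectation (\<lambda>\<omega>. exp (- s * of_real (ln (KG \<omega>))))) c \<zeta>"
      proof -
        obtain b where b: "0 < b" "\<And>y. norm (I.kernel (Complex c y)) \<le> b * exp (- (pi + I.decay_rate) * \<bar>y\<bar>)"
          using I.kernel_bound[OF strict d] by blast
        have "pi / 2 < pi + I.decay_rate" using I.decay_rate_pos[OF strict] pi_gt_zero by linarith
        then show ?thesis
          unfolding L1 by (rule X.expectation_mellin_barnes[OF I.kernel_measurable[OF strict d] b(2) _ \<zeta> meas(2) real_mom[OF mom_G(1)]]) simp
      qed
      have E2: "X.expectation (\<lambda>\<omega>. 1 / (1 + z * of_real (KH \<omega>))) =
        mellin_barnes (\<lambda>s. f2 s * X.expectation (\<lambda>\<omega>. exp (- s * of_real (ln (KH \<omega>))))) c \<zeta>"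
      proof -
        obtain b where b: "0 < b" "\<And>s. c \<le> Re s \<Longrightarrow> Re s \<le> c \<Longrightarrow> norm (sinc_inv s) \<le> b * exp (- (3 * pi / 4) * \<bar>Im s\<bar>)"
          using sinc_inv_bound[of c c "3 * pi / 4"] c pi_gt_zero by auto
        have f2: "f2 (Complex c y) = sinc_inv (Complex c y) / Complex c y" for y
          using c by (simp add: f2_def sinc_inv_def complex_eq_iff[of _ 0])
        have bound: "norm (f2 (Complex c y)) \<le> (b / c) * exp (- (3 * pi / 4) * \<bar>y\<bar>)" for y
        proof -
          have "norm (sinc_inv (Complex c y)) / norm (Complex c y) \<le> (b * exp (- (3 * pi / 4) * \<bar>y\<bar>)) / c"
            using b(2)[of "Complex c y"] b(1) c(1) complex_Re_le_cmod[of "Complex c y"] by (intro frac_le) auto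
          then show ?thesis by (simp add: f2 norm_divide)
        qed
        have "(\<lambda>y. f2 (Complex c y)) \<in> borel_measurable borel"
        proof -
          have "continuous_on UNIV (\<lambda>y. sin (of_real pi * Complex c y))" by (intro continuous_intros)
          then have "(\<lambda>y. sin (of_real pi * Complex c y)) \<in> borel_measurable borel" by (rule borel_measurable_continuous_onI)
          then show ?thesis unfolding f2_def by measurable
        qed
        moreover have "pi / 2 < 3 * pi / 4" using pi_gt_zero by linarith
        ultimately show ?thesis
          unfolding L2 by (rule X.expectation_mellin_barnes[OF _ bound _ \<zeta> meas(3) real_mom[OF mom_H(1)]]) simp
      qed
      have "I.kernel s * X.expectation (\<lambda>\<omega>. exp (- s * of_real (ln (KG \<omega>)))) = f2 s * X.expectation (\<lambda>\<omega>. exp (- s * of_real (ln (KH \<omega>))))"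
        if s: "Re s = c" for s
      proof -
        define EG where "EG = X.expectation (\<lambda>\<omega>. exp (- s * of_real (ln (KG \<omega>))))"
        define EH where "EH = X.expectation (\<lambda>\<omega>. exp (- s * of_real (ln (KH \<omega>))))"
        have g: "sin_ratio_num \<alpha> l s * EG = 1" and h: "sin_ratio_den \<alpha> k s * EH = 1"
          using mom_G(2)[OF s] mom_H(2)[OF s] by (simp_all add: EG_def EH_def)
        have r: "sin_ratio_num \<alpha> l s = I.sin_ratio s * sin_ratio_den \<alpha> k s" using s c \<alpha> by (intro I.sin_ratio_eq) auto
        \<comment> \<open>\<open>EG\<close> and \<open>EH\<close> invert numerator and denominator, and \<open>sin_ratio\<close> is the quotient of these\<close>
        have "I.sin_ratio s * EG = EH" using g h r by algebra
        then show ?thesis by (simp add: I.kernel_def f2_def EG_def EH_def mult.assoc)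
      qed
      then show ?thesis unfolding left right E1 E2 mellin_barnes_def by simp
    qed
  qed
  have "distr M borel (\<lambda>\<omega>. T \<omega> * KG \<omega>) = distr M borel (\<lambda>\<omega>. \<epsilon>\<^sub>2 \<omega> * KH \<omega>)"
  proof (rule Levy_uniqueness)
    show "real_distribution (distr M borel (\<lambda>\<omega>. T \<omega> * KG \<omega>))" "real_distribution (distr M borel (\<lambda>\<omega>. \<epsilon>\<^sub>2 \<omega> * KH \<omega>))"
      by (rule real_distribution_distrI[OF X.prob_space_axioms]; measurable)+
    have ch: "char (distr M borel V) t = X.expectation (\<lambda>\<omega>. exp (- (- \<i> * of_real t) * of_real (V \<omega>)))" if "V \<in> borel_measurable M" for V t
      using that by (simp add: char_def integral_distr mult.assoc)
    have "char (distr M borel (\<lambda>\<omega>. T \<omega> * KG \<omega>)) t = char (distr M borel (\<lambda>\<omega>. \<epsilon>\<^sub>2 \<omega> * KH \<omega>)) t" for t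
    proof (cases "t = 0")
      case True
      then show ?thesis by (simp add: ch del: of_real_mult)
    next
      case False
      have "char (distr M borel (\<lambda>\<omega>. T \<omega> * KG \<omega>)) t = X.expectation (\<lambda>\<omega>. exp (- (- \<i> * of_real t) * of_real (T \<omega> * KG \<omega>)))"
        by (rule ch) measurable
      also have "\<dots> = X.expectation (\<lambda>\<omega>. exp (- (- \<i> * of_real t) * of_real (\<epsilon>\<^sub>2 \<omega> * KH \<omega>)))"
        using False by (intro main) auto
      also have "\<dots> = char (distr M borel (\<lambda>\<omega>. \<epsilon>\<^sub>2 \<omega> * KH \<omega>)) t"
        by (rule ch[symmetric]) measurable
      finally show ?thesis .
    qed
    then show "char (distr M borel (\<lambda>\<omega>. T \<omega> * KG \<omega>)) = char (distr M borel (\<lambda>\<omega>. \<epsilon>\<^sub>2 \<omega> * KH \<omega>))" by auto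
  qed
  moreover have "distr M borel (\<lambda>\<omega>. running_sup X 1 \<omega> * (\<epsilon>\<^sub>1 \<omega> * (\<Prod>j = 1..l - 1. A j \<omega> / B j \<omega>)) powr (1 / \<alpha>)) = distr M borel (\<lambda>\<omega>. T \<omega> * KG \<omega>)"
  proof (rule distr_cong_AE)
    show "AE \<omega> in M. running_sup X 1 \<omega> * (\<epsilon>\<^sub>1 \<omega> * (\<Prod>j = 1..l - 1. A j \<omega> / B j \<omega>)) powr (1 / \<alpha>) = T \<omega> * KG \<omega>"
      using gpos epos
    proof eventually_elim
      case (elim \<omega>)
      have "(\<epsilon>\<^sub>1 \<omega> * G \<omega>) powr (1 / \<alpha>) = \<epsilon>\<^sub>1 \<omega> powr (1 / \<alpha>) * KG \<omega>"
        using elim by (simp add: powr_mult KG_def powr_def[of "G \<omega>"])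
      then show ?case by (simp add: T_def G_def F_simps)
    qed
    have "(\<lambda>\<omega>. running_sup X 1 \<omega> * (\<epsilon>\<^sub>1 \<omega> * G \<omega>) powr (1 / \<alpha>)) \<in> borel_measurable M" by measurable
    then show "(\<lambda>\<omega>. running_sup X 1 \<omega> * (\<epsilon>\<^sub>1 \<omega> * (\<Prod>j = 1..l - 1. A j \<omega> / B j \<omega>)) powr (1 / \<alpha>)) \<in> borel_measurable M"
      by (simp add: G_def F_simps)
  qed auto
  moreover have "distr M borel (\<lambda>\<omega>. \<epsilon>\<^sub>2 \<omega> * (\<Prod>j = 1..k. C j \<omega> / D j \<omega>)) = distr M borel (\<lambda>\<omega>. \<epsilon>\<^sub>2 \<omega> * KH \<omega>)"
  proof (rule distr_cong_AE)
    show "AE \<omega> in M. \<epsilon>\<^sub>2 \<omega> * (\<Prod>j = 1..k. C j \<omega> / D j \<omega>) = \<epsilon>\<^sub>2 \<omega> * KH \<omega>"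
      using hpos by eventually_elim (simp add: KH_def H_def F_simps)
    have "(\<lambda>\<omega>. \<epsilon>\<^sub>2 \<omega> * H \<omega>) \<in> borel_measurable M" by measurable
    then show "(\<lambda>\<omega>. \<epsilon>\<^sub>2 \<omega> * (\<Prod>j = 1..k. C j \<omega> / D j \<omega>)) \<in> borel_measurable M"
      by (simp add: H_def F_simps)
  qed auto
  ultimately show ?thesis by simp
qed

end
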